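(* Let $X$ be a separable and piecewise quasiconvex metric space (with quasiconvexity constant $c\ge 1$) and let $T\in\mathbf M_1(X)$. For any $\varepsilon>0$ there exist a cycle $C\in\mathbf M_1(X)$ and a sequence $(P_j)\subset\mathbf N_1(X)$, where each $P_j$ is a finite sum of the form $$\sum_{i=1}^{r}\eta_i[\![\theta_i]\!],\qquad \eta_i\in\mathbb R,\quad \theta_i\in\mathrm{Lip}_1([0,1],X)$$ (with $r$, $\eta_i$, $\theta_i$ depending on $j$), such that $$\mathbf M(T-C-P_j)\to 0\quad\text{as } j\to\infty\qquad\text{and}\qquad \mathbf M(P_j)\le c\,\|\partial T\|_{\mathrm{KR}}+\varepsilon \quad\text{for all } j.$$ Moreover: a) if $X$ is a geodesic space, then the curves $\theta_i$ can be chosen to be geodesics; b) if $X$ is a Banach space, then the $P_j$ can be chosen to be polyhedral.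
   Context: Let $(X,d)$ be a metric space (not assumed complete). $\mathrm{Lip}(X)$ is the space of real-valued Lipschitz functions on $X$, $\mathrm{Lip}(f)$ is the Lipschitz constant, $\mathrm{Lip}_b(X)$ the bounded ones, $\mathrm{Lip}_1(X)$ those with Lipschitz constant at most $1$; $\mathrm{Lip}_1([0,1],X)$ denotes the maps $[0,1]\to X$ with Lipschitz constant at most $1$. A metric $1$-current on $X$ is a bilinear functional $T:\mathrm{Lip}_b(X)\times \mathrm{Lip}(X)\to\mathbb R$ such that: (i) (finite mass) there is a finite Borel measure $\mu$ on $X$ with $|T(f,\pi)|\le \mathrm{Lip}(\pi)\int_X |f|\,d\mu$ for all $(f,\pi)$; the minimal such measure is the mass measure $\|T\|$, and $\mathbf M(T):=\|T\|(X)$; (ii) (continuity) if $\pi_j\to\pi$ pointwise on $X$ and $\sup_j\mathrm{Lip}(\pi_j)<\infty$, then $T(f,\pi_j)\to T(f,\pi)$; (iii) (locality) $T(f,\pi)=0$ whenever $\pi$ is constant on a neighborhood of the support of $f$. The space of metric $1$-currents is $\mathbf M_1(X)$. The boundary is $\partial T(f):=T(1,f)$, $f\in\mathrm{Lip}(X)$; $T$ is a cycle if $\partial T=0$; $T\in\mathbf N_1(X)$ (normal) if moreover there is a finite Borel measure $\nu$ with $|\partial T(f)|\le\int|f|\,d\nu$ for all $f\in\mathrm{Lip}_b(X)$. Kantorovich–Rubinstein norm: $\|\partial T\|_{\mathrm{KR}}:=\sup\{\partial T(f): f\in\mathrm{Lip}_1(X)\}$. For a Lipschitz curve $\theta:[0,1]\to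 X$, $[\![\theta]\!](f,\pi):=\int_0^1 f(\theta(t))\,(\pi\circ\theta)'(t)\,dt$, and $\ell(\theta):=\int_0^1|\dot\theta|(t)\,dt$ with $|\dot\theta|(t)=\limsup_{h\to0^+}d(\theta(t+h),\theta(t))/h$. $X$ is piecewise quasiconvex with constant $c\ge1$ if for all $x,y\in X$ and $\eta>0$ there exist finitely many pairs $(x_1,y_1),\dots,(x_m,y_m)\in X^2$ with $d(x,x_1)+d(y_m,y)+\sum_{i=1}^{m-1}d(x_{i+1},y_i)<\eta$ and Lipschitz curves $\theta_1,\dots,\theta_m:[0,1]\to X$ with $\theta_i(0)=x_i$, $\theta_i(1)=y_i$ and $\sum_{i=1}^m\ell(\theta_i)\le c\,d(x,y)$. A geodesic is a Lipschitz curve $\theta$ with $\ell(\theta)=d(\theta(0),\theta(1))$; a geodesic space is one where any two points are joined by a geodesic (such a space is piecewise quasiconvex with $c=1$). In a Banach space, $[\![x,y]\!]$ is the current of the oriented segment from $x$ to $y$, i.e. $[\![\theta]\!]$ for $\theta(t)=(1-t)x+ty$; a polyhedral $1$-current is a finite sum $\sum_h\eta_h[\![x_h,y_h]\!]$ with $\eta_h\in\mathbb R$. *)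

theory Defs
  imports "HOL-Analysis.Analysis"
begin

text \<open>
  The metric space is the whole of a type of class \<^class>\<open>metric_space\<close>. Functionals are total
  HOL functions, but only their values on pairs \<open>(f, \<pi>)\<close> with \<open>f\<close> bounded Lipschitz and \<open>\<pi>\<close>
  Lipschitz are meaningful; no notion below depends on the other values.
\<close>

type_synonym 'a functional = "('a \<Rightarrow> real) \<Rightarrow> ('a \<Rightarrow> real) \<Rightarrow> real"

definition Lip :: "('a::metric_space \<Rightarrow> real) set"
  where "Lip = {f. \<exists>L. L-lipschitz_on UNIV f}"

definition Lip_b :: "('a::metric_space \<Rightarrow> real) set"
  where "Lip_b = {f \<in> Lip. bounded (range f)}"

definition Lip_1 :: "('a::metric_space \<Rightarrow> real) set"
  where "Lip_1 = {f. 1-lipschitz_on UNIV f}"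

definition lip_const :: "('a::metric_space \<Rightarrow> real) \<Rightarrow> real"
  where "lip_const f = Inf {L. L-lipschitz_on UNIV f}"

definition finite_borel_measure :: "'a::topological_space measure \<Rightarrow> bool"
  where "finite_borel_measure \<mu> \<longleftrightarrow> sets \<mu> = sets borel \<and> finite_measure \<mu>"

definition bilinear_functional :: "'a::metric_space functional \<Rightarrow> bool"
  where "bilinear_functional T \<longleftrightarrow>
    (\<forall>f\<in>Lip_b. \<forall>g\<in>Lip_b. \<forall>\<pi>\<in>Lip. \<forall>a b.
       T (\<lambda>x. a * f x + b * g x) \<pi> = a * T f \<pi> + b * T g \<pi>) \<and>
    (\<forall>f\<in>Lip_b. \<forall>\<pi>\<in>Lip. \<forall>\<sigma>\<in>Lip. \<forall>a b.
       T f (\<lambda>x. a * \<pi> x + b * \<sigma> x) = a * T f \<pi> + b * T f \<sigma>)"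

definition mass_bound :: "'a::metric_space functional \<Rightarrow> 'a measure \<Rightarrow> bool"
  where "mass_bound T \<mu> \<longleftrightarrow> finite_borel_measure \<mu> \<and>
    (\<forall>f\<in>Lip_b. \<forall>\<pi>\<in>Lip. \<bar>T f \<pi>\<bar> \<le> lip_const \<pi> * (LINT x|\<mu>. \<bar>f x\<bar>))"

definition metric_current :: "'a::metric_space functional \<Rightarrow> bool"
  where "metric_current T \<longleftrightarrow>
    bilinear_functional T \<and>
    (\<exists>\<mu>. mass_bound T \<mu>) \<and>
    (\<forall>f\<in>Lip_b. \<forall>\<pi>\<in>Lip. \<forall>\<pi>s. (\<forall>j::nat. \<pi>s j \<in> Lip) \<and> bdd_above (range (\<lambda>j. lip_const (\<pi>s j))) \<and>
       (\<forall>x. (\<lambda>j. \<pi>s j x) \<longlonglongrightarrow> \<pi> x) \<longrightarrow> (\<lambda>j. T f (\<pi>s j)) \<longlonglongrightarrow> T f \<pi>) \<and>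
    (\<forall>f\<in>Lip_b. \<forall>\<pi>\<in>Lip.
       (\<exists>U a. open U \<and> closure {x. f x \<noteq> 0} \<subseteq> U \<and> (\<forall>x\<in>U. \<pi> x = a)) \<longrightarrow> T f \<pi> = 0)"

text \<open>
  On measures with the same sigma-algebra, \<open>\<le>\<close> is the setwise order (lemma \<open>le_measure\<close>), so the
  following is the minimal measure controlling \<open>T\<close>.
\<close>

definition mass_measure :: "'a::metric_space functional \<Rightarrow> 'a measure"
  where "mass_measure T = (LEAST \<mu>. mass_bound T \<mu>)"

definition mass :: "'a::metric_space functional \<Rightarrow> real"
  where "mass T = measure (mass_measure T) UNIV"

definition boundary :: "'a functional \<Rightarrow> ('a \<Rightarrow> real) \<Rightarrow> real"
  where "boundary T f = T (\<lambda>_. 1) f"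

definition cycle :: "'a::metric_space functional \<Rightarrow> bool"
  where "cycle T \<longleftrightarrow> metric_current T \<and> (\<forall>f\<in>Lip. boundary T f = 0)"

definition normal_current :: "'a::metric_space functional \<Rightarrow> bool"
  where "normal_current T \<longleftrightarrow> metric_current T \<and>
    (\<exists>\<nu>. finite_borel_measure \<nu> \<and> (\<forall>f\<in>Lip_b. \<bar>boundary T f\<bar> \<le> (LINT x|\<nu>. \<bar>f x\<bar>)))"

text \<open>
  For a metric current \<open>T\<close> the supremum is finite: \<open>\<bar>boundary T f\<bar> \<le> mass T\<close> for \<open>f \<in> Lip_1\<close>.
\<close>

definition KR_norm :: "(('a::metric_space \<Rightarrow> real) \<Rightarrow> real) \<Rightarrow> real"
  where "KR_norm S = (SUP f\<in>Lip_1. S f)"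

text \<open>
  Curves are total functions on \<open>\<real>\<close> of which only the restriction to \<open>[0,1]\<close> matters. The
  derivative of \<open>\<pi> \<circ> \<theta>\<close> exists almost everywhere in \<open>[0,1]\<close>; since \<^const>\<open>deriv\<close> is unspecified
  on the exceptional null set, the integral is taken with respect to the complete measure
  \<^const>\<open>lebesgue\<close>. The values of \<open>\<theta>\<close> outside \<open>[0,1]\<close> enter only at the endpoints.
\<close>

definition Lipschitz_curve :: "(real \<Rightarrow> 'a::metric_space) \<Rightarrow> bool"
  where "Lipschitz_curve \<theta> \<longleftrightarrow> (\<exists>L. L-lipschitz_on {0..1} \<theta>)"

definition curve_current :: "(real \<Rightarrow> 'a::metric_space) \<Rightarrow> 'a functional"
  where "curve_current \<theta> f \<pi> = (LINT t:{0..1}|lebesgue. f (\<theta> t) * deriv (\<pi> \<circ> \<theta>) t)"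

definition metric_speed :: "(real \<Rightarrow> 'a::metric_space) \<Rightarrow> real \<Rightarrow> real"
  where "metric_speed \<theta> t =
    real_of_ereal (Limsup (at_right 0) (\<lambda>h. ereal (dist (\<theta> (t + h)) (\<theta> t) / h)))"

definition curve_length :: "(real \<Rightarrow> 'a::metric_space) \<Rightarrow> real"
  where "curve_length \<theta> = (LINT t:{0..1}|lebesgue. metric_speed \<theta> t)"

definition geodesic :: "(real \<Rightarrow> 'a::metric_space) \<Rightarrow> bool"
  where "geodesic \<theta> \<longleftrightarrow> Lipschitz_curve \<theta> \<and> curve_length \<theta> = dist (\<theta> 0) (\<theta> 1)"

definition geodesic_space :: "'a::metric_space itself \<Rightarrow> bool"
  where "geodesic_space _ \<longleftrightarrow> (\<forall>x y::'a. \<exists>\<theta>. geodesic \<theta> \<and> \<theta> 0 = x \<and> \<theta> 1 = y)"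

definition piecewise_quasiconvex :: "'a::metric_space itself \<Rightarrow> real \<Rightarrow> bool"
  where "piecewise_quasiconvex _ c \<longleftrightarrow> 1 \<le> c \<and>
    (\<forall>(x::'a) y. \<forall>\<eta>>0. \<exists>m\<ge>1. \<exists>xs ys \<theta>.
       dist x (xs 1) + dist (ys m) y + (\<Sum>i=1..m-1. dist (xs (i + 1)) (ys i)) < \<eta> \<and>
       (\<forall>i\<in>{1..m::nat}. Lipschitz_curve (\<theta> i) \<and> \<theta> i 0 = xs i \<and> \<theta> i 1 = ys i) \<and>
       (\<Sum>i=1..m. curve_length (\<theta> i)) \<le> c * dist x y)"

definition Lip_1_curves :: "(real \<Rightarrow> 'a::metric_space) set"
  where "Lip_1_curves = {\<theta>. 1-lipschitz_on {0..1} \<theta>}"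

definition curve_combination :: "(real \<Rightarrow> 'a::metric_space) set \<Rightarrow> 'a functional \<Rightarrow> bool"
  where "curve_combination \<Theta> P \<longleftrightarrow>
    (\<exists>(r::nat) (\<eta>::nat \<Rightarrow> real) \<theta>. (\<forall>i\<in>{1..r}. \<theta> i \<in> \<Theta>) \<and>
       (\<forall>f\<in>Lip_b. \<forall>\<pi>\<in>Lip. P f \<pi> = (\<Sum>i=1..r. \<eta> i * curve_current (\<theta> i) f \<pi>)))"

definition segment_current :: "'a::real_normed_vector \<Rightarrow> 'a \<Rightarrow> 'a functional"
  where "segment_current x y = curve_current (\<lambda>t. (1 - t) *\<^sub>R x + t *\<^sub>R y)"

definition polyhedral :: "'a::real_normed_vector functional \<Rightarrow> bool"
  where "polyhedral P \<longleftrightarrow>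
    (\<exists>(r::nat) (\<eta>::nat \<Rightarrow> real) x y.
       \<forall>f\<in>Lip_b. \<forall>\<pi>\<in>Lip. P f \<pi> = (\<Sum>i=1..r. \<eta> i * segment_current (x i) (y i) f \<pi>))"

end

(*
  The boundary of T is a functional on Lip(X) that is continuous along pointwise convergent, uniformly
  Lipschitz sequences. By separability this forces, for every delta, a finite set F such that the
  functional is bounded by delta * Lip(f) on the functions vanishing on F; removing the points of F one
  at a time (Hahn-Banach in one dimension) shows that it is delta-close, in the Kantorovich-Rubinstein
  norm, to a finite combination of point masses. Finite duality turns the latter into a sum of
  b_k (delta_{y_k} - delta_{x_k}) with sum |b_k| d(x_k, y_k) at most the norm plus delta, and piecewise
  quasiconvexity replaces each pair by curves, again with a small error on the boundary. Iterating on
  the error gives a mass-convergent series of curves with the same boundary as T and total length at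
  most c times the norm plus epsilon; the difference between T and its sum is the cycle, and the
  partial sums are the P_j.

  That curves are currents rests on the almost everywhere differentiability of Lipschitz functions of
  one variable (Radon-Nikodym plus Vitali); the continuity axiom is integration by parts.
*)
theory Submission
  imports Defs
begin

section \<open>Lipschitz functions of one real variable\<close>

text \<open>The iteration never returns to the current: it carries along the residual functional on
  Lipschitz functions. Subtracting finitely many differences of point values keeps it linear and
  continuous along pointwise convergent sequences, and together with a norm bound this is all that
  the next step consumes. The first step costs c times the norm and each later one c times the
  previous error, always up to a tolerance; tolerances in geometric progression with total
  \<epsilon> / (c + 1) make the excess exactly \<epsilon>.

  The obstacle is the mass. It is read off a LEAST measure, which says nothing until a least
  controlling measure exists, and the setwise order on measures is only partial. A controlling
  density of minimal integral provides it. Afterwards masses are never computed, merely bounded from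
  above through \<open>current_mass_le\<close>.

  General curves, geodesics and segments are handled by one argument, which sees a family of curves
  only through \<open>chainable\<close>. Since that argument wants 1-Lipschitz curves, a curve is
  first cut into pieces, without change of total length.\<close>

lemma Vitali_comparison:
  fixes \<alpha> \<beta> :: "real measure"
  assumes \<alpha>: "sets \<alpha> = sets borel" "absolutely_continuous lborel \<alpha>"
    and \<beta>: "finite_measure \<beta>" "sets \<beta> = sets borel"
    and E: "E \<in> sets borel"
    and small: "\<And>x d. x \<in> E \<Longrightarrow> 0 < d \<Longrightarrow>
      \<exists>a r. 0 < r \<and> r < d \<and> x \<in> ball a r \<and> emeasure \<alpha> (ball a r) \<le> emeasure \<beta> (ball a r)"
  shows "emeasure \<alpha> E \<le> emeasure \<beta> E"
proof -
  have [simp]: "emeasure \<beta> (space \<beta>) \<noteq> \<infinity>"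
    using \<beta>(1) by (simp add: finite_measure.emeasure_finite)
  \<comment> \<open>By outer regularity of the finite measure \<beta> it is enough to compare with
    \<beta> U for every open U around E. Disjoint good balls inside U exhaust E up to a Lebesgue
    null set, which \<alpha> does not see.\<close>
  have "emeasure \<alpha> E \<le> emeasure \<beta> U" if U: "E \<subseteq> U" "open U" for U
  proof -
    define K where "K = {(a, r). 0 < r \<and> ball a r \<subseteq> U \<and> emeasure \<alpha> (ball a r) \<le> emeasure \<beta> (ball a r)}"
    obtain C where C: "countable C" "C \<subseteq> K"
      and disj: "pairwise (\<lambda>i j. disjnt (ball (fst i) (snd i)) (ball (fst j) (snd j))) C"
      and neg: "negligible (E - (\<Union>i\<in>C. ball (fst i) (snd i)))"
    proof (rule Vitali_covering_theorem_balls[of E K fst snd])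
      fix x and d :: real assume x: "x \<in> E" and d: "0 < d"
      obtain k where k: "k > 0" "ball x k \<subseteq> U"
        using U x open_contains_ball by (metis subsetD)
      \<comment> \<open>The balls contain x without being centred there, so a radius below k / 2 is
        what keeps them inside \<open>ball x k\<close>.\<close>
      obtain a r where ar: "0 < r" "r < min d (k / 2)" "x \<in> ball a r"
          "emeasure \<alpha> (ball a r) \<le> emeasure \<beta> (ball a r)"
        using small[OF x, of "min d (k / 2)"] d k by auto
      have "ball a r \<subseteq> ball x k"
        using ar by (auto simp: dist_real_def)
      then show "\<exists>i. i \<in> K \<and> x \<in> ball (fst i) (snd i) \<and> snd i < d"
        using ar k by (intro exI[of _ "(a, r)"]) (auto simp: K_def)
    qed auto
    let ?B = "\<lambda>i. ball (fst i) (snd i) :: real set"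
    have dis: "disjoint_family_on ?B C"
      using disj by (auto simp: disjoint_family_on_def pairwise_def disjnt_def)
    have mU: "(\<Union>i\<in>C. ?B i) \<in> sets borel" by (intro borel_open open_UN) auto
    have null: "E - (\<Union>i\<in>C. ?B i) \<in> null_sets \<alpha>"
    proof -
      have "E - (\<Union>i\<in>C. ?B i) \<in> null_sets lborel"
        using neg E mU negligible_iff_null_sets
        by (metis sets.Diff null_sets_completion_iff sets_lborel)
      then show ?thesis using \<alpha>(2) by (auto simp: absolutely_continuous_def)
    qed
    have "emeasure \<alpha> E \<le> emeasure \<alpha> ((\<Union>i\<in>C. ?B i) \<union> (E - (\<Union>i\<in>C. ?B i)))"
      by (rule emeasure_mono) (use E mU \<alpha> in auto)
    also have "\<dots> = emeasure \<alpha> (\<Union>i\<in>C. ?B i)"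
      by (rule emeasure_Un_null_set) (use mU \<alpha> null in auto)
    also have "\<dots> = (\<integral>\<^sup>+i. emeasure \<alpha> (?B i) \<partial>count_space C)"
      by (rule emeasure_UN_countable) (use C dis \<alpha> in auto)
    also have "\<dots> \<le> (\<integral>\<^sup>+i. emeasure \<beta> (?B i) \<partial>count_space C)"
      by (rule nn_integral_mono) (use C in \<open>auto simp: K_def\<close>)
    also have "\<dots> = emeasure \<beta> (\<Union>i\<in>C. ?B i)"
      by (rule emeasure_UN_countable[symmetric]) (use C dis \<beta> in auto)
    also have "\<dots> \<le> emeasure \<beta> U"
      using C U \<beta> by (intro emeasure_mono) (auto simp: K_def subset_eq split_beta)
    finally show ?thesis .
  qed
  then show ?thesis
    using outer_regular[OF \<beta>(2) _ E] \<beta>(1)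
    by (auto simp: finite_measure.emeasure_finite intro!: INF_greatest)
qed

text \<open>On the set where g < f and the comparison balls shrink to the point,
  \<open>Vitali_comparison\<close> bounds the integral of f by that of g, which forces the set to be
  null. Balls that merely contain x make the admissible points a countable intersection of open
  sets, hence Borel.\<close>

lemma AE_Vitali_density:
  fixes f g :: "real \<Rightarrow> ennreal"
  assumes [measurable]: "f \<in> borel_measurable borel" "g \<in> borel_measurable borel"
    and fin: "\<And>n::nat. emeasure (density lborel g) {- real n<..<real n} < \<infinity>"
  shows "AE x in lborel. (\<forall>d>0. \<exists>a r. 0 < r \<and> r < d \<and> x \<in> ball a r \<and>
      emeasure (density lborel f) (ball a r) \<le> emeasure (density lborel g) (ball a r)) \<longrightarrow> f x \<le> g x"
    (is "AE x in lborel. (\<forall>d>0. ?Q d x) \<longrightarrow> _")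
proof -
  define G where "G d = \<Union>{ball a r |a r. 0 < r \<and> r < d \<and>
      emeasure (density lborel f) (ball a r) \<le> emeasure (density lborel g) (ball a r)}" for d
  have G: "x \<in> G d \<longleftrightarrow> ?Q d x" for x d
    unfolding G_def by blast
  have oG: "open (G d)" for d
    unfolding G_def by (intro open_Union) auto
  define H where "H = (\<Inter>k::nat. G (1 / Suc k))"
  have [measurable]: "H \<in> sets borel"
    unfolding H_def by (rule sets.countable_INT) (auto intro!: borel_open oG)
  have H: "x \<in> H \<longleftrightarrow> (\<forall>d>0. ?Q d x)" for x
  proof
    assume x: "x \<in> H"
    show "\<forall>d>0. ?Q d x"
    proof (intro allI impI)
      fix d :: real assume "d > 0"
      then obtain k :: nat where k: "1 / Suc k < d"
        using nat_approx_posE by blast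
      have "?Q (1 / Suc k) x" using x by (auto simp: H_def G)
      then show "?Q d x" using k by (meson less_trans)
    qed
  next
    assume "\<forall>d>0. ?Q d x"
    then show "x \<in> H" by (auto simp: H_def G)
  qed
  \<comment> \<open>Cutting down to bounded intervals supplies the finite second measure that
    \<open>Vitali_comparison\<close> asks for.\<close>
  have "AE x in lborel. x \<in> {- real n<..<real n} \<longrightarrow> x \<in> H \<longrightarrow> f x \<le> g x" for n
  proof -
    let ?I = "{- real n<..<real n}"
    define E where "E = {x \<in> H. g x < f x} \<inter> ?I"
    have E[measurable]: "E \<in> sets borel" unfolding E_def by measurable
    have "emeasure (density lborel f) E \<le> emeasure (density lborel (\<lambda>x. g x * indicator ?I x)) E"
    proof (rule Vitali_comparison)
      show "absolutely_continuous lborel (density lborel f)"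
        by (rule absolutely_continuousI_density) simp
      show "finite_measure (density lborel (\<lambda>x. g x * indicator ?I x))"
        using fin[of n] by (intro finite_measureI) (simp add: emeasure_density)
      fix x d :: real assume x: "x \<in> E" and d: "d > 0"
      obtain k where k: "k > 0" "ball x k \<subseteq> ?I"
        using x open_contains_ball[of ?I] by (metis E_def IntD2 open_greaterThanLessThan)
      have "x \<in> H" using x by (auto simp: E_def)
      moreover have "0 < min d (k / 2)" using d k by simp
      ultimately have "?Q (min d (k / 2)) x" using H by blast
      then obtain a r where ar: "0 < r" "r < min d (k / 2)" "x \<in> ball a r"
        "emeasure (density lborel f) (ball a r) \<le> emeasure (density lborel g) (ball a r)" by blast
      have "ball a r \<subseteq> ball x k" using ar by (auto simp: dist_real_def)
      then have sub: "ball a r \<subseteq> ?I" using k by blast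
      have "emeasure (density lborel (\<lambda>x. g x * indicator ?I x)) (ball a r) = emeasure (density lborel g) (ball a r)"
        using sub by (auto simp: emeasure_density indicator_def intro!: nn_integral_cong)
      then show "\<exists>a r. 0 < r \<and> r < d \<and> x \<in> ball a r \<and>
        emeasure (density lborel f) (ball a r) \<le> emeasure (density lborel (\<lambda>x. g x * indicator ?I x)) (ball a r)"
        using ar by (intro exI[of _ a] exI[of _ r]) simp
    qed auto
    also have "\<dots> = emeasure (density lborel g) E"
      by (auto simp: emeasure_density E_def indicator_def intro!: nn_integral_cong)
    finally have le: "(\<integral>\<^sup>+x. f x * indicator E x \<partial>lborel) \<le> (\<integral>\<^sup>+x. g x * indicator E x \<partial>lborel)"
      by (simp add: emeasure_density)
    have gfin: "(\<integral>\<^sup>+x. g x * indicator E x \<partial>lborel) \<noteq> \<infinity>"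
    proof -
      have "(\<integral>\<^sup>+x. g x * indicator E x \<partial>lborel) \<le> emeasure (density lborel g) ?I"
        by (auto simp: emeasure_density E_def indicator_def intro!: nn_integral_mono)
      then show ?thesis using fin[of n] by (auto simp: top_unique)
    qed
    have "(\<integral>\<^sup>+x. (f x * indicator E x - g x * indicator E x) \<partial>lborel) = 
        (\<integral>\<^sup>+x. f x * indicator E x \<partial>lborel) - (\<integral>\<^sup>+x. g x * indicator E x \<partial>lborel)"
      by (rule nn_integral_diff) (use gfin in \<open>auto simp: E_def indicator_def\<close>)
    also have "\<dots> = 0" using le gfin by (simp add: diff_eq_0_iff_ennreal top.not_eq_extremum)
    \<comment> \<open>Subtraction in \<open>ennreal\<close> truncates at 0, but on E the difference
      is positive because g < f there; so a vanishing integral makes E null.\<close>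
    finally have "AE x in lborel. f x * indicator E x - g x * indicator E x = 0"
      by (subst (asm) nn_integral_0_iff_AE) auto
    then show ?thesis
    proof (rule AE_mp, intro AE_I2 impI)
      fix x assume "f x * indicator E x - g x * indicator E x = 0" "x \<in> ?I" "x \<in> H"
      then show "f x \<le> g x"
        by (cases "x \<in> E") (auto simp: E_def diff_eq_0_iff_ennreal)
    qed
  qed
  then have "AE x in lborel. \<forall>n::nat. x \<in> {- real n<..<real n} \<longrightarrow> x \<in> H \<longrightarrow> f x \<le> g x"
    by (subst AE_all_countable) auto
  then show ?thesis
  proof (rule AE_mp, intro AE_I2 impI)
    fix x assume *: "\<forall>n::nat. x \<in> {- real n<..<real n} \<longrightarrow> x \<in> H \<longrightarrow> f x \<le> g x" "\<forall>d>0. ?Q d x"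
    obtain n :: nat where "\<bar>x\<bar> < n" using reals_Archimedean2 by blast
    then show "f x \<le> g x" using * H by (auto simp: abs_less_iff)
  qed
qed

text \<open>The image of Lebesgue measure under the inverse of \<open>F\<close> is absolutely continuous because
  Lipschitz maps preserve null sets.\<close>

lemma bilipschitz_density:
  fixes F :: "real \<Rightarrow> real"
  assumes lower: "\<And>x y. x \<le> y \<Longrightarrow> y - x \<le> F y - F x"
    and upper: "\<And>x y. x \<le> y \<Longrightarrow> F y - F x \<le> K * (y - x)"
  obtains g :: "real \<Rightarrow> ennreal" where "g \<in> borel_measurable borel"
    "\<And>a b. a \<le> b \<Longrightarrow> emeasure (density lborel g) {a..b} = ennreal (F b - F a)"
proof -
  have smono: "strict_mono F"
    by (rule strict_monoI) (use lower in \<open>smt (verit, best)\<close>)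
  have inj: "inj F" using smono by (rule strict_mono_imp_inj_on)
  have lips: "\<bar>F y - F x\<bar> \<le> K * \<bar>y - x\<bar>" for x y
    using upper[of x y] upper[of y x] lower[of x y] lower[of y x] by (cases "x \<le> y") (auto simp: abs_if)
  have contF: "continuous_on A F" for A
  proof -
    have "0 \<le> K" using lips[of 1 0] by auto
    then have "K-lipschitz_on A F" using lips by (intro lipschitz_onI) (auto simp: dist_real_def)
    then show ?thesis by (rule lipschitz_on_continuous_on)
  qed
  have surj: "surj F"
  proof (rule surjI[of _ "inv F"])
    fix y
    define x where "x = \<bar>y - F 0\<bar>"
    have "F (-x) \<le> y" "y \<le> F x" "-x \<le> x" using lower[of "-x" 0] lower[of 0 x] by (auto simp: x_def)
    then obtain z where "F z = y" using IVT'[of F "-x" y x] contF by blast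
    then show "F (inv F y) = y" by (metis f_inv_into_f rangeI)
  qed
  define G where "G = inv F"
  have FG [simp]: "F (G y) = y" for y using surj by (simp add: G_def surj_f_inv_f)
  have GF [simp]: "G (F x) = x" for x using inj by (simp add: G_def)
  have Gle: "G x \<le> y \<longleftrightarrow> x \<le> F y" "y \<le> G x \<longleftrightarrow> F y \<le> x" for x y
    using smono by (metis FG strict_mono_less_eq)+
  have "1-lipschitz_on UNIV G"
  proof (rule lipschitz_onI)
    fix x y show "dist (G x) (G y) \<le> 1 * dist x y"
      using lower[of "G x" "G y"] lower[of "G y" "G x"] 
      by (cases "G x \<le> G y") (auto simp: dist_real_def abs_if)
  qed auto
  then have [measurable]: "G \<in> borel_measurable borel"
    by (intro borel_measurable_continuous_onI lipschitz_on_continuous_on)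
  \<comment> \<open>This is the Stieltjes measure of F: the preimage of an interval under G is the
    interval between the values of F at its ends.\<close>
  define \<nu> where "\<nu> = distr lborel borel G"
  have Icc: "emeasure \<nu> {a..b} = ennreal (F b - F a)" if "a \<le> b" for a b
  proof -
    have "G -` {a..b} = {F a..F b}" by (auto simp: Gle)
    moreover have "F a \<le> F b" using lower[OF that] that by auto
    ultimately show ?thesis by (simp add: \<nu>_def emeasure_distr)
  qed
  have ac: "absolutely_continuous lborel \<nu>"
    unfolding absolutely_continuous_def
  proof
    fix N :: "real set" assume N: "N \<in> null_sets lborel"
    have "negligible N"
      using N negligible_iff_null_sets null_sets_completion_iff2 by (auto intro: null_sets_completionI)
    have "negligible (F ` N)"
      by (rule negligible_locally_Lipschitz_image)
         (use \<open>negligible N\<close> lips in \<open>auto intro!: exI[of _ UNIV] exI[of _ K]\<close>)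
    moreover have "F ` N = G -` N" by (force simp: image_iff)
    moreover have "G -` N \<in> sets borel"
      using measurable_sets_borel[of G borel N] N by auto
    ultimately have "G -` N \<in> null_sets lborel"
      by (metis negligible_iff_null_sets null_sets_completion_iff sets_lborel)
    then show "N \<in> null_sets \<nu>" using N by (auto simp: \<nu>_def null_sets_def emeasure_distr)
  qed
  obtain g where "g \<in> borel_measurable lborel" "density lborel g = \<nu>"
    using sigma_finite_measure.Radon_Nikodym[OF sigma_finite_lborel ac] by (auto simp: \<nu>_def)
  then show ?thesis using Icc that by simp
qed

text \<open>Squeeze between rational slopes: outside a null set, no q above g x is reached by the
  mean slopes of arbitrarily small intervals around x, and symmetrically from below. So mean slopes
  over small intervals with x in the interior converge to g x, and a limiting argument admits x as
  an endpoint.\<close>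

lemma bilipschitz_AE_derivative:
  fixes F :: "real \<Rightarrow> real"
  assumes lower: "\<And>x y. x \<le> y \<Longrightarrow> y - x \<le> F y - F x"
    and upper: "\<And>x y. x \<le> y \<Longrightarrow> F y - F x \<le> K * (y - x)"
    and g [measurable]: "g \<in> borel_measurable borel"
    and Icc: "\<And>a b. a \<le> b \<Longrightarrow> emeasure (density lborel g) {a..b} = ennreal (F b - F a)"
  shows "AE x in lborel. g x < \<infinity> \<and> (F has_real_derivative enn2real (g x)) (at x)"
proof -
  let ?\<nu> = "density lborel g"
  have mono: "x \<le> y \<Longrightarrow> F x \<le> F y" for x y using lower[of x y] by auto
  have K: "K \<ge> 0" using lower[of 0 1] upper[of 0 1] by auto
  have pt: "emeasure ?\<nu> {x} = 0" for x using Icc[of x x] by simp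
  have ball: "emeasure ?\<nu> (ball a r) = ennreal (F (a + r) - F (a - r))" if "0 < r" for a r
  proof -
    have "ball a r = {a - r..a + r} - {a - r, a + r}"
      by (auto simp: dist_real_def)
    moreover have "emeasure ?\<nu> {a - r, a + r} = 0"
    proof -
      have "emeasure ?\<nu> {a - r, a + r} \<le> emeasure ?\<nu> {a - r} + emeasure ?\<nu> {a + r}"
        by (metis borel_singleton emeasure_subadditive insert_is_Un sets.empty_sets sets_density sets_lborel)
      then show ?thesis by (simp add: pt)
    qed
    ultimately show ?thesis using that
      by (subst \<open>ball a r = _\<close>, subst emeasure_Diff) (auto simp: Icc)
  qed
  have fin: "emeasure ?\<nu> {- real n<..<real n} < \<infinity>" for n
  proof -
    have "emeasure ?\<nu> {- real n<..<real n} \<le> emeasure ?\<nu> {- real n..real n}"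
      by (intro emeasure_mono) auto
    also have "\<dots> < \<infinity>" by (subst Icc) auto
    finally show ?thesis .
  qed
  have const: "emeasure (density lborel (\<lambda>_. ennreal q)) (ball a r) = ennreal (q * (2 * r))" if "0 < q" "0 < r" for q a r :: real
  proof -
    have "ball a r = {a - r<..<a + r}" by (auto simp: dist_real_def)
    then show ?thesis using that by (simp add: emeasure_density nn_integral_cmult_indicator ennreal_mult')
  qed
  have A: "AE x in lborel. (\<forall>d>0. \<exists>a r. 0 < r \<and> r < d \<and> x \<in> ball a r \<and>
      q * (2 * r) \<le> F (a + r) - F (a - r)) \<longrightarrow> ennreal q \<le> g x" if q: "q > 0" for q
    using AE_Vitali_density[OF borel_measurable_const g fin, of "ennreal q"] 
  proof (rule AE_mp, intro AE_I2 impI)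
    fix x assume *: "(\<forall>d>0. \<exists>a r. 0 < r \<and> r < d \<and> x \<in> ball a r \<and>
      emeasure (density lborel (\<lambda>_. ennreal q)) (ball a r) \<le> emeasure ?\<nu> (ball a r)) \<longrightarrow> ennreal q \<le> g x"
      and **: "\<forall>d>0. \<exists>a r. 0 < r \<and> r < d \<and> x \<in> ball a r \<and> q * (2 * r) \<le> F (a + r) - F (a - r)"
    show "ennreal q \<le> g x"
    proof (rule mp[OF *], intro allI impI)
      fix d :: real assume "d > 0"
      then obtain a r where "0 < r \<and> r < d \<and> x \<in> ball a r \<and> q * (2 * r) \<le> F (a + r) - F (a - r)" using ** by blast
      then show "\<exists>a r. 0 < r \<and> r < d \<and> x \<in> ball a r \<and>
          emeasure (density lborel (\<lambda>_. ennreal q)) (ball a r) \<le> emeasure ?\<nu> (ball a r)"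
        using q by (intro exI[of _ a] exI[of _ r]) (simp add: const ball ennreal_leI)
    qed
  qed
  have fin2: "emeasure (density lborel (\<lambda>_. ennreal q)) {- real n<..<real n} < \<infinity>" for q n
    by (simp add: emeasure_density nn_integral_cmult_indicator ennreal_mult_less_top)
  have B: "AE x in lborel. (\<forall>d>0. \<exists>a r. 0 < r \<and> r < d \<and> x \<in> ball a r \<and>
      F (a + r) - F (a - r) \<le> q * (2 * r)) \<longrightarrow> g x \<le> ennreal q" if q: "q > 0" for q
    using AE_Vitali_density[OF g borel_measurable_const fin2, of q] 
  proof (rule AE_mp, intro AE_I2 impI)
    fix x assume *: "(\<forall>d>0. \<exists>a r. 0 < r \<and> r < d \<and> x \<in> ball a r \<and>
      emeasure ?\<nu> (ball a r) \<le> emeasure (density lborel (\<lambda>_. ennreal q)) (ball a r)) \<longrightarrow> g x \<le> ennreal q"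
      and **: "\<forall>d>0. \<exists>a r. 0 < r \<and> r < d \<and> x \<in> ball a r \<and> F (a + r) - F (a - r) \<le> q * (2 * r)"
    show "g x \<le> ennreal q"
    proof (rule mp[OF *], intro allI impI)
      fix d :: real assume "d > 0"
      then obtain a r where "0 < r \<and> r < d \<and> x \<in> ball a r \<and> F (a + r) - F (a - r) \<le> q * (2 * r)" using ** by blast
      then show "\<exists>a r. 0 < r \<and> r < d \<and> x \<in> ball a r \<and>
          emeasure ?\<nu> (ball a r) \<le> emeasure (density lborel (\<lambda>_. ennreal q)) (ball a r)"
        using q by (intro exI[of _ a] exI[of _ r]) (simp add: const ball ennreal_leI)
    qed
  qed
  let ?A = "\<lambda>q x. (\<forall>d>0. \<exists>a r. 0 < r \<and> r < d \<and> x \<in> ball a r \<and>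
      q * (2 * r) \<le> F (a + r) - F (a - r)) \<longrightarrow> ennreal q \<le> g x"
  let ?B = "\<lambda>q x. (\<forall>d>0. \<exists>a r. 0 < r \<and> r < d \<and> x \<in> ball a r \<and>
      F (a + r) - F (a - r) \<le> q * (2 * r)) \<longrightarrow> g x \<le> ennreal q"
  \<comment> \<open>Restricting to rational slopes keeps the union of the exceptional sets
    countable, hence null.\<close>
  have "AE x in lborel. \<forall>q\<in>\<rat>. 0 < q \<longrightarrow> ?A q x"
    using A by (intro AE_ball_countable' countable_rat) (auto simp del: mem_ball)
  moreover have "AE x in lborel. \<forall>q\<in>\<rat>. 0 < q \<longrightarrow> ?B q x"
    using B by (intro AE_ball_countable' countable_rat) (auto simp del: mem_ball)
  \<comment> \<open>This instance bounds g by K + 1 almost everywhere, so that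
    \<open>enn2real\<close> loses nothing; K + 1 is positive, as \<open>B\<close> requires, because
    0 \<le> K.\<close>
  moreover have "AE x in lborel. ?B (K + 1) x" by (rule B) (use K in simp)
  ultimately show ?thesis
  proof eventually_elim
    case (elim x)
    have "g x \<le> ennreal (K + 1)"
    proof (rule mp[OF elim(3)], intro allI impI)
      fix d :: real assume d: "d > 0"
      have "F (x + d / 2) - F (x - d / 2) \<le> K * d" using upper[of "x - d / 2" "x + d / 2"] d by auto
      also have "\<dots> \<le> (K + 1) * (2 * (d / 2))" using d by (simp add: algebra_simps)
      finally have "F (x + d / 2) - F (x - d / 2) \<le> (K + 1) * (2 * (d / 2))" .
      then show "\<exists>a r. 0 < r \<and> r < d \<and> x \<in> ball a r \<and> F (a + r) - F (a - r) \<le> (K + 1) * (2 * r)"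
        using d by (intro exI[of _ x] exI[of _ "d / 2"]) auto
    qed
    then have gfin: "g x < \<infinity>" by (simp add: le_less_trans)
    define D where "D = enn2real (g x)"
    have gD: "g x = ennreal D" "D \<ge> 0" using gfin by (auto simp: D_def)
    have up: "\<exists>d>0. \<forall>y z. y < x \<longrightarrow> x < z \<longrightarrow> z - y < d \<longrightarrow> F z - F y \<le> q * (z - y)" if Dq: "D < q" for q
    proof -
      obtain q' where q': "q' \<in> \<rat>" "D < q'" "q' < q" using Rats_dense_in_real[OF Dq] by auto
      then have "\<not> ennreal q' \<le> g x" using gD by (simp add: ennreal_le_iff2)
      with elim(1) q' gD obtain d where d: "d > 0" 
        "\<not> (\<exists>a r. 0 < r \<and> r < d \<and> x \<in> ball a r \<and> q' * (2 * r) \<le> F (a + r) - F (a - r))"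
        by (meson le_less_trans)
      show ?thesis
      proof (intro exI[of _ d] conjI allI impI)
        fix y z assume yz: "y < x" "x < z" "z - y < d"
        let ?a = "(y + z) / 2" and ?r = "(z - y) / 2"
        have "x \<in> ball ?a ?r" using yz by (auto simp: dist_real_def abs_less_iff field_simps)
        moreover have "0 < ?r" "?r < d" using yz by auto
        ultimately have "\<not> q' * (2 * ?r) \<le> F (?a + ?r) - F (?a - ?r)" using d(2) by blast
        moreover have "?a + ?r = z" "?a - ?r = y" "2 * ?r = z - y" by (auto simp: field_simps)
        ultimately have "F z - F y < q' * (z - y)" by (metis not_le)
        also have "\<dots> \<le> q * (z - y)" using yz q' by (intro mult_right_mono) auto
        finally show "F z - F y \<le> q * (z - y)" by simp
      qed (use d in auto)
    qed
    have lo: "\<exists>d>0. \<forall>y z. y < x \<longrightarrow> x < z \<longrightarrow> z - y < d \<longrightarrow> q * (z - y) \<le> F z - F y" if Dq: "q < D" for q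
    proof (cases "q < 0")
      \<comment> \<open>Negative slopes are settled by monotonicity alone; \<open>ennreal\<close>
        would collapse them to 0, so the density argument is reserved for q \<ge> 0.\<close>
      case True
      have "q * (z - y) \<le> F z - F y" if "y < x" "x < z" for y z
      proof -
        have "q * (z - y) \<le> 0" using True that by (auto simp: mult_le_0_iff)
        then show ?thesis using mono[of y z] that by auto
      qed
      then show ?thesis by (intro exI[of _ 1]) auto
    next
      case False
      obtain q' where q': "q' \<in> \<rat>" "q < q'" "q' < D" using Rats_dense_in_real[OF Dq] by auto
      then have "\<not> g x \<le> ennreal q'" using gD False by (simp add: ennreal_le_iff2)
      moreover have "0 < q'" using q' False by auto
      ultimately obtain d where d: "d > 0" 
        "\<not> (\<exists>a r. 0 < r \<and> r < d \<and> x \<in> ball a r \<and> F (a + r) - F (a - r) \<le> q' * (2 * r))"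
        using elim(2) q' by blast
      show ?thesis
      proof (intro exI[of _ d] conjI allI impI)
        fix y z assume yz: "y < x" "x < z" "z - y < d"
        let ?a = "(y + z) / 2" and ?r = "(z - y) / 2"
        have "x \<in> ball ?a ?r" using yz by (auto simp: dist_real_def abs_less_iff field_simps)
        moreover have "0 < ?r" "?r < d" using yz by auto
        ultimately have "\<not> F (?a + ?r) - F (?a - ?r) \<le> q' * (2 * ?r)" using d(2) by blast
        moreover have "?a + ?r = z" "?a - ?r = y" "2 * ?r = z - y" by (auto simp: field_simps)
        ultimately have "q' * (z - y) < F z - F y" by (metis not_le)
        moreover have "q * (z - y) \<le> q' * (z - y)" using yz q' by (intro mult_right_mono) auto
        ultimately show "q * (z - y) \<le> F z - F y" by simp
      qed (use d in auto)
    qed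
    have limF: "((\<lambda>s. F (x + c * s)) \<longlongrightarrow> F x) (at_right 0)" for c
    proof (rule tendsto_sandwich[of "\<lambda>s. F x - K * \<bar>c * s\<bar>" _ _ "\<lambda>s. F x + K * \<bar>c * s\<bar>"])
      have *: "\<bar>F (x + c * s) - F x\<bar> \<le> K * \<bar>c * s\<bar>" for s
        using upper[of x "x + c * s"] upper[of "x + c * s" x] mono[of x "x + c * s"] mono[of "x + c * s" x]
        by (cases "c * s \<ge> 0") (auto simp: abs_if)
      show "\<forall>\<^sub>F s in at_right 0. F x - K * \<bar>c * s\<bar> \<le> F (x + c * s)"
        using * by (intro always_eventually) (smt (verit, best))
      show "\<forall>\<^sub>F s in at_right 0. F (x + c * s) \<le> F x + K * \<bar>c * s\<bar>"
        using * by (intro always_eventually) (smt (verit, best))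
      show "((\<lambda>s. F x - K * \<bar>c * s\<bar>) \<longlongrightarrow> F x) (at_right 0)" "((\<lambda>s. F x + K * \<bar>c * s\<bar>) \<longlongrightarrow> F x) (at_right 0)"
        by (auto intro!: tendsto_eq_intros)
    qed
    \<comment> \<open>The bounds \<open>up\<close> and \<open>lo\<close> want x strictly inside the
      interval, whereas a difference quotient at x has x as an endpoint. The endpoint that equals x
      is moved outwards by s and s tends to 0. Taking b = 1 or b = -1 covers the upper and the lower
      bound at once.\<close>
    have one: "\<exists>d>0. \<forall>y z. y \<le> x \<longrightarrow> x \<le> z \<longrightarrow> z - y < d \<longrightarrow> (b * (F z - F y) \<le> b * (q * (z - y)))" 
      if bq: "\<exists>d>0. \<forall>y z. y < x \<longrightarrow> x < z \<longrightarrow> z - y < d \<longrightarrow> (b * (F z - F y) \<le> b * (q * (z - y)))" for q and b :: real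
    proof -
      obtain d where d: "d > 0" "\<And>y z. y < x \<Longrightarrow> x < z \<Longrightarrow> z - y < d \<Longrightarrow> (b * (F z - F y) \<le> b * (q * (z - y)))" 
        using bq by blast
      have "b * (F z - F y) \<le> b * (q * (z - y))" if yz: "y \<le> x" "x \<le> z" "z - y < d" for y z
      proof -
        define c1 c2 where "c1 = (if z = x then 1 else 0 :: real)" and "c2 = (if y = x then - 1 else 0 :: real)"
        have l1: "((\<lambda>s. F (z + c1 * s)) \<longlongrightarrow> F z) (at_right 0)" using limF[of c1] by (cases "z = x") (auto simp: c1_def)
        have l2: "((\<lambda>s. F (y + c2 * s)) \<longlongrightarrow> F y) (at_right 0)" using limF[of c2] by (cases "y = x") (auto simp: c2_def)
        show ?thesis
        proof (rule tendsto_le)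
          show "((\<lambda>s. b * (F (z + c1 * s) - F (y + c2 * s))) \<longlongrightarrow> b * (F z - F y)) (at_right 0)"
            by (intro tendsto_intros l1 l2)
          show "((\<lambda>s. b * (q * ((z + c1 * s) - (y + c2 * s)))) \<longlongrightarrow> b * (q * (z - y))) (at_right 0)"
            by (auto intro!: tendsto_eq_intros)
          have "\<forall>\<^sub>F s in at_right 0. s < (d - (z - y)) / 2"
            using yz by (intro eventually_at_right_field[THEN iffD2] exI[of _ "(d - (z - y)) / 2"]) auto
          then show "\<forall>\<^sub>F s in at_right 0. b * (F (z + c1 * s) - F (y + c2 * s)) \<le> b * (q * ((z + c1 * s) - (y + c2 * s)))"
            using eventually_at_right_less[of 0]
            by eventually_elim (rule d(2), use yz in \<open>auto simp: c1_def c2_def\<close>)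
        qed simp
      qed
      then show ?thesis using d(1) by blast
    qed
    have "(F has_real_derivative D) (at x)"
      unfolding has_field_derivative_iff
    proof (rule order_tendstoI)
      fix a assume a: "a < D"
      then obtain a' where a': "a < a'" "a' < D" using dense by blast
      have "\<exists>d>0. \<forall>y z. y < x \<longrightarrow> x < z \<longrightarrow> z - y < d \<longrightarrow> - 1 * (F z - F y) \<le> - 1 * (a' * (z - y))"
        using lo[OF a'(2)] by (simp only: mult_minus1 neg_le_iff_le)
      from one[OF this]
      obtain d where d: "d > 0" "\<And>y z. y \<le> x \<Longrightarrow> x \<le> z \<Longrightarrow> z - y < d \<Longrightarrow> a' * (z - y) \<le> F z - F y"
        by (simp only: mult_minus1 neg_le_iff_le) blast
      have "\<forall>\<^sub>F y in at x. \<bar>y - x\<bar> < d" using d(1)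
        by (metis (mono_tags, lifting) dist_real_def eventually_at)
      moreover have "\<forall>\<^sub>F y in at x. y \<noteq> x" by (simp add: eventually_at_filter)
      ultimately show "\<forall>\<^sub>F y in at x. a < (F y - F x) / (y - x)"
      proof eventually_elim
        case (elim y)
        show ?case
        proof (cases "x < y")
          case True
          have "a' \<le> (F y - F x) / (y - x)" using d(2)[of x y] elim True by (simp add: pos_le_divide_eq)
          then show ?thesis using a' by simp
        next
          case False
          have "a' \<le> (F x - F y) / (x - y)" using d(2)[of y x] elim False by (simp add: pos_le_divide_eq)
          moreover have "(F x - F y) / (x - y) = (F y - F x) / (y - x)" by (metis minus_diff_eq minus_divide_divide)
          ultimately show ?thesis using a' by simp
        qed
      qed
    next
      fix a assume a: "D < a"
      then obtain a' where a': "a' < a" "D < a'" using dense by blast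
      obtain d where d: "d > 0" "\<And>y z. y \<le> x \<Longrightarrow> x \<le> z \<Longrightarrow> z - y < d \<Longrightarrow> F z - F y \<le> a' * (z - y)"
        using one[of 1 a'] up[OF a'(2)] by auto
      have "\<forall>\<^sub>F y in at x. \<bar>y - x\<bar> < d" using d(1)
        by (metis (mono_tags, lifting) dist_real_def eventually_at)
      moreover have "\<forall>\<^sub>F y in at x. y \<noteq> x" by (simp add: eventually_at_filter)
      ultimately show "\<forall>\<^sub>F y in at x. (F y - F x) / (y - x) < a"
      proof eventually_elim
        case (elim y)
        show ?case
        proof (cases "x < y")
          case True
          have "(F y - F x) / (y - x) \<le> a'" using d(2)[of x y] elim True by (simp add: pos_divide_le_eq)
          then show ?thesis using a' by simp
        next
          case False
          have "(F x - F y) / (x - y) \<le> a'" using d(2)[of y x] elim False by (simp add: pos_divide_le_eq)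
          moreover have "(F x - F y) / (x - y) = (F y - F x) / (y - x)" by (metis minus_diff_eq minus_divide_divide)
          ultimately show ?thesis using a' by simp
        qed
      qed
    qed
    then show ?case using gfin by (simp add: D_def)
  qed
qed

text \<open>Adding the linear term (L + 1) x produces slopes between 1 and 2 L + 1, so the
  bi-Lipschitz case applies; the term is subtracted from the density afterwards. That g is Borel and
  bounded at every point keeps later integrability arguments free of null sets.\<close>

lemma lipschitz_has_AE_derivative:
  fixes u :: "real \<Rightarrow> real"
  assumes u: "L-lipschitz_on UNIV u"
  obtains g where "g \<in> borel_measurable borel"
    "AE x in lborel. (u has_real_derivative g x) (at x)"
    "\<And>x. \<bar>g x\<bar> \<le> L"
    "\<And>a b. a \<le> b \<Longrightarrow> (LINT x:{a..b}|lborel. g x) = u b - u a"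
proof -
  have L: "L \<ge> 0" using u by (rule lipschitz_on_nonneg)
  have lip: "\<bar>u y - u x\<bar> \<le> L * \<bar>y - x\<bar>" for x y
    using lipschitz_onD[OF u, of y x] by (simp add: dist_real_def)
  define F where "F x = u x + (L + 1) * x" for x
  have lower: "y - x \<le> F y - F x" if "x \<le> y" for x y
    using lip[of y x] that by (simp add: F_def algebra_simps abs_le_iff)
  have upper: "F y - F x \<le> (2 * L + 1) * (y - x)" if "x \<le> y" for x y
    using lip[of y x] that by (simp add: F_def algebra_simps abs_le_iff)
  obtain f where f [measurable]: "f \<in> borel_measurable borel"
    and Icc: "\<And>a b. a \<le> b \<Longrightarrow> emeasure (density lborel f) {a..b} = ennreal (F b - F a)"
    using bilipschitz_density[OF lower upper] by blast
  have AE_f: "AE x in lborel. f x < \<infinity> \<and> (F has_real_derivative enn2real (f x)) (at x)"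
    by (rule bilipschitz_AE_derivative[OF lower upper f Icc])
  \<comment> \<open>Truncation to [-L, L] alters the density on a null set at most, since a
    derivative of u lies in that range wherever it exists.\<close>
  define g where "g x = max (- L) (min L (enn2real (f x) - (L + 1)))" for x
  have AE_g: "AE x in lborel. (u has_real_derivative g x) (at x) \<and> f x = ennreal (g x + (L + 1))"
    using AE_f
  proof eventually_elim
    case (elim x)
    let ?D = "enn2real (f x) - (L + 1)"
    have "((\<lambda>x. F x - (L + 1) * x) has_real_derivative ?D) (at x)"
      using elim by (auto intro!: derivative_eq_intros)
    then have D: "(u has_real_derivative ?D) (at x)" by (simp add: F_def)
    have "((\<lambda>y. (u y - u x) / (y - x)) \<longlongrightarrow> ?D) (at x)"
      using D by (simp add: has_field_derivative_iff)
    then have "((\<lambda>y. \<bar>(u y - u x) / (y - x)\<bar>) \<longlongrightarrow> \<bar>?D\<bar>) (at x)"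
      by (rule tendsto_rabs)
    then have "\<bar>?D\<bar> \<le> L"
    proof (rule tendsto_upperbound)
      show "\<forall>\<^sub>F y in at x. \<bar>(u y - u x) / (y - x)\<bar> \<le> L"
        using lip L by (auto simp: eventually_at_filter divide_le_eq)
    qed simp
    then have "g x = ?D" by (auto simp: g_def)
    then show ?case using D elim by simp
  qed
  have gL: "\<bar>g x\<bar> \<le> L" for x using L by (auto simp: g_def)
  have gm [measurable]: "g \<in> borel_measurable borel" unfolding g_def by measurable
  have gpos: "0 \<le> g x + (L + 1)" for x using gL[of x] by (simp add: abs_le_iff)
  have FTC: "(LINT x:{a..b}|lborel. g x) = u b - u a" if ab: "a \<le> b" for a b
  proof -
    have int: "set_integrable lborel {a..b} (\<lambda>x. g x + (L + 1))"
      unfolding set_integrable_def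
      by (rule integrableI_bounded_set_indicator[where B="2 * L + 1"])
         (use gL L in \<open>auto intro!: AE_I2 simp: emeasure_lborel_Icc_eq abs_le_iff\<close>, smt (verit))
    have "ennreal (LINT x:{a..b}|lborel. g x + (L + 1)) = (\<integral>\<^sup>+x. ennreal (indicator {a..b} x * (g x + (L + 1))) \<partial>lborel)"
      unfolding set_lebesgue_integral_def
      using int gpos by (subst nn_integral_eq_integral) (auto simp: set_integrable_def)
    also have "\<dots> = (\<integral>\<^sup>+x. f x * indicator {a..b} x \<partial>lborel)"
      by (rule nn_integral_cong_AE) (use AE_g in eventually_elim, auto simp: indicator_def)
    also have "\<dots> = ennreal (F b - F a)"
      using Icc[OF ab] by (simp add: emeasure_density)
    finally have "(LINT x:{a..b}|lborel. g x + (L + 1)) = F b - F a"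
    proof (subst (asm) ennreal_inj)
      show "0 \<le> (LINT x:{a..b}|lborel. g x + (L + 1))"
        unfolding set_lebesgue_integral_def
        using gpos by (intro integral_nonneg_AE AE_I2) auto
      show "0 \<le> F b - F a" using lower[OF ab] ab by simp
    qed
    moreover have "(LINT x:{a..b}|lborel. g x + (L + 1)) = (LINT x:{a..b}|lborel. g x) + (LINT x:{a..b}|lborel. L + 1)"
    proof (rule set_integral_add(2))
      show c: "set_integrable lborel {a..b} (\<lambda>x. L + 1)"
        by (rule borel_integrable_atLeastAtMost') (auto intro: continuous_intros)
      show "set_integrable lborel {a..b} g"
        using set_integral_diff(1)[OF int c] by simp
    qed
    moreover have "(LINT x:{a..b}|lborel. L + 1) = (L + 1) * (b - a)"
      using ab by (simp add: set_lebesgue_integral_def)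
    ultimately show ?thesis by (simp add: F_def algebra_simps)
  qed
  show ?thesis
    by (rule that[OF gm _ gL FTC]) (use AE_g in auto)
qed

section \<open>Lipschitz functions on a metric space\<close>

text \<open>The infimum is attained: every difference quotient is a lower bound for the admissible
  constants, hence at most their infimum.\<close>

lemma lipschitz_lip_const:
  assumes "f \<in> Lip" shows "(lip_const f)-lipschitz_on UNIV f"
proof -
  let ?S = "{L. L-lipschitz_on UNIV f}"
  have ne: "?S \<noteq> {}" using assms by (auto simp: Lip_def)
  show ?thesis
  proof (rule lipschitz_onI)
    show "0 \<le> lip_const f" unfolding lip_const_def
      by (rule cInf_greatest[OF ne]) (auto dest: lipschitz_on_nonneg)
    fix x y :: 'a
    show "dist (f x) (f y) \<le> lip_const f * dist x y"
    proof (cases "x = y")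
      case False
      have "dist (f x) (f y) / dist x y \<le> lip_const f" unfolding lip_const_def
      proof (rule cInf_greatest[OF ne])
        fix L assume "L \<in> ?S"
        then show "dist (f x) (f y) / dist x y \<le> L"
          using lipschitz_onD[of L UNIV f x y] False by (simp add: pos_divide_le_eq)
      qed
      then show ?thesis using False by (simp add: pos_divide_le_eq)
    qed simp
  qed
qed

lemma lip_const_le: "L-lipschitz_on UNIV f \<Longrightarrow> lip_const f \<le> L"
  unfolding lip_const_def by (rule cInf_lower) (auto intro!: bdd_belowI[of _ 0] dest: lipschitz_on_nonneg)

lemma lip_const_nonneg: "f \<in> Lip \<Longrightarrow> 0 \<le> lip_const f"
  using lipschitz_lip_const lipschitz_on_nonneg by blast

lemma LipI: "L-lipschitz_on UNIV f \<Longrightarrow> f \<in> Lip"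
  by (auto simp: Lip_def)

lemma Lip_dist_le: "f \<in> Lip \<Longrightarrow> \<bar>f x - f y\<bar> \<le> lip_const f * dist x y"
  using lipschitz_onD[OF lipschitz_lip_const, of f x y] by (simp add: dist_real_def)

lemma Lip_continuous: "f \<in> Lip \<Longrightarrow> continuous_on A f"
  using lipschitz_lip_const lipschitz_on_continuous_on continuous_on_subset by blast

lemma Lip_borel_measurable [measurable_dest]: "f \<in> Lip \<Longrightarrow> f \<in> borel_measurable borel"
  by (intro borel_measurable_continuous_onI Lip_continuous)

lemma Lip_lincomb:
  assumes "f \<in> Lip" "g \<in> Lip" shows "(\<lambda>x. a * f x + b * g x) \<in> Lip"
  by (rule LipI[of "\<bar>a\<bar> * lip_const f + \<bar>b\<bar> * lip_const g"])
    (intro lipschitz_on_add lipschitz_on_cmult_real lipschitz_lip_const assms)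

lemma Lip_const [simp]: "(\<lambda>x. c) \<in> Lip"
  by (rule LipI[OF lipschitz_on_constant])

lemma lip_const_const [simp]: "lip_const (\<lambda>x. c) = 0"
  using lip_const_le[OF lipschitz_on_constant] lip_const_nonneg[OF Lip_const] by (rule antisym)

lemma Lip_bI: "f \<in> Lip \<Longrightarrow> (\<And>x. \<bar>f x\<bar> \<le> B) \<Longrightarrow> f \<in> Lip_b"
  by (auto simp: Lip_b_def bounded_iff)

lemma Lip_b_imp_Lip: "f \<in> Lip_b \<Longrightarrow> f \<in> Lip"
  by (auto simp: Lip_b_def)

lemma Lip_bE:
  assumes "f \<in> Lip_b" obtains B where "B \<ge> 0" "\<And>x. \<bar>f x\<bar> \<le> B"
proof -
  obtain B where B: "\<And>x. \<bar>f x\<bar> \<le> B" using assms by (auto simp: Lip_b_def bounded_iff)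
  have "B \<ge> 0" using B[of undefined] by linarith
  then show ?thesis using B that by blast
qed

lemma Lip_b_lincomb:
  assumes "f \<in> Lip_b" "g \<in> Lip_b" shows "(\<lambda>x. a * f x + b * g x) \<in> Lip_b"
proof -
  obtain A where A: "\<And>x. \<bar>f x\<bar> \<le> A" using Lip_bE[OF assms(1)] by blast
  obtain B where B: "\<And>x. \<bar>g x\<bar> \<le> B" using Lip_bE[OF assms(2)] by blast
  show ?thesis
  proof (rule Lip_bI[OF Lip_lincomb])
    fix x
    have "\<bar>a * f x + b * g x\<bar> \<le> \<bar>a\<bar> * \<bar>f x\<bar> + \<bar>b\<bar> * \<bar>g x\<bar>"
      by (metis abs_mult abs_triangle_ineq)
    also have "\<dots> \<le> \<bar>a\<bar> * A + \<bar>b\<bar> * B" by (intro add_mono mult_left_mono A B) auto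
    finally show "\<bar>a * f x + b * g x\<bar> \<le> \<bar>a\<bar> * A + \<bar>b\<bar> * B" .
  qed (use assms in \<open>auto simp: Lip_b_def\<close>)
qed

lemma Lip_b_const [simp]: "(\<lambda>x. c) \<in> Lip_b"
  by (rule Lip_bI[of _ "\<bar>c\<bar>"]) auto

lemma lipschitz_on_mult:
  fixes f g :: "'a::metric_space \<Rightarrow> real"
  assumes f: "L-lipschitz_on X f" "\<And>x. x \<in> X \<Longrightarrow> \<bar>f x\<bar> \<le> A"
    and g: "M-lipschitz_on X g" "\<And>x. x \<in> X \<Longrightarrow> \<bar>g x\<bar> \<le> B"
    and AB: "0 \<le> A" "0 \<le> B"
  shows "(A * M + B * L)-lipschitz_on X (\<lambda>x. f x * g x)"
proof (rule lipschitz_onI)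
  show "0 \<le> A * M + B * L" using assms by (auto dest!: lipschitz_on_nonneg)
  fix x y assume xy: "x \<in> X" "y \<in> X"
  have "f x * g x - f y * g y = f x * (g x - g y) + g y * (f x - f y)" by (simp add: algebra_simps)
  then have "\<bar>f x * g x - f y * g y\<bar> \<le> \<bar>f x\<bar> * \<bar>g x - g y\<bar> + \<bar>g y\<bar> * \<bar>f x - f y\<bar>"
    by (metis abs_mult abs_triangle_ineq)
  also have "\<dots> \<le> A * (M * dist x y) + B * (L * dist x y)"
    using lipschitz_onD[OF f(1) xy] lipschitz_onD[OF g(1) xy] f(2)[OF xy(1)] g(2)[OF xy(2)] AB
    by (intro add_mono mult_mono) (auto simp: dist_real_def)
  finally show "dist (f x * g x) (f y * g y) \<le> (A * M + B * L) * dist x y"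
    by (simp add: dist_real_def algebra_simps)
qed

lemma Lip_b_mult:
  assumes "f \<in> Lip_b" "g \<in> Lip_b" shows "(\<lambda>x. f x * g x) \<in> Lip_b"
proof -
  obtain A where A: "A \<ge> 0" "\<And>x. \<bar>f x\<bar> \<le> A" using Lip_bE[OF assms(1)] by blast
  obtain B where B: "B \<ge> 0" "\<And>x. \<bar>g x\<bar> \<le> B" using Lip_bE[OF assms(2)] by blast
  have "(\<lambda>x. f x * g x) \<in> Lip"
    by (rule LipI, rule lipschitz_on_mult[OF lipschitz_lip_const A(2) lipschitz_lip_const B(2) A(1) B(1)])
      (use assms in \<open>auto intro: Lip_b_imp_Lip\<close>)
  then show ?thesis
    by (rule Lip_bI[of _ "A * B"]) (simp add: abs_mult A B mult_mono)
qed

lemma bilinear_functionalD: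
  assumes "bilinear_functional T"
  shows "f \<in> Lip_b \<Longrightarrow> g \<in> Lip_b \<Longrightarrow> \<pi> \<in> Lip \<Longrightarrow> T (\<lambda>x. a * f x + b * g x) \<pi> = a * T f \<pi> + b * T g \<pi>"
    "f \<in> Lip_b \<Longrightarrow> \<pi> \<in> Lip \<Longrightarrow> \<sigma> \<in> Lip \<Longrightarrow> T f (\<lambda>x. a * \<pi> x + b * \<sigma> x) = a * T f \<pi> + b * T f \<sigma>"
  using assms unfolding bilinear_functional_def by blast+

text \<open>\<open>deriv\<close> is unspecified on a null set, so the integrands of curve currents
  need not be Borel. Passing to a Borel representative on the open interval moves all later
  estimates to \<open>lborel\<close>.\<close>

lemma set_lebesgue_integral_eq_lborel:
  fixes f g :: "real \<Rightarrow> real"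
  assumes g [measurable]: "g \<in> borel_measurable borel"
    and AE: "AE t in lborel. t \<in> {a<..<b} \<longrightarrow> f t = g t"
  shows "(LINT t:{a..b}|lebesgue. f t) = (LINT t:{a..b}|lborel. g t)"
proof -
  have "AE t in lborel. t \<notin> {a, b}"
    by (intro AE_not_in finite_imp_null_set_lborel) auto
  then have "AE t in lborel. indicator {a..b} t *\<^sub>R g t = indicator {a..b} t *\<^sub>R f t"
    using AE by eventually_elim (auto simp: indicator_def)
  then have AE': "AE t in lebesgue. indicator {a..b} t *\<^sub>R g t = indicator {a..b} t *\<^sub>R f t"
    by (rule AE_completion)
  have 1: "(\<lambda>t. indicator {a..b} t *\<^sub>R g t) \<in> borel_measurable lebesgue"
    by (intro measurable_completion) simp
  \<comment> \<open>Completeness of the measure enters here: agreeing almost everywhere with a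
    measurable function is enough to be measurable.\<close>
  have 2: "(\<lambda>t. indicator {a..b} t *\<^sub>R f t) \<in> borel_measurable lebesgue"
    by (rule borel_measurable_AE[OF 1 AE'])
  have "(LINT t:{a..b}|lebesgue. f t) = (LINT t|lebesgue. indicator {a..b} t *\<^sub>R g t)"
    unfolding set_lebesgue_integral_def by (rule integral_cong_AE[OF 2 1]) (use AE' in auto)
  also have "\<dots> = (LINT t:{a..b}|lborel. g t)"
    unfolding set_lebesgue_integral_def by (rule integral_completion) simp
  finally show ?thesis .
qed

text \<open>Composition with this projection makes a curve Lipschitz on the whole line without
  changing it on [0,1], so that facts about functions on all of the reals become applicable.\<close>

definition unit_clamp :: "real \<Rightarrow> real"
  where "unit_clamp t = max 0 (min 1 t)"

lemma unit_clamp_in [simp]: "unit_clamp t \<in> {0..1}" "0 \<le> unit_clamp t" "unit_clamp t \<le> 1"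
  by (auto simp: unit_clamp_def)

lemma unit_clamp_id [simp]: "t \<in> {0..1} \<Longrightarrow> unit_clamp t = t"
  by (auto simp: unit_clamp_def)

lemma lipschitz_unit_clamp:
  assumes "L-lipschitz_on {0..1} \<theta>" shows "L-lipschitz_on UNIV (\<lambda>t. \<theta> (unit_clamp t))"
proof (rule lipschitz_onI)
  fix s t :: real
  have "dist (\<theta> (unit_clamp s)) (\<theta> (unit_clamp t)) \<le> L * dist (unit_clamp s) (unit_clamp t)"
    using assms by (rule lipschitz_onD) auto
  also have "\<dots> \<le> L * dist s t"
    using lipschitz_on_nonneg[OF assms] by (intro mult_left_mono) (auto simp: dist_real_def unit_clamp_def)
  finally show "dist (\<theta> (unit_clamp s)) (\<theta> (unit_clamp t)) \<le> L * dist s t" .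
qed (use assms lipschitz_on_nonneg in blast)

lemma eventually_unit_clamp: "t \<in> {0<..<1} \<Longrightarrow> \<forall>\<^sub>F s in nhds t. \<theta> (unit_clamp s) = \<theta> s"
  by (rule eventually_mono[OF eventually_nhds_in_open[of "{0<..<1}" t]]) auto

text \<open>The clamped function has a derivative almost everywhere on the line. In the open
  interval the clamp is locally the identity, so this is the derivative of u itself; at the
  endpoints nothing is claimed.\<close>

lemma lipschitz_Icc_AE_derivative:
  fixes u :: "real \<Rightarrow> real"
  assumes u: "L-lipschitz_on {0..1} u"
  obtains g where "g \<in> borel_measurable borel"
    "AE t in lborel. t \<in> {0<..<1} \<longrightarrow> (u has_real_derivative g t) (at t)"
    "\<And>t. \<bar>g t\<bar> \<le> L"
    "(LINT t:{0..1}|lborel. g t) = u 1 - u 0"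
proof -
  obtain g where g: "g \<in> borel_measurable borel"
    "AE x in lborel. ((\<lambda>t. u (unit_clamp t)) has_real_derivative g x) (at x)"
    "\<And>x. \<bar>g x\<bar> \<le> L"
    "\<And>a b. a \<le> b \<Longrightarrow> (LINT x:{a..b}|lborel. g x) = u (unit_clamp b) - u (unit_clamp a)"
    by (rule lipschitz_has_AE_derivative[OF lipschitz_unit_clamp[OF u]]) blast
  show ?thesis
  proof (rule that)
    show "AE t in lborel. t \<in> {0<..<1} \<longrightarrow> (u has_real_derivative g t) (at t)"
      using g(2)
    proof eventually_elim
      case (elim t)
      show ?case
      proof
        assume "t \<in> {0<..<1}"
        then have "((\<lambda>t. u (unit_clamp t)) has_real_derivative g t) (at t) \<longleftrightarrow> (u has_real_derivative g t) (at t)"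
          by (intro DERIV_cong_ev eventually_unit_clamp refl)
        then show "(u has_real_derivative g t) (at t)" using elim by simp
      qed
    qed
    show "(LINT t:{0..1}|lborel. g t) = u 1 - u 0" using g(4)[of 0 1] by simp
  qed (use g in auto)
qed

lemma set_integrable_Icc_bounded:
  fixes g :: "real \<Rightarrow> real"
  assumes "g \<in> borel_measurable borel" "\<And>t. t \<in> {a..b} \<Longrightarrow> \<bar>g t\<bar> \<le> B"
  shows "set_integrable lborel {a..b} g"
  unfolding set_integrable_def
  by (rule integrableI_bounded_set_indicator[where B=B])
    (use assms in \<open>auto simp: emeasure_lborel_Icc_eq\<close>)

text \<open>The product w u is again Lipschitz, so the fundamental theorem applies to it, and almost
  everywhere its derivative is given by the Leibniz rule. Any bounded Borel representatives of the
  two derivatives may be inserted.\<close>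

lemma integration_by_parts_lipschitz:
  fixes u w gu gw :: "real \<Rightarrow> real"
  assumes u: "L-lipschitz_on {0..1} u" and w: "M-lipschitz_on {0..1} w"
    and gu: "gu \<in> borel_measurable borel" "\<And>t. \<bar>gu t\<bar> \<le> A"
      "AE t in lborel. t \<in> {0<..<1} \<longrightarrow> (u has_real_derivative gu t) (at t)"
    and gw: "gw \<in> borel_measurable borel" "\<And>t. \<bar>gw t\<bar> \<le> B"
      "AE t in lborel. t \<in> {0<..<1} \<longrightarrow> (w has_real_derivative gw t) (at t)"
  shows "(LINT t:{0..1}|lborel. w (unit_clamp t) * gu t) =
    w 1 * u 1 - w 0 * u 0 - (LINT t:{0..1}|lborel. u (unit_clamp t) * gw t)"
proof -
  have bdd: "\<exists>C\<ge>0. \<forall>t\<in>{0..1}. \<bar>v t\<bar> \<le> C" if v: "K-lipschitz_on {0..1} v" for K and v :: "real \<Rightarrow> real"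
  proof (intro exI[of _ "\<bar>v 0\<bar> + K"] conjI ballI)
    show "0 \<le> \<bar>v 0\<bar> + K" using lipschitz_on_nonneg[OF v] by auto
    fix t :: real assume t: "t \<in> {0..1}"
    have "dist (v t) (v 0) \<le> K * dist t 0" using lipschitz_onD[OF v t, of 0] by auto
    also have "\<dots> \<le> K * 1" using lipschitz_on_nonneg[OF v] t by (intro mult_left_mono) auto
    finally show "\<bar>v t\<bar> \<le> \<bar>v 0\<bar> + K" by (auto simp: dist_real_def)
  qed
  obtain Cu where Cu: "Cu \<ge> 0" "\<And>t. t \<in> {0..1} \<Longrightarrow> \<bar>u t\<bar> \<le> Cu" using bdd[OF u] by blast
  obtain Cw where Cw: "Cw \<ge> 0" "\<And>t. t \<in> {0..1} \<Longrightarrow> \<bar>w t\<bar> \<le> Cw" using bdd[OF w] by blast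
  have [measurable]: "(\<lambda>t. u (unit_clamp t)) \<in> borel_measurable borel" "(\<lambda>t. w (unit_clamp t)) \<in> borel_measurable borel"
    using lipschitz_unit_clamp[OF u] lipschitz_unit_clamp[OF w]
    by (auto intro!: borel_measurable_continuous_onI lipschitz_on_continuous_on)
  note [measurable] = gu(1) gw(1)
  obtain g where g: "g \<in> borel_measurable borel"
    "AE t in lborel. t \<in> {0<..<1} \<longrightarrow> ((\<lambda>t. w t * u t) has_real_derivative g t) (at t)"
    "(LINT t:{0..1}|lborel. g t) = w 1 * u 1 - w 0 * u 0"
    by (rule lipschitz_Icc_AE_derivative[OF lipschitz_on_mult[OF w Cw(2) u Cu(2) Cw(1) Cu(1)]]) blast
  have i1: "set_integrable lborel {0..1} (\<lambda>t. w (unit_clamp t) * gu t)"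
  proof (rule set_integrable_Icc_bounded)
    fix t :: real assume "t \<in> {0..1}"
    then show "\<bar>w (unit_clamp t) * gu t\<bar> \<le> Cw * A"
      using Cw Cw(2)[of t] gu(2) by (auto simp: abs_mult intro!: mult_mono)
  qed simp
  have i2: "set_integrable lborel {0..1} (\<lambda>t. u (unit_clamp t) * gw t)"
  proof (rule set_integrable_Icc_bounded)
    fix t :: real assume "t \<in> {0..1}"
    then show "\<bar>u (unit_clamp t) * gw t\<bar> \<le> Cu * B"
      using Cu Cu(2)[of t] gw(2) by (auto simp: abs_mult intro!: mult_mono)
  qed simp
  have "(LINT t:{0..1}|lebesgue. g t) = (LINT t:{0..1}|lborel. g t)"
    by (rule set_lebesgue_integral_eq_lborel) (use g in auto)
  moreover have "(LINT t:{0..1}|lebesgue. g t) = (LINT t:{0..1}|lborel. w (unit_clamp t) * gu t + u (unit_clamp t) * gw t)"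
  proof (rule set_lebesgue_integral_eq_lborel)
    show "AE t in lborel. t \<in> {0<..<1} \<longrightarrow> g t = w (unit_clamp t) * gu t + u (unit_clamp t) * gw t"
      using g(2) gu(3) gw(3)
    proof eventually_elim
      case (elim t)
      show ?case
      proof
        assume t: "t \<in> {0<..<1}"
        have "((\<lambda>t. w t * u t) has_real_derivative (w t * gu t + u t * gw t)) (at t)"
          using elim t by (auto intro!: derivative_eq_intros)
        moreover have "((\<lambda>t. w t * u t) has_real_derivative g t) (at t)" using elim t by auto
        ultimately show "g t = w (unit_clamp t) * gu t + u (unit_clamp t) * gw t"
          using DERIV_unique t by fastforce
      qed
    qed
  qed simp
  ultimately show ?thesis using g(3) set_integral_add(2)[OF i1 i2] by simp
qed

section \<open>Metric speed and the current of a curve\<close>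

text \<open>\<open>real_of_ereal\<close> sends infinities to 0, so the limit superior is first shown
  to be finite, using the local Lipschitz bound. The slack e turns its upper bounds into eventual
  inequalities, and all further facts about the speed are drawn from this form.\<close>

lemma metric_speed_le_iff:
  assumes L: "\<forall>\<^sub>F h in at_right 0. dist (\<theta> (t + h)) (\<theta> t) \<le> L * h"
  shows "metric_speed \<theta> t \<le> a \<longleftrightarrow>
    (\<forall>e>0. \<forall>\<^sub>F h in at_right 0. dist (\<theta> (t + h)) (\<theta> t) \<le> (a + e) * h)"
proof -
  define Z where "Z = Limsup (at_right 0) (\<lambda>h. ereal (dist (\<theta> (t + h)) (\<theta> t) / h))"
  have pos: "\<forall>\<^sub>F h in at_right (0::real). 0 < h" by (rule eventually_at_right_less)
  have "Z \<le> ereal L" unfolding Z_def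
    by (rule Limsup_bounded) (use L pos in eventually_elim, auto simp: pos_divide_le_eq)
  moreover have "0 \<le> Z" unfolding Z_def
  proof (rule order_trans[OF _ Liminf_le_Limsup])
    show "0 \<le> Liminf (at_right 0) (\<lambda>h. ereal (dist (\<theta> (t + h)) (\<theta> t) / h))"
      by (rule Liminf_bounded) (use pos in eventually_elim, auto)
  qed simp
  ultimately obtain z where z: "Z = ereal z" by (cases Z) auto
  have "metric_speed \<theta> t = z" unfolding metric_speed_def Z_def[symmetric] z by simp
  moreover have "z \<le> a \<longleftrightarrow> (\<forall>e>0. \<forall>\<^sub>F h in at_right 0. dist (\<theta> (t + h)) (\<theta> t) \<le> (a + e) * h)"
  proof
    assume za: "z \<le> a"
    show "\<forall>e>0. \<forall>\<^sub>F h in at_right 0. dist (\<theta> (t + h)) (\<theta> t) \<le> (a + e) * h"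
    proof (intro allI impI)
      fix e :: real assume "e > 0"
      then have "Z < ereal (a + e)" using z za by simp
      then have "\<forall>\<^sub>F h in at_right 0. ereal (dist (\<theta> (t + h)) (\<theta> t) / h) < ereal (a + e)"
        unfolding Z_def by (rule Limsup_lessD)
      then show "\<forall>\<^sub>F h in at_right 0. dist (\<theta> (t + h)) (\<theta> t) \<le> (a + e) * h"
        using pos by eventually_elim (auto simp: pos_divide_less_eq)
    qed
  next
    assume *: "\<forall>e>0. \<forall>\<^sub>F h in at_right 0. dist (\<theta> (t + h)) (\<theta> t) \<le> (a + e) * h"
    show "z \<le> a"
    proof (rule field_le_epsilon)
      fix e :: real assume "e > 0"
      then have "Z \<le> ereal (a + e)" unfolding Z_def
        by (intro Limsup_bounded) (use *[rule_format, OF \<open>e > 0\<close>] pos in eventually_elim, auto simp: pos_divide_le_eq)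
      then show "z \<le> a + e" by (simp add: z)
    qed
  qed
  ultimately show ?thesis by simp
qed

lemma eventually_dist_le_lipschitz:
  assumes "L-lipschitz_on {0..1} \<theta>" "t \<in> {0..<1}"
  shows "\<forall>\<^sub>F h in at_right 0. dist (\<theta> (t + h)) (\<theta> t) \<le> L * h"
proof -
  have "\<forall>\<^sub>F h in at_right 0. h \<in> {0<..<1 - t}"
    using assms by (intro eventually_at_right_real) auto
  then show ?thesis
  proof eventually_elim
    case (elim h)
    have "dist (\<theta> (t + h)) (\<theta> t) \<le> L * dist (t + h) t"
      using assms elim by (intro lipschitz_onD) auto
    then show ?case using elim by (simp add: dist_real_def)
  qed
qed

lemma metric_speed_bounds:
  assumes L: "\<forall>\<^sub>F h in at_right 0. dist (\<theta> (t + h)) (\<theta> t) \<le> L * h"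
  shows "0 \<le> metric_speed \<theta> t" "metric_speed \<theta> t \<le> L"
proof -
  have pos: "\<forall>\<^sub>F h in at_right (0::real). 0 < h" by (rule eventually_at_right_less)
  show "metric_speed \<theta> t \<le> L"
    unfolding metric_speed_le_iff[OF L]
  proof (intro allI impI)
    fix e :: real assume "e > 0"
    show "\<forall>\<^sub>F h in at_right 0. dist (\<theta> (t + h)) (\<theta> t) \<le> (L + e) * h"
      using L pos
    proof eventually_elim
      case (elim h)
      have "L * h \<le> (L + e) * h" using elim \<open>e > 0\<close> by (intro mult_right_mono) auto
      then show ?case using elim by linarith
    qed
  qed
  show "0 \<le> metric_speed \<theta> t"
  proof (rule ccontr)
    assume "\<not> 0 \<le> metric_speed \<theta> t"
    define m where "m = metric_speed \<theta> t"
    have m: "m < 0" using \<open>\<not> _\<close> by (simp add: m_def)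
    have "\<forall>\<^sub>F h in at_right 0. dist (\<theta> (t + h)) (\<theta> t) \<le> (m + - m / 2) * h"
      using metric_speed_le_iff[OF L, of m, THEN iffD1, rule_format, of "- m / 2"] m by (simp add: m_def)
    then have "\<forall>\<^sub>F h in at_right (0::real). False"
      using pos
    proof eventually_elim
      case (elim h)
      have "(m + - m / 2) * h < 0" using m elim by (auto simp: mult_less_0_iff)
      then show ?case using elim zero_le_dist[of "\<theta> (t + h)" "\<theta> t"] by linarith
    qed
    then show False by simp
  qed
qed

lemma metric_speed_unit_clamp:
  assumes "L-lipschitz_on {0..1} \<theta>" "t \<in> {0<..<1}"
  shows "metric_speed (\<lambda>t. \<theta> (unit_clamp t)) t = metric_speed \<theta> t"
proof -
  have *: "\<forall>\<^sub>F h in at_right 0. h \<in> {0<..<1 - t}"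
    using assms by (intro eventually_at_right_real) auto
  \<comment> \<open>Two reals with the same upper bounds are equal, so it suffices that both curves
    have the same germ to the right of t.\<close>
  have "metric_speed (\<lambda>t. \<theta> (unit_clamp t)) t \<le> a \<longleftrightarrow> metric_speed \<theta> t \<le> a" for a
  proof -
    have "(\<forall>\<^sub>F h in at_right 0. dist (\<theta> (unit_clamp (t + h))) (\<theta> (unit_clamp t)) \<le> b * h) \<longleftrightarrow>
      (\<forall>\<^sub>F h in at_right 0. dist (\<theta> (t + h)) (\<theta> t) \<le> b * h)" for b
      by (rule eventually_cong[OF *]) (use assms in auto)
    then show ?thesis
      using assms by (subst metric_speed_le_iff[OF eventually_dist_le_lipschitz[OF assms(1)]]; simp?)
        (subst metric_speed_le_iff[of _ _ L]; use eventually_dist_le_lipschitz[OF assms(1), of t] in simp)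
  qed
  then show ?thesis by (metis order_antisym order_refl)
qed

lemma borel_measurable_metric_speed:
  assumes "L-lipschitz_on UNIV \<theta>"
  shows "metric_speed \<theta> \<in> borel_measurable borel"
proof -
  have cont: "continuous_on UNIV \<theta>" using assms by (rule lipschitz_on_continuous_on)
  have L: "\<forall>\<^sub>F h in at_right 0. dist (\<theta> (t + h)) (\<theta> t) \<le> L * h" for t
    using eventually_at_right_less[of "0::real"]
  proof eventually_elim
    case (elim h)
    then show ?case using lipschitz_onD[OF assms, of "t + h" t] by (simp add: dist_real_def)
  qed
  \<comment> \<open>Although h ranges over an uncountable set, each of these sets is an intersection
    of closed ones by continuity of \<theta>, so a sublevel set of the speed is a countable
    intersection of countable unions of closed sets.\<close>
  define A where "A a k n = {t. \<forall>h\<in>{0<..<1 / Suc n}. dist (\<theta> (t + h)) (\<theta> t) \<le> (a + 1 / Suc k) * h}" for a and k n :: nat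
  have clA: "closed (A a k n)" for a k n
  proof -
    have "A a k n = (\<Inter>h\<in>{0<..<1 / Suc n}. {t. dist (\<theta> (t + h)) (\<theta> t) \<le> (a + 1 / Suc k) * h})"
      by (auto simp: A_def)
    also have "closed \<dots>"
      by (intro closed_INT ballI closed_Collect_le continuous_intros continuous_on_compose2[OF cont]) auto
    finally show ?thesis .
  qed
  have "{t. metric_speed \<theta> t \<le> a} = (\<Inter>k. \<Union>n. A a k n)" for a
  proof (intro set_eqI iffI)
    fix t assume "t \<in> {t. metric_speed \<theta> t \<le> a}"
    then have *: "\<forall>\<^sub>F h in at_right 0. dist (\<theta> (t + h)) (\<theta> t) \<le> (a + e) * h" if "e > 0" for e
      using metric_speed_le_iff[OF L] that by auto
    show "t \<in> (\<Inter>k. \<Union>n. A a k n)"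
    proof
      fix k :: nat
      obtain b where b: "b > 0" "\<And>h. 0 < h \<Longrightarrow> h < b \<Longrightarrow> dist (\<theta> (t + h)) (\<theta> t) \<le> (a + 1 / Suc k) * h"
        using *[of "1 / Suc k"] by (auto simp: eventually_at_right_field)
      obtain n :: nat where "1 / Suc n < b" using b(1) nat_approx_posE by blast
      then have "t \<in> A a k n" unfolding A_def using b(2) by auto
      then show "t \<in> (\<Union>n. A a k n)" by blast
    qed
  next
    fix t assume t: "t \<in> (\<Inter>k. \<Union>n. A a k n)"
    have "metric_speed \<theta> t \<le> a"
      unfolding metric_speed_le_iff[OF L]
    proof (intro allI impI)
      fix e :: real assume "e > 0"
      then obtain k :: nat where k: "1 / Suc k < e" using nat_approx_posE by blast
      obtain n where n: "t \<in> A a k n" using t by blast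
      have "\<forall>\<^sub>F h in at_right 0. h \<in> {0<..<1 / real (Suc n)}" by (rule eventually_at_right_real) auto
      then show "\<forall>\<^sub>F h in at_right 0. dist (\<theta> (t + h)) (\<theta> t) \<le> (a + e) * h"
      proof eventually_elim
        case (elim h)
        have "dist (\<theta> (t + h)) (\<theta> t) \<le> (a + 1 / Suc k) * h" using n elim by (simp add: A_def)
        also have "\<dots> \<le> (a + e) * h" using k elim by (intro mult_right_mono) auto
        finally show ?case .
      qed
    qed
    then show "t \<in> {t. metric_speed \<theta> t \<le> a}" by simp
  qed
  then have "{t. metric_speed \<theta> t \<le> a} \<in> sets borel" for a
    using clA by (auto intro!: sets.countable_INT sets.countable_UN borel_closed)
  then show ?thesis by (intro borel_measurable_iff_le[THEN iffD2]) auto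
qed

text \<open>Difference quotients of \<pi> \<circ> \<theta> from the right are at most Lip(\<pi>)
  times those of \<theta>. Using the speed here, and not the Lipschitz constant of the curve, is
  what later makes the mass of a curve current at most its length.\<close>

lemma derivative_le_metric_speed:
  assumes \<theta>: "L-lipschitz_on {0..1} \<theta>" "t \<in> {0..<1}" and \<pi>: "\<pi> \<in> Lip"
    and D: "((\<pi> \<circ> \<theta>) has_real_derivative D) (at t)"
  shows "\<bar>D\<bar> \<le> lip_const \<pi> * metric_speed \<theta> t"
proof (rule field_le_epsilon)
  fix e :: real assume e: "e > 0"
  let ?m = "metric_speed \<theta> t" and ?l = "lip_const \<pi>"
  have l: "0 \<le> ?l" using \<pi> by (rule lip_const_nonneg)
  \<comment> \<open>Dividing by \<open>?l + 1\<close> also covers a constant \<pi>, whose Lipschitz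
    constant is 0.\<close>
  define d where "d = e / (?l + 1)"
  have d: "d > 0" "?l * d \<le> e" using e l by (auto simp: d_def field_simps)
  have "((\<lambda>h. ((\<pi> \<circ> \<theta>) (t + h) - (\<pi> \<circ> \<theta>) t) / h) \<longlongrightarrow> D) (at 0)"
    using D by (simp add: DERIV_def)
  then have "((\<lambda>h. ((\<pi> \<circ> \<theta>) (t + h) - (\<pi> \<circ> \<theta>) t) / h) \<longlongrightarrow> D) (at_right 0)"
    by (rule tendsto_mono[OF at_le, rotated]) auto
  then have "((\<lambda>h. \<bar>((\<pi> \<circ> \<theta>) (t + h) - (\<pi> \<circ> \<theta>) t) / h\<bar>) \<longlongrightarrow> \<bar>D\<bar>) (at_right 0)"
    by (rule tendsto_rabs)
  then have "\<bar>D\<bar> \<le> ?l * (?m + d)"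
  proof (rule tendsto_upperbound)
    have "\<forall>\<^sub>F h in at_right 0. dist (\<theta> (t + h)) (\<theta> t) \<le> (?m + d) * h"
      using metric_speed_le_iff[OF eventually_dist_le_lipschitz[OF \<theta>]] d by blast
    then show "\<forall>\<^sub>F h in at_right 0. \<bar>((\<pi> \<circ> \<theta>) (t + h) - (\<pi> \<circ> \<theta>) t) / h\<bar> \<le> ?l * (?m + d)"
      using eventually_at_right_less[of "0::real"]
    proof eventually_elim
      case (elim h)
      have "\<bar>\<pi> (\<theta> (t + h)) - \<pi> (\<theta> t)\<bar> \<le> ?l * dist (\<theta> (t + h)) (\<theta> t)" using \<pi> by (rule Lip_dist_le)
      also have "\<dots> \<le> ?l * ((?m + d) * h)" using elim l by (intro mult_left_mono)
      finally show ?case using elim by (simp add: pos_divide_le_eq abs_divide mult.assoc)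
    qed
  qed simp
  also have "\<dots> \<le> ?l * ?m + e" using d by (simp add: algebra_simps)
  finally show "\<bar>D\<bar> \<le> ?l * ?m + e" .
qed

text \<open>The measure with density speed, pushed forward along the curve; its total mass is the
  length. The open interval excludes t = 1, where the speed would look at values of \<theta> beyond
  the parameter interval.\<close>

definition curve_mass :: "(real \<Rightarrow> 'a::metric_space) \<Rightarrow> 'a measure"
  where "curve_mass \<theta> = distr (density lborel (\<lambda>t. ennreal (indicator {0<..<1} t * metric_speed \<theta> t)))
    borel (\<lambda>t. \<theta> (unit_clamp t))"

lemma curve_mass_measurable:
  fixes \<theta> :: "real \<Rightarrow> 'a::metric_space"
  assumes "L-lipschitz_on {0..1} \<theta>"
  shows "(\<lambda>t. indicator {0<..<1} t * metric_speed \<theta> t) \<in> borel_measurable borel"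
    and "(\<lambda>t. \<theta> (unit_clamp t)) \<in> borel_measurable borel"
proof -
  note lip = lipschitz_unit_clamp[OF assms]
  show "(\<lambda>t. \<theta> (unit_clamp t)) \<in> borel_measurable borel"
    by (intro borel_measurable_continuous_onI lipschitz_on_continuous_on[OF lip])
  have [measurable]: "metric_speed (\<lambda>t. \<theta> (unit_clamp t)) \<in> borel_measurable borel"
    using lip by (rule borel_measurable_metric_speed)
  have "(\<lambda>t. indicator {0<..<1} t * metric_speed \<theta> t :: real) =
    (\<lambda>t. indicator {0<..<1} t * metric_speed (\<lambda>t. \<theta> (unit_clamp t)) t)"
    using metric_speed_unit_clamp[OF assms] by (auto simp: indicator_def fun_eq_iff)
  also have "\<dots> \<in> borel_measurable borel" by measurable
  finally show "(\<lambda>t. indicator {0<..<1} t * metric_speed \<theta> t :: real) \<in> borel_measurable borel" .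
qed

lemma curve_length_eq_lborel:
  assumes "L-lipschitz_on {0..1} \<theta>"
  shows "curve_length \<theta> = (LINT t|lborel. indicator {0<..<1} t * metric_speed \<theta> t)"
proof -
  have "curve_length \<theta> = (LINT t:{0..1}|lborel. indicator {0<..<1} t * metric_speed \<theta> t)"
    unfolding curve_length_def
    by (rule set_lebesgue_integral_eq_lborel[OF curve_mass_measurable(1)[OF assms]]) auto
  also have "\<dots> = (LINT t|lborel. indicator {0<..<1} t * metric_speed \<theta> t)"
    unfolding set_lebesgue_integral_def by (rule Bochner_Integration.integral_cong) (auto simp: indicator_def)
  finally show ?thesis .
qed

lemma metric_speed_indicator_bounds:
  assumes "L-lipschitz_on {0..1} \<theta>"
  shows "0 \<le> indicator {0<..<1} t * metric_speed \<theta> t"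
    "indicator {0<..<1} t * metric_speed \<theta> t \<le> L * indicator {0<..<1} t"
  using metric_speed_bounds[OF eventually_dist_le_lipschitz[OF assms, of t]]
  by (auto simp: indicator_def)

lemma integrable_metric_speed:
  assumes "L-lipschitz_on {0..1} \<theta>"
  shows "integrable lborel (\<lambda>t. indicator {0<..<1} t * metric_speed \<theta> t)"
proof (rule integrableI_bounded_set[where A="{0<..<1}" and B=L])
  show "(\<lambda>t. indicator {0<..<1} t * metric_speed \<theta> t) \<in> borel_measurable lborel"
    using curve_mass_measurable(1)[OF assms] by simp
  show "AE t in lborel. t \<in> {0<..<1} \<longrightarrow> norm (indicator {0<..<1} t * metric_speed \<theta> t) \<le> L"
    using metric_speed_bounds[OF eventually_dist_le_lipschitz[OF assms]] by (auto intro!: AE_I2)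
qed auto

lemma curve_length_nonneg:
  assumes "L-lipschitz_on {0..1} \<theta>"
  shows "0 \<le> curve_length \<theta>"
  unfolding curve_length_eq_lborel[OF assms]
  by (rule integral_nonneg_AE) (use metric_speed_indicator_bounds[OF assms] in auto)

lemma finite_borel_curve_mass:
  assumes "L-lipschitz_on {0..1} \<theta>"
  shows "finite_borel_measure (curve_mass \<theta>)" "measure (curve_mass \<theta>) UNIV = curve_length \<theta>"
proof -
  note [measurable] = curve_mass_measurable[OF assms]
  have "emeasure (curve_mass \<theta>) UNIV = (\<integral>\<^sup>+t. ennreal (indicator {0<..<1} t * metric_speed \<theta> t) \<partial>lborel)"
    by (simp add: curve_mass_def emeasure_distr emeasure_density)
  also have "\<dots> = ennreal (curve_length \<theta>)"
    unfolding curve_length_eq_lborel[OF assms]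
    by (rule nn_integral_eq_integral[OF integrable_metric_speed[OF assms]])
      (use metric_speed_indicator_bounds[OF assms] in auto)
  finally have *: "emeasure (curve_mass \<theta>) UNIV = ennreal (curve_length \<theta>)" .
  show "finite_borel_measure (curve_mass \<theta>)"
    using * by (auto simp: finite_borel_measure_def curve_mass_def intro!: finite_measureI)
  show "measure (curve_mass \<theta>) UNIV = curve_length \<theta>"
    using * curve_length_nonneg[OF assms] by (simp add: measure_def)
qed

lemma lipschitz_comp_curve:
  assumes "L-lipschitz_on {0..1} \<theta>" "\<pi> \<in> Lip"
  shows "(lip_const \<pi> * L)-lipschitz_on {0..1} (\<pi> \<circ> \<theta>)"
  using lipschitz_on_compose[OF assms(1) lipschitz_on_subset[OF lipschitz_lip_const[OF assms(2)]]]
  by simp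

text \<open>One bounded Borel derivative of \<pi> \<circ> \<theta> represents the current for all f
  at once, which reduces the verification of the axioms to ordinary integrals over [0,1].\<close>

lemma curve_current_density:
  assumes \<theta>: "L-lipschitz_on {0..1} \<theta>" and \<pi>: "\<pi> \<in> Lip"
  obtains g where "g \<in> borel_measurable borel"
    "AE t in lborel. t \<in> {0<..<1} \<longrightarrow> ((\<pi> \<circ> \<theta>) has_real_derivative g t) (at t)"
    "\<And>t. \<bar>g t\<bar> \<le> lip_const \<pi> * L"
    "(LINT t:{0..1}|lborel. g t) = \<pi> (\<theta> 1) - \<pi> (\<theta> 0)"
    "\<And>f. f \<in> Lip \<Longrightarrow> curve_current \<theta> f \<pi> = (LINT t:{0..1}|lborel. f (\<theta> (unit_clamp t)) * g t)"
proof -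
  obtain g where g: "g \<in> borel_measurable borel"
    "AE t in lborel. t \<in> {0<..<1} \<longrightarrow> ((\<pi> \<circ> \<theta>) has_real_derivative g t) (at t)"
    "\<And>t. \<bar>g t\<bar> \<le> lip_const \<pi> * L"
    "(LINT t:{0..1}|lborel. g t) = (\<pi> \<circ> \<theta>) 1 - (\<pi> \<circ> \<theta>) 0"
    by (rule lipschitz_Icc_AE_derivative[OF lipschitz_comp_curve[OF \<theta> \<pi>]]) blast
  have "curve_current \<theta> f \<pi> = (LINT t:{0..1}|lborel. f (\<theta> (unit_clamp t)) * g t)" if f: "f \<in> Lip" for f
    unfolding curve_current_def
  proof (rule set_lebesgue_integral_eq_lborel)
    note [measurable] = curve_mass_measurable(2)[OF \<theta>] g(1) Lip_borel_measurable[OF f]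
    show "(\<lambda>t. f (\<theta> (unit_clamp t)) * g t) \<in> borel_measurable borel" by measurable
    show "AE t in lborel. t \<in> {0<..<1} \<longrightarrow> f (\<theta> t) * deriv (\<pi> \<circ> \<theta>) t = f (\<theta> (unit_clamp t)) * g t"
      using g(2) by eventually_elim (auto simp: DERIV_imp_deriv)
  qed
  then show ?thesis using g that by simp
qed

lemma boundary_curve_current:
  assumes "L-lipschitz_on {0..1} \<theta>" "\<pi> \<in> Lip"
  shows "curve_current \<theta> (\<lambda>_. 1) \<pi> = \<pi> (\<theta> 1) - \<pi> (\<theta> 0)"
  by (rule curve_current_density[OF assms]) simp

text \<open>This moves the derivative off \<open>\<pi>\<close>, so that pointwise convergence of \<open>\<pi>\<close> suffices for the
  continuity axiom.\<close>

lemma curve_current_by_parts: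
  assumes \<theta>: "L-lipschitz_on {0..1} \<theta>" and f: "f \<in> Lip" and \<pi>: "\<pi> \<in> Lip"
  shows "curve_current \<theta> f \<pi> = f (\<theta> 1) * \<pi> (\<theta> 1) - f (\<theta> 0) * \<pi> (\<theta> 0) - curve_current \<theta> \<pi> f"
proof -
  obtain g where g: "g \<in> borel_measurable borel"
    "AE t in lborel. t \<in> {0<..<1} \<longrightarrow> ((\<pi> \<circ> \<theta>) has_real_derivative g t) (at t)"
    "\<And>t. \<bar>g t\<bar> \<le> lip_const \<pi> * L"
    "\<And>f. f \<in> Lip \<Longrightarrow> curve_current \<theta> f \<pi> = (LINT t:{0..1}|lborel. f (\<theta> (unit_clamp t)) * g t)"
    by (rule curve_current_density[OF \<theta> \<pi>]) blast
  obtain k where k: "k \<in> borel_measurable borel"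
    "AE t in lborel. t \<in> {0<..<1} \<longrightarrow> ((f \<circ> \<theta>) has_real_derivative k t) (at t)"
    "\<And>t. \<bar>k t\<bar> \<le> lip_const f * L"
    "\<And>\<pi>. \<pi> \<in> Lip \<Longrightarrow> curve_current \<theta> \<pi> f = (LINT t:{0..1}|lborel. \<pi> (\<theta> (unit_clamp t)) * k t)"
    by (rule curve_current_density[OF \<theta> f]) blast
  show ?thesis
    using integration_by_parts_lipschitz[OF lipschitz_comp_curve[OF \<theta> \<pi>] lipschitz_comp_curve[OF \<theta> f] g(1,3,2) k(1,3,2)]
      g(4)[OF f] k(4)[OF \<pi>] by (simp add: mult.commute)
qed

text \<open>The integrand is dominated by Lip(\<pi>) times speed times |f| along the curve, and a
  change of variables turns the integral of the latter into one against
  \<open>curve_mass\<close>.\<close>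

lemma mass_bound_curve_current:
  assumes \<theta>: "L-lipschitz_on {0..1} \<theta>"
  shows "mass_bound (curve_current \<theta>) (curve_mass \<theta>)"
  unfolding mass_bound_def
proof (intro conjI ballI)
  show "finite_borel_measure (curve_mass \<theta>)" by (rule finite_borel_curve_mass[OF \<theta>])
  fix f \<pi> :: "'a \<Rightarrow> real" assume f: "f \<in> Lip_b" and \<pi>: "\<pi> \<in> Lip"
  let ?m = "\<lambda>t. indicator {0<..<1} t * metric_speed \<theta> t :: real"
  note m = metric_speed_indicator_bounds[OF \<theta>]
  obtain B where B: "B \<ge> 0" "\<And>x. \<bar>f x\<bar> \<le> B" using Lip_bE[OF f] by blast
  obtain g where g: "g \<in> borel_measurable borel"
    "AE t in lborel. t \<in> {0<..<1} \<longrightarrow> ((\<pi> \<circ> \<theta>) has_real_derivative g t) (at t)"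
    "\<And>t. \<bar>g t\<bar> \<le> lip_const \<pi> * L"
    "\<And>f. f \<in> Lip \<Longrightarrow> curve_current \<theta> f \<pi> = (LINT t:{0..1}|lborel. f (\<theta> (unit_clamp t)) * g t)"
    by (rule curve_current_density[OF \<theta> \<pi>]) blast
  note [measurable] = g(1) curve_mass_measurable[OF \<theta>] Lip_borel_measurable[OF Lip_b_imp_Lip[OF f]]
  have int: "integrable lborel (\<lambda>t. lip_const \<pi> * (?m t * \<bar>f (\<theta> (unit_clamp t))\<bar>))"
  proof (intro integrable_mult_right Bochner_Integration.integrable_bound[OF integrable_mult_left[OF integrable_metric_speed[OF \<theta>], of B]])
    show "AE t in lborel. norm (?m t * \<bar>f (\<theta> (unit_clamp t))\<bar>) \<le> norm (?m t * B)"
      using B m by (intro AE_I2) (auto simp: abs_mult intro!: mult_left_mono)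
  qed measurable
  have "\<bar>curve_current \<theta> f \<pi>\<bar> = \<bar>LINT t:{0..1}|lborel. f (\<theta> (unit_clamp t)) * g t\<bar>"
    using g(4)[OF Lip_b_imp_Lip[OF f]] by simp
  also have "\<dots> \<le> (LINT t|lborel. \<bar>indicator {0..1} t *\<^sub>R (f (\<theta> (unit_clamp t)) * g t)\<bar>)"
    unfolding set_lebesgue_integral_def by (rule integral_abs_bound)
  also have "\<dots> \<le> (LINT t|lborel. lip_const \<pi> * (?m t * \<bar>f (\<theta> (unit_clamp t))\<bar>))"
  proof (rule integral_mono_AE'[OF int])
    have "AE t in lborel. t \<notin> {0, 1::real}"
      by (intro AE_not_in finite_imp_null_set_lborel) auto
    then show "AE t in lborel. \<bar>indicator {0..1} t *\<^sub>R (f (\<theta> (unit_clamp t)) * g t)\<bar>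
        \<le> lip_const \<pi> * (?m t * \<bar>f (\<theta> (unit_clamp t))\<bar>)"
      using g(2)
    proof eventually_elim
      case (elim t)
      show ?case
      proof (cases "t \<in> {0<..<1}")
        case True
        then have "\<bar>g t\<bar> \<le> lip_const \<pi> * metric_speed \<theta> t"
          using elim by (intro derivative_le_metric_speed[OF \<theta> _ \<pi>]) auto
        then have "\<bar>f (\<theta> t)\<bar> * \<bar>g t\<bar> \<le> \<bar>f (\<theta> t)\<bar> * (lip_const \<pi> * metric_speed \<theta> t)"
          by (rule mult_left_mono) auto
        then show ?thesis using True by (simp add: abs_mult mult_ac)
      qed (use elim in \<open>auto simp: indicator_def\<close>)
    qed
    show "AE t in lborel. 0 \<le> lip_const \<pi> * (?m t * \<bar>f (\<theta> (unit_clamp t))\<bar>)"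
      by (intro AE_I2 mult_nonneg_nonneg[OF _ mult_nonneg_nonneg[OF m(1)]] lip_const_nonneg[OF \<pi>]) auto
  qed
  also have "\<dots> = lip_const \<pi> * (LINT t|lborel. ?m t * \<bar>f (\<theta> (unit_clamp t))\<bar>)" by simp
  also have "(LINT t|lborel. ?m t * \<bar>f (\<theta> (unit_clamp t))\<bar>) = (LINT x|curve_mass \<theta>. \<bar>f x\<bar>)"
    unfolding curve_mass_def using m by (subst integral_distr) (auto simp: integral_density)
  finally show "\<bar>curve_current \<theta> f \<pi>\<bar> \<le> lip_const \<pi> * (LINT x|curve_mass \<theta>. \<bar>f x\<bar>)" .
qed

section \<open>The axioms of a metric current for the current of a curve\<close>

lemma mass_boundD:
  assumes "mass_bound T \<mu>" "f \<in> Lip_b" "\<pi> \<in> Lip"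
  shows "\<bar>T f \<pi>\<bar> \<le> lip_const \<pi> * (LINT x|\<mu>. \<bar>f x\<bar>)"
  using assms by (simp add: mass_bound_def)

lemma bilinear_curve_current:
  assumes \<theta>: "L-lipschitz_on {0..1} \<theta>"
  shows "bilinear_functional (curve_current \<theta>)"
proof -
  have right: "curve_current \<theta> f (\<lambda>x. a * \<pi> x + b * \<sigma> x) = a * curve_current \<theta> f \<pi> + b * curve_current \<theta> f \<sigma>"
    if f: "f \<in> Lip" and \<pi>: "\<pi> \<in> Lip" and \<sigma>: "\<sigma> \<in> Lip" for f \<pi> \<sigma> a b
  proof -
    obtain g where g: "g \<in> borel_measurable borel"
      "AE t in lborel. t \<in> {0<..<1} \<longrightarrow> ((\<pi> \<circ> \<theta>) has_real_derivative g t) (at t)"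
      "\<And>t. \<bar>g t\<bar> \<le> lip_const \<pi> * L"
      "\<And>f. f \<in> Lip \<Longrightarrow> curve_current \<theta> f \<pi> = (LINT t:{0..1}|lborel. f (\<theta> (unit_clamp t)) * g t)"
      by (rule curve_current_density[OF \<theta> \<pi>]) blast
    obtain k where k: "k \<in> borel_measurable borel"
      "AE t in lborel. t \<in> {0<..<1} \<longrightarrow> ((\<sigma> \<circ> \<theta>) has_real_derivative k t) (at t)"
      "\<And>t. \<bar>k t\<bar> \<le> lip_const \<sigma> * L"
      "\<And>f. f \<in> Lip \<Longrightarrow> curve_current \<theta> f \<sigma> = (LINT t:{0..1}|lborel. f (\<theta> (unit_clamp t)) * k t)"
      by (rule curve_current_density[OF \<theta> \<sigma>]) blast
    note [measurable] = g(1) k(1) curve_mass_measurable(2)[OF \<theta>] Lip_borel_measurable[OF f]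
    \<comment> \<open>f is merely Lipschitz here, since \<open>left\<close> below puts \<pi> in the
      first slot; a bound along the curve comes from compactness of the parameter interval.\<close>
    have fb: "\<exists>B. \<forall>t. \<bar>f (\<theta> (unit_clamp t))\<bar> \<le> B"
    proof -
      have "compact ((f \<circ> \<theta>) ` {0..1})"
        by (intro compact_continuous_image lipschitz_on_continuous_on[OF lipschitz_comp_curve[OF \<theta> f]]) auto
      then obtain B where "\<forall>y\<in>(f \<circ> \<theta>) ` {0..1}. norm y \<le> B"
        using compact_imp_bounded bounded_iff by blast
      then show ?thesis by (intro exI[of _ B]) auto
    qed
    then obtain B where B: "\<And>t. \<bar>f (\<theta> (unit_clamp t))\<bar> \<le> B" by blast
    have B0: "0 \<le> B" using B[of 0] by linarith
    have int: "set_integrable lborel {0..1} (\<lambda>t. f (\<theta> (unit_clamp t)) * p t)"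
      if "p \<in> borel_measurable borel" "\<And>t. \<bar>p t\<bar> \<le> M" for p M
    proof (rule set_integrable_Icc_bounded)
      note [measurable] = that(1)
      show "(\<lambda>t. f (\<theta> (unit_clamp t)) * p t) \<in> borel_measurable borel" by measurable
      show "\<bar>f (\<theta> (unit_clamp t)) * p t\<bar> \<le> B * M" for t
        unfolding abs_mult by (intro mult_mono B that B0) auto
    qed
    have "curve_current \<theta> f (\<lambda>x. a * \<pi> x + b * \<sigma> x) =
      (LINT t:{0..1}|lborel. a * (f (\<theta> (unit_clamp t)) * g t) + b * (f (\<theta> (unit_clamp t)) * k t))"
      unfolding curve_current_def
    proof (rule set_lebesgue_integral_eq_lborel)
      show "AE t in lborel. t \<in> {0<..<1} \<longrightarrow> f (\<theta> t) * deriv ((\<lambda>x. a * \<pi> x + b * \<sigma> x) \<circ> \<theta>) t =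
         a * (f (\<theta> (unit_clamp t)) * g t) + b * (f (\<theta> (unit_clamp t)) * k t)"
        using g(2) k(2)
      proof eventually_elim
        case (elim t)
        show ?case
        proof
          assume t: "t \<in> {0<..<1}"
          have "((\<pi> \<circ> \<theta>) has_real_derivative g t) (at t)" "((\<sigma> \<circ> \<theta>) has_real_derivative k t) (at t)"
            using elim t by blast+
          then have "((\<lambda>t. a * (\<pi> \<circ> \<theta>) t + b * (\<sigma> \<circ> \<theta>) t) has_real_derivative (a * g t + b * k t)) (at t)"
            by (intro DERIV_add DERIV_cmult)
          then have "deriv ((\<lambda>x. a * \<pi> x + b * \<sigma> x) \<circ> \<theta>) t = a * g t + b * k t"
            by (intro DERIV_imp_deriv) (simp add: o_def)
          then show "f (\<theta> t) * deriv ((\<lambda>x. a * \<pi> x + b * \<sigma> x) \<circ> \<theta>) t =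
             a * (f (\<theta> (unit_clamp t)) * g t) + b * (f (\<theta> (unit_clamp t)) * k t)"
            using t by (simp add: algebra_simps)
        qed
      qed
    qed measurable
    also have "\<dots> = a * curve_current \<theta> f \<pi> + b * curve_current \<theta> f \<sigma>"
      using int[OF g(1,3)] int[OF k(1,3)] g(4)[OF f] k(4)[OF f]
      by (simp add: set_integral_add set_integral_mult_right)
    finally show ?thesis .
  qed
  \<comment> \<open>Integration by parts exchanges the two arguments, so linearity in f follows from
    linearity in the differentiated argument.\<close>
  have left: "curve_current \<theta> (\<lambda>x. a * f x + b * g x) \<pi> = a * curve_current \<theta> f \<pi> + b * curve_current \<theta> g \<pi>"
    if f: "f \<in> Lip" and g: "g \<in> Lip" and \<pi>: "\<pi> \<in> Lip" for f g \<pi> a b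
    unfolding curve_current_by_parts[OF \<theta> Lip_lincomb[OF f g] \<pi>] curve_current_by_parts[OF \<theta> f \<pi>]
      curve_current_by_parts[OF \<theta> g \<pi>] right[OF \<pi> f g]
    by (simp add: algebra_simps)
  show ?thesis
    unfolding bilinear_functional_def using left right Lip_b_imp_Lip by blast
qed

lemma curve_current_continuous:
  assumes \<theta>: "L-lipschitz_on {0..1} \<theta>" and f: "f \<in> Lip" and \<pi>: "\<pi> \<in> Lip"
    and \<pi>s: "\<And>j::nat. \<pi>s j \<in> Lip" "bdd_above (range (\<lambda>j. lip_const (\<pi>s j)))"
    and lim: "\<And>x. (\<lambda>j. \<pi>s j x) \<longlonglongrightarrow> \<pi> x"
  shows "(\<lambda>j. curve_current \<theta> f (\<pi>s j)) \<longlonglongrightarrow> curve_current \<theta> f \<pi>"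
proof -
  obtain k where k: "k \<in> borel_measurable borel" "\<And>t. \<bar>k t\<bar> \<le> lip_const f * L"
    "\<And>\<pi>. \<pi> \<in> Lip \<Longrightarrow> curve_current \<theta> \<pi> f = (LINT t:{0..1}|lborel. \<pi> (\<theta> (unit_clamp t)) * k t)"
    by (rule curve_current_density[OF \<theta> f]) blast
  obtain \<Lambda> where \<Lambda>: "\<And>j. lip_const (\<pi>s j) \<le> \<Lambda>" using \<pi>s(2) by (auto simp: bdd_above_def)
  \<comment> \<open>Pointwise convergence bounds the values at the single point \<theta> 0, and the
    common Lipschitz constant spreads this bound along the curve. This is the majorant for dominated
    convergence.\<close>
  obtain C where C: "\<And>j. \<bar>\<pi>s j (\<theta> 0)\<bar> \<le> C"
    using convergent_imp_bounded[OF lim[of "\<theta> 0"]] by (auto simp: bounded_iff)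
  have L0: "0 \<le> L" using \<theta> by (rule lipschitz_on_nonneg)
  have bd: "\<bar>\<pi>s j (\<theta> (unit_clamp t))\<bar> \<le> C + \<Lambda> * L" for j t
  proof -
    have l: "0 \<le> lip_const (\<pi>s j)" using \<pi>s(1) by (rule lip_const_nonneg)
    have "\<bar>\<pi>s j (\<theta> (unit_clamp t)) - \<pi>s j (\<theta> 0)\<bar> \<le> lip_const (\<pi>s j) * dist (\<theta> (unit_clamp t)) (\<theta> 0)"
      by (rule Lip_dist_le[OF \<pi>s(1)])
    also have "\<dots> \<le> \<Lambda> * L"
    proof (rule mult_mono[OF \<Lambda>])
      have "dist (\<theta> (unit_clamp t)) (\<theta> 0) \<le> L * dist (unit_clamp t) 0"
        using \<theta> by (rule lipschitz_onD) auto
      also have "\<dots> \<le> L * 1" using L0 by (intro mult_left_mono) auto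
      finally show "dist (\<theta> (unit_clamp t)) (\<theta> 0) \<le> L" by simp
    qed (use l \<Lambda>[of j] in auto)
    finally show ?thesis using C[of j] by linarith
  qed
  have "(\<lambda>j. LINT t:{0..1}|lborel. \<pi>s j (\<theta> (unit_clamp t)) * k t) \<longlonglongrightarrow> (LINT t:{0..1}|lborel. \<pi> (\<theta> (unit_clamp t)) * k t)"
    unfolding set_lebesgue_integral_def
  proof (rule integral_dominated_convergence)
    note [measurable] = k(1) curve_mass_measurable(2)[OF \<theta>] Lip_borel_measurable[OF \<pi>] Lip_borel_measurable[OF \<pi>s(1)]
    show "(\<lambda>t. indicator {0..1} t *\<^sub>R (\<pi> (\<theta> (unit_clamp t)) * k t)) \<in> borel_measurable lborel" by measurable
    show "(\<lambda>t. indicator {0..1} t *\<^sub>R (\<pi>s j (\<theta> (unit_clamp t)) * k t)) \<in> borel_measurable lborel" for j by measurable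
    show "integrable lborel (\<lambda>t. indicator {0..1::real} t *\<^sub>R ((C + \<Lambda> * L) * (lip_const f * L)))"
      by (intro integrableI_bounded_set_indicator[where B="\<bar>(C + \<Lambda> * L) * (lip_const f * L)\<bar>"]) (auto simp: emeasure_lborel_Icc_eq)
    show "AE t in lborel. (\<lambda>j. indicator {0..1} t *\<^sub>R (\<pi>s j (\<theta> (unit_clamp t)) * k t)) \<longlonglongrightarrow>
        indicator {0..1} t *\<^sub>R (\<pi> (\<theta> (unit_clamp t)) * k t)"
      by (intro AE_I2 tendsto_intros lim)
    show "AE t in lborel. norm (indicator {0..1} t *\<^sub>R (\<pi>s j (\<theta> (unit_clamp t)) * k t))
        \<le> indicator {0..1} t *\<^sub>R ((C + \<Lambda> * L) * (lip_const f * L))" for j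
    proof (intro AE_I2)
      fix t
      have "\<bar>\<pi>s j (\<theta> (unit_clamp t))\<bar> * \<bar>k t\<bar> \<le> (C + \<Lambda> * L) * (lip_const f * L)"
        using bd[of j t] k(2)[of t] by (intro mult_mono) linarith+
      then show "norm (indicator {0..1} t *\<^sub>R (\<pi>s j (\<theta> (unit_clamp t)) * k t))
        \<le> indicator {0..1} t *\<^sub>R ((C + \<Lambda> * L) * (lip_const f * L))"
        by (auto simp: abs_mult indicator_def)
    qed
  qed
  then have "(\<lambda>j. curve_current \<theta> (\<pi>s j) f) \<longlonglongrightarrow> curve_current \<theta> \<pi> f"
    using k(3) \<pi> \<pi>s(1) by simp
  then have "(\<lambda>j. f (\<theta> 1) * \<pi>s j (\<theta> 1) - f (\<theta> 0) * \<pi>s j (\<theta> 0) - curve_current \<theta> (\<pi>s j) f) \<longlonglongrightarrow>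
    f (\<theta> 1) * \<pi> (\<theta> 1) - f (\<theta> 0) * \<pi> (\<theta> 0) - curve_current \<theta> \<pi> f"
    by (intro tendsto_intros lim)
  then show ?thesis
    using curve_current_by_parts[OF \<theta> f \<pi>] curve_current_by_parts[OF \<theta> f \<pi>s(1)] by simp
qed

text \<open>At a time t with f (\<theta> t) nonzero the curve stays in U for nearby times, so \<pi>
  \<circ> \<theta> is locally constant and its derivative vanishes.\<close>

lemma curve_current_local:
  assumes \<theta>: "L-lipschitz_on {0..1} \<theta>" and U: "open U" "closure {x. f x \<noteq> 0} \<subseteq> U" "\<And>x. x \<in> U \<Longrightarrow> \<pi> x = a"
  shows "curve_current \<theta> f \<pi> = 0"
proof -
  have "curve_current \<theta> f \<pi> = (LINT t:{0..1::real}|lborel. 0::real)"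
    unfolding curve_current_def
  proof (rule set_lebesgue_integral_eq_lborel)
    show "AE t in lborel. t \<in> {0<..<1} \<longrightarrow> f (\<theta> t) * deriv (\<pi> \<circ> \<theta>) t = 0"
    proof (intro AE_I2 impI)
      fix t :: real assume t: "t \<in> {0<..<1}"
      show "f (\<theta> t) * deriv (\<pi> \<circ> \<theta>) t = 0"
      proof (cases "f (\<theta> t) = 0")
        case False
        then have "\<theta> t \<in> {x. f x \<noteq> 0}" by simp
        then have "\<theta> t \<in> U" using U(2) closure_subset[of "{x. f x \<noteq> 0}"] by (meson subsetD)
        have "continuous (at t) \<theta>"
          by (rule continuous_on_interior[OF lipschitz_on_continuous_on[OF \<theta>]])
            (use t in \<open>simp only: interior_atLeastAtMost_real\<close>)
        then have "\<forall>\<^sub>F s in at t. \<theta> s \<in> U"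
          using \<open>\<theta> t \<in> U\<close> U(1)
          unfolding continuous_within by (intro topological_tendstoD)
        then have "\<forall>\<^sub>F s in nhds t. \<theta> s \<in> U"
          using \<open>\<theta> t \<in> U\<close> by (simp add: eventually_nhds_conv_at)
        then have "\<forall>\<^sub>F s in nhds t. (\<pi> \<circ> \<theta>) s = a"
          by (rule eventually_mono) (simp add: U(3))
        then have "((\<pi> \<circ> \<theta>) has_real_derivative 0) (at t)"
          using DERIV_cong_ev[OF refl _ refl, of "\<pi> \<circ> \<theta>" "\<lambda>_. a" t 0] by simp
        then show ?thesis by (simp add: DERIV_imp_deriv)
      qed simp
    qed
  qed simp
  then show ?thesis by simp
qed

lemma metric_current_curve_current:
  assumes "L-lipschitz_on {0..1} \<theta>"
  shows "metric_current (curve_current \<theta>)"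
  unfolding metric_current_def
proof (intro conjI ballI allI impI)
  show "bilinear_functional (curve_current \<theta>)" by (rule bilinear_curve_current[OF assms])
  show "\<exists>\<mu>. mass_bound (curve_current \<theta>) \<mu>" using mass_bound_curve_current[OF assms] by blast
  fix f \<pi> :: "'a \<Rightarrow> real" assume f: "f \<in> Lip_b" and \<pi>: "\<pi> \<in> Lip"
  {
    fix \<pi>s :: "nat \<Rightarrow> 'a \<Rightarrow> real"
    assume "(\<forall>j. \<pi>s j \<in> Lip) \<and> bdd_above (range (\<lambda>j. lip_const (\<pi>s j))) \<and> (\<forall>x. (\<lambda>j. \<pi>s j x) \<longlonglongrightarrow> \<pi> x)"
    then show "(\<lambda>j. curve_current \<theta> f (\<pi>s j)) \<longlonglongrightarrow> curve_current \<theta> f \<pi>"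
      by (intro curve_current_continuous[OF assms Lip_b_imp_Lip[OF f] \<pi>]) auto
  }
  assume "\<exists>U a. open U \<and> closure {x. f x \<noteq> 0} \<subseteq> U \<and> (\<forall>x\<in>U. \<pi> x = a)"
  then obtain U a where "open U" "closure {x. f x \<noteq> 0} \<subseteq> U" "\<And>x. x \<in> U \<Longrightarrow> \<pi> x = a" by blast
  then show "curve_current \<theta> f \<pi> = 0" by (rule curve_current_local[OF assms])
qed

text \<open>Testing the current with 1 and the distance from \<theta> 0 gives exactly the distance
  of the endpoints, while the mass bound limits the value by the length.\<close>

lemma curve_length_ge_dist:
  assumes \<theta>: "L-lipschitz_on {0..1} \<theta>"
  shows "dist (\<theta> 0) (\<theta> 1) \<le> curve_length \<theta>"
proof -
  define \<pi> where "\<pi> x = dist (\<theta> 0) x" for x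
  have l1: "1-lipschitz_on UNIV \<pi>"
  proof (rule lipschitz_onI)
    fix x y
    show "dist (\<pi> x) (\<pi> y) \<le> 1 * dist x y"
      using dist_triangle[of "\<theta> 0" x y] dist_triangle[of "\<theta> 0" y x]
      by (simp add: \<pi>_def dist_real_def dist_commute abs_le_iff)
  qed simp
  then have \<pi>: "\<pi> \<in> Lip" by (rule LipI)
  have "dist (\<theta> 0) (\<theta> 1) = curve_current \<theta> (\<lambda>_. 1) \<pi>"
    using boundary_curve_current[OF \<theta> \<pi>] by (simp add: \<pi>_def)
  also have "\<dots> \<le> lip_const \<pi> * (LINT x|curve_mass \<theta>. \<bar>1\<bar>)"
    using mass_boundD[OF mass_bound_curve_current[OF \<theta>] Lip_b_const \<pi>, of 1] by linarith
  also have "\<dots> = lip_const \<pi> * curve_length \<theta>"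
    using finite_borel_curve_mass[OF \<theta>] by (simp add: curve_mass_def)
  also have "\<dots> \<le> 1 * curve_length \<theta>"
    by (intro mult_right_mono lip_const_le[OF l1] curve_length_nonneg[OF \<theta>])
  finally show ?thesis by simp
qed

section \<open>Affine reparametrization and subdivision of curves\<close>

lemma metric_speed_scale:
  assumes \<theta>: "L-lipschitz_on {0..1} \<theta>" and s: "p + q * t \<in> {0..<1}" and q: "q > 0"
  shows "metric_speed (\<lambda>t. \<theta> (p + q * t)) t = q * metric_speed \<theta> (p + q * t)"
proof -
  let ?\<sigma> = "\<lambda>t. \<theta> (p + q * t)"
  have scale: "(\<forall>\<^sub>F h in at_right 0. P (q * h)) \<longleftrightarrow> (\<forall>\<^sub>F h in at_right 0. P h)" for P
  proof -
    have "filtermap ((*) q) (at_right 0) = at_right 0"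
      using filtermap_times_pos_at_right[OF q, of 0] by simp
    then show ?thesis using eventually_filtermap[of P "(*) q" "at_right 0"] by simp
  qed
  have ev: "(\<forall>\<^sub>F h in at_right 0. dist (?\<sigma> (t + h)) (?\<sigma> t) \<le> K * h) \<longleftrightarrow>
    (\<forall>\<^sub>F h in at_right 0. dist (\<theta> (p + q * t + h)) (\<theta> (p + q * t)) \<le> K / q * h)" for K
    using scale[of "\<lambda>h. dist (\<theta> (p + q * t + h)) (\<theta> (p + q * t)) \<le> K / q * h"] q
    by (simp add: algebra_simps)
  note L = eventually_dist_le_lipschitz[OF \<theta> s]
  have L': "\<forall>\<^sub>F h in at_right 0. dist (?\<sigma> (t + h)) (?\<sigma> t) \<le> (q * L) * h"
    unfolding ev using L q by simp
  have "metric_speed ?\<sigma> t \<le> a \<longleftrightarrow> q * metric_speed \<theta> (p + q * t) \<le> a" for a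
  proof -
    have "metric_speed ?\<sigma> t \<le> a \<longleftrightarrow> (\<forall>e>0. \<forall>\<^sub>F h in at_right 0. dist (\<theta> (p + q * t + h)) (\<theta> (p + q * t)) \<le> (a + e) / q * h)"
      unfolding metric_speed_le_iff[OF L'] ev ..
    also have "\<dots> \<longleftrightarrow> (\<forall>e>0. \<forall>\<^sub>F h in at_right 0. dist (\<theta> (p + q * t + h)) (\<theta> (p + q * t)) \<le> (a / q + e) * h)"
    proof (intro iffI allI impI)
      fix e :: real assume e: "0 < e" and *: "\<forall>e>0. \<forall>\<^sub>F h in at_right 0. dist (\<theta> (p + q * t + h)) (\<theta> (p + q * t)) \<le> (a + e) / q * h"
      have "(a + q * e) / q = a / q + e" using q by (simp add: field_simps)
      then show "\<forall>\<^sub>F h in at_right 0. dist (\<theta> (p + q * t + h)) (\<theta> (p + q * t)) \<le> (a / q + e) * h"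
        using *[rule_format, of "q * e"] q e by simp
    next
      fix e :: real assume e: "0 < e" and *: "\<forall>e>0. \<forall>\<^sub>F h in at_right 0. dist (\<theta> (p + q * t + h)) (\<theta> (p + q * t)) \<le> (a / q + e) * h"
      have "a / q + e / q = (a + e) / q" using q by (simp add: field_simps)
      then show "\<forall>\<^sub>F h in at_right 0. dist (\<theta> (p + q * t + h)) (\<theta> (p + q * t)) \<le> (a + e) / q * h"
        using *[rule_format, of "e / q"] q e by simp
    qed
    also have "\<dots> \<longleftrightarrow> metric_speed \<theta> (p + q * t) \<le> a / q"
      unfolding metric_speed_le_iff[OF L] ..
    also have "\<dots> \<longleftrightarrow> q * metric_speed \<theta> (p + q * t) \<le> a"
      using q by (simp add: field_simps)
    finally show ?thesis .
  qed
  then show ?thesis by (metis order_antisym order_refl)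
qed

lemma curve_length_affine:
  assumes \<theta>: "L-lipschitz_on {0..1} \<theta>" and p: "0 \<le> p" "p + q \<le> 1" and q: "q > 0"
  shows "curve_length (\<lambda>t. \<theta> (p + q * t)) = (LINT t|lborel. indicator {p<..<p + q} t * metric_speed \<theta> t)"
proof -
  have "(L * q)-lipschitz_on {0..1} (\<lambda>t. \<theta> (p + q * t))"
  proof (rule lipschitz_onI)
    fix s t :: real assume st: "s \<in> {0..1}" "t \<in> {0..1}"
    have *: "p + q * r \<in> {0..1}" if "r \<in> {0..1}" for r
    proof -
      have "0 \<le> q * r" "q * r \<le> q" using that q mult_left_le[of r q] by auto
      then show ?thesis using p by auto
    qed
    have "dist (\<theta> (p + q * s)) (\<theta> (p + q * t)) \<le> L * dist (p + q * s) (p + q * t)"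
      using \<theta> by (rule lipschitz_onD) (use * st in auto)
    also have "dist (p + q * s) (p + q * t) = q * dist s t"
      using q by (simp add: dist_real_def abs_mult flip: right_diff_distrib)
    finally show "dist (\<theta> (p + q * s)) (\<theta> (p + q * t)) \<le> L * q * dist s t" by (simp add: mult.assoc)
  qed (use q lipschitz_on_nonneg[OF \<theta>] in auto)
  then have "curve_length (\<lambda>t. \<theta> (p + q * t)) =
    (LINT t|lborel. indicator {0<..<1} t * metric_speed (\<lambda>t. \<theta> (p + q * t)) t)"
    by (rule curve_length_eq_lborel)
  \<comment> \<open>The factor q gained by the speed is the Jacobian of the affine change of
    variables that follows.\<close>
  also have "\<dots> = (LINT t|lborel. q * (indicator {p<..<p + q} (p + q * t) * metric_speed \<theta> (p + q * t)))"
  proof (rule Bochner_Integration.integral_cong[OF refl])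
    fix t :: real
    show "indicator {0<..<1} t * metric_speed (\<lambda>t. \<theta> (p + q * t)) t =
      q * (indicator {p<..<p + q} (p + q * t) * metric_speed \<theta> (p + q * t))"
    proof (cases "t \<in> {0<..<1}")
      case True
      have "q * t < q" "0 < q * t" using True q by auto
      then have "p + q * t \<in> {0..<1}" "p + q * t \<in> {p<..<p + q}" using p by auto
      then show ?thesis
        using True metric_speed_scale[OF \<theta> _ q, of p t] by simp
    next
      case False
      then have "p + q * t \<notin> {p<..<p + q}" using q by (auto simp: zero_less_mult_iff)
      then show ?thesis using False by simp
    qed
  qed
  also have "\<dots> = (LINT t|lborel. indicator {p<..<p + q} t * metric_speed \<theta> t)"
    using lborel_integral_real_affine[of q "\<lambda>t. indicator {p<..<p + q} t * metric_speed \<theta> t" p] q by simp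
  finally show ?thesis .
qed

text \<open>Stretching a subinterval of length 1 / n to [0,1] divides the Lipschitz constant by n,
  so any positive n \<ge> L makes the pieces 1-Lipschitz, while the lengths of the pieces add
  up.\<close>

lemma curve_subdivision:
  fixes \<theta> :: "real \<Rightarrow> 'a::metric_space"
  assumes \<theta>: "L-lipschitz_on {0..1} \<theta>"
  obtains n :: nat where "n > 0" "\<And>k. k < n \<Longrightarrow> (\<lambda>t. \<theta> (real k / n + 1 / n * t)) \<in> Lip_1_curves"
    "(\<Sum>k<n. curve_length (\<lambda>t. \<theta> (real k / n + 1 / n * t))) = curve_length \<theta>"
proof -
  obtain n0 :: nat where "L \<le> n0" using real_arch_simple by blast
  define n where "n = Suc n0"
  have n: "n > 0" "L \<le> n" using \<open>L \<le> n0\<close> by (auto simp: n_def)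
  have le: "real k / n + 1 / n \<le> 1" if "k < n" for k
    using n that by (simp add: field_simps)
  have "(\<lambda>t. \<theta> (real k / n + 1 / n * t)) \<in> Lip_1_curves" if "k < n" for k
    unfolding Lip_1_curves_def
  proof (rule CollectI, rule lipschitz_onI)
    fix s t :: real assume st: "s \<in> {0..1}" "t \<in> {0..1}"
    have *: "k / n + 1 / n * r \<in> {0..1}" if "r \<in> {0..1}" for r
    proof -
      have "1 / n * r \<le> 1 / n" using that by (auto simp: divide_right_mono)
      then show ?thesis using that le[OF \<open>k < n\<close>] by (auto intro: add_nonneg_nonneg)
    qed
    have "dist (\<theta> (k / n + 1 / n * s)) (\<theta> (real k / n + 1 / n * t)) \<le> L * dist (k / n + 1 / n * s) (k / n + 1 / n * t)"
      using \<theta> by (rule lipschitz_onD) (use * st in auto)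
    also have "dist (k / n + 1 / n * s) (k / n + 1 / n * t) = dist s t / n"
      by (simp add: dist_real_def flip: diff_divide_distrib)
    also have "L * (dist s t / n) \<le> n * (dist s t / n)" using n by (intro mult_right_mono) auto
    finally show "dist (\<theta> (k / n + 1 / n * s)) (\<theta> (real k / n + 1 / n * t)) \<le> 1 * dist s t" using n by simp
  qed simp
  \<comment> \<open>The first m pieces cover the open interval up to m / n except for their common
    endpoints, a null set.\<close>
  moreover have "(\<Sum>k<m. curve_length (\<lambda>t. \<theta> (real k / n + 1 / n * t))) =
    (LINT t|lborel. indicator {0<..<m / n} t * metric_speed \<theta> t)" if "m \<le> n" for m :: nat
    using that
  proof (induction m)
    case (Suc m)
    let ?J = "\<lambda>A t. indicator A t * metric_speed \<theta> t :: real"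
    have *: "real m / n + 1 / n = Suc m / n" by (simp add: add_divide_distrib)
    have le1: "real (Suc m) / n \<le> 1" using Suc.prems n by simp
    have int: "integrable lborel (?J {a<..<b})" if "0 \<le> a" "b \<le> 1" for a b :: real
    proof -
      have "?J {a<..<b} = (\<lambda>t. indicator {a<..<b} t *\<^sub>R ?J {0<..<1} t)"
        using that by (auto simp: indicator_def)
      then show ?thesis using integrable_mult_indicator[OF _ integrable_metric_speed[OF \<theta>]] by simp
    qed
    have i: "integrable lborel (?J {0<..<m / n})" "integrable lborel (?J {m / n<..<Suc m / n})"
      using le1 by (auto intro!: int simp: divide_le_eq_1)
    have "(\<Sum>k<Suc m. curve_length (\<lambda>t. \<theta> (real k / n + 1 / n * t))) =
      (LINT t|lborel. ?J {0<..<m / n} t) + (LINT t|lborel. ?J {m / n<..<m / n + 1 / n} t)"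
      using Suc curve_length_affine[OF \<theta>, of "m / n" "1 / n"] le[of m] n by simp
    also have "\<dots> = (LINT t|lborel. ?J {0<..<m / n} t + ?J {m / n<..<Suc m / n} t)"
      unfolding * using i by simp
    also have "\<dots> = (LINT t|lborel. ?J {0<..<Suc m / n} t)"
    proof (rule integral_cong_AE)
      have "AE t in lborel. t \<notin> {real m / n}"
        by (intro AE_not_in finite_imp_null_set_lborel) auto
      then show "AE t in lborel. ?J {0<..<m / n} t + ?J {m / n<..<Suc m / n} t = ?J {0<..<Suc m / n} t"
      proof eventually_elim
        case (elim t)
        have "?J {0<..<a} t + ?J {a<..<b} t = ?J {0<..<b} t" if "0 \<le> a" "a < b" "t \<noteq> a" for a b
          using that by (auto simp: indicator_def)
        then show ?case using elim n by (simp add: divide_strict_right_mono)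
      qed
      show "?J {0<..<Suc m / n} \<in> borel_measurable lborel"
        using int[OF _ le1, of 0] by auto
      show "(\<lambda>t. ?J {0<..<m / n} t + ?J {m / n<..<Suc m / n} t) \<in> borel_measurable lborel"
        using i by (intro borel_measurable_add) auto
    qed
    finally show ?case .
  qed simp
  from this[of n] have "(\<Sum>k<n. curve_length (\<lambda>t. \<theta> (real k / n + 1 / n * t))) = curve_length \<theta>"
    using n curve_length_eq_lborel[OF \<theta>] by simp
  ultimately show ?thesis using n that by blast
qed

text \<open>The lengths of the pieces sum to the distance of the endpoints, which the triangle
  inequality bounds by the sum of the endpoint distances of the pieces. Each length is at least the
  corresponding distance, so all of them are equal.\<close>

lemma geodesic_subdivision:
  fixes \<theta> :: "real \<Rightarrow> 'a::metric_space"
  assumes "geodesic \<theta>"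
  obtains n :: nat where "n > 0"
    "\<And>k. k < n \<Longrightarrow> (\<lambda>t. \<theta> (real k / n + 1 / n * t)) \<in> Lip_1_curves \<inter> Collect geodesic"
    "(\<Sum>k<n. curve_length (\<lambda>t. \<theta> (real k / n + 1 / n * t))) = curve_length \<theta>"
proof -
  obtain L where \<theta>: "L-lipschitz_on {0..1} \<theta>"
    using assms by (auto simp: geodesic_def Lipschitz_curve_def)
  obtain n :: nat where n: "n > 0" "\<And>k. k < n \<Longrightarrow> (\<lambda>t. \<theta> (real k / n + 1 / n * t)) \<in> Lip_1_curves"
    "(\<Sum>k<n. curve_length (\<lambda>t. \<theta> (real k / n + 1 / n * t))) = curve_length \<theta>"
    by (rule curve_subdivision[OF \<theta>]) blast
  let ?\<sigma> = "\<lambda>k t. \<theta> (real k / n + 1 / n * t)"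
  have tri: "dist (\<theta> 0) (\<theta> (real m / n)) \<le> (\<Sum>k<m. dist (?\<sigma> k 0) (?\<sigma> k 1))" for m
  proof (induction m)
    case (Suc m)
    have "real m / n + 1 / n = Suc m / n" by (simp add: add_divide_distrib)
    then have "dist (\<theta> 0) (\<theta> (Suc m / n)) \<le> dist (\<theta> 0) (\<theta> (m / n)) + dist (?\<sigma> m 0) (?\<sigma> m 1)"
      using dist_triangle[of "\<theta> 0" "\<theta> (Suc m / n)" "\<theta> (m / n)"] by simp
    then show ?case using Suc by simp
  qed simp
  have ge: "dist (?\<sigma> k 0) (?\<sigma> k 1) \<le> curve_length (?\<sigma> k)" if "k < n" for k
    by (rule curve_length_ge_dist[of 1]) (use n(2)[OF that] in \<open>simp add: Lip_1_curves_def\<close>)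
  have "(\<Sum>k<n. curve_length (?\<sigma> k)) = dist (\<theta> 0) (\<theta> 1)"
    using n(3) assms by (simp add: geodesic_def)
  also have "\<dots> \<le> (\<Sum>k<n. dist (?\<sigma> k 0) (?\<sigma> k 1))"
    using tri[of n] n(1) by simp
  finally have le: "(\<Sum>k<n. curve_length (?\<sigma> k) - dist (?\<sigma> k 0) (?\<sigma> k 1)) \<le> 0"
    by (simp add: sum_subtractf)
  have "curve_length (?\<sigma> k) - dist (?\<sigma> k 0) (?\<sigma> k 1) = 0" if "k < n" for k
  proof -
    have "(\<Sum>k<n. curve_length (?\<sigma> k) - dist (?\<sigma> k 0) (?\<sigma> k 1)) = 0"
      using le ge by (intro antisym sum_nonneg) auto
    then have "\<forall>k\<in>{..<n}. curve_length (?\<sigma> k) - dist (?\<sigma> k 0) (?\<sigma> k 1) = 0"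
      using ge by (subst (asm) sum_nonneg_eq_0_iff) auto
    then show ?thesis using that by blast
  qed
  then have "?\<sigma> k \<in> Lip_1_curves \<inter> Collect geodesic" if "k < n" for k
    using n(2)[OF that] that by (auto simp: geodesic_def Lipschitz_curve_def Lip_1_curves_def)
  then show ?thesis using n that by blast
qed

lemma segment_length:
  fixes x y :: "'a::real_normed_vector"
  shows "(dist x y)-lipschitz_on {0..1} (\<lambda>t. (1 - t) *\<^sub>R x + t *\<^sub>R y)"
    and "curve_length (\<lambda>t. (1 - t) *\<^sub>R x + t *\<^sub>R y) \<le> dist x y"
proof -
  let ?\<theta> = "\<lambda>t. (1 - t) *\<^sub>R x + t *\<^sub>R y"
  have d: "dist (?\<theta> s) (?\<theta> t) = dist x y * dist s t" for s t
  proof -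
    have "?\<theta> s - ?\<theta> t = (t - s) *\<^sub>R (x - y)" by (simp add: algebra_simps)
    then have "norm (?\<theta> s - ?\<theta> t) = \<bar>t - s\<bar> * norm (x - y)" by (metis norm_scaleR)
    then show ?thesis by (simp add: dist_norm dist_real_def abs_minus_commute)
  qed
  show lip: "(dist x y)-lipschitz_on {0..1} ?\<theta>"
    by (rule lipschitz_onI) (simp_all only: d order_refl zero_le_dist)
  have "curve_length ?\<theta> \<le> (LINT t|lborel. dist x y * indicator {0<..<1::real} t)"
    unfolding curve_length_eq_lborel[OF lip]
    by (rule integral_mono[OF integrable_metric_speed[OF lip]])
      (use metric_speed_indicator_bounds[OF lip] in auto)
  also have "\<dots> = dist x y" by simp
  finally show "curve_length ?\<theta> \<le> dist x y" .
qed

section \<open>The minimal mass measure\<close>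

lemma borel_measurable_finite_borel_measure:
  assumes "finite_borel_measure \<mu>"
  shows "borel_measurable \<mu> = borel_measurable borel"
  by (rule measurable_cong_sets) (use assms in \<open>auto simp: finite_borel_measure_def\<close>)

lemma integrable_bounded_borel:
  fixes f :: "'a::topological_space \<Rightarrow> real"
  assumes "finite_borel_measure \<mu>" "f \<in> borel_measurable borel" "\<And>x. \<bar>f x\<bar> \<le> B"
  shows "integrable \<mu> f"
proof (rule finite_measure.integrable_const_bound[where B=B])
  show "f \<in> borel_measurable \<mu>"
    using assms(2) by (simp add: borel_measurable_finite_borel_measure[OF assms(1)])
qed (use assms in \<open>auto simp: finite_borel_measure_def\<close>)

lemma abs_diff_indicator_le: "0 \<le> a \<Longrightarrow> a \<le> 1 \<Longrightarrow> \<bar>a - indicator A x\<bar> \<le> (1::real)"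
  by (auto simp: indicator_def)

lemma open_indicator_lipschitz_limit:
  fixes A :: "'a::metric_space set"
  assumes "open A"
  obtains \<phi> :: "nat \<Rightarrow> 'a \<Rightarrow> real" where "\<And>k. \<phi> k \<in> Lip" "\<And>k x. 0 \<le> \<phi> k x" "\<And>k x. \<phi> k x \<le> 1"
    "\<And>x. (\<lambda>k. \<phi> k x) \<longlonglongrightarrow> indicator A x"
proof (cases "A = UNIV")
  \<comment> \<open>Treated apart because \<open>infdist\<close> to the empty set is 0, which would
    make the functions below vanish.\<close>
  case True
  then show ?thesis using that[of "\<lambda>_ _. 1"] by simp
next
  case False
  define \<phi> where "\<phi> k x = min 1 (real k * infdist x (- A))" for k x
  have "(real k)-lipschitz_on UNIV (\<phi> k)" for k
  proof (rule lipschitz_onI)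
    fix x y
    have "\<bar>infdist x (- A) - infdist y (- A)\<bar> \<le> dist x y"
      using infdist_triangle[of x "- A" y] infdist_triangle[of y "- A" x] by (simp add: dist_commute abs_le_iff)
    then have "real k * \<bar>infdist x (- A) - infdist y (- A)\<bar> \<le> real k * dist x y"
      by (intro mult_left_mono) auto
    then have "\<bar>real k * infdist x (- A) - real k * infdist y (- A)\<bar> \<le> real k * dist x y"
      by (simp add: abs_mult flip: right_diff_distrib)
    then show "dist (\<phi> k x) (\<phi> k y) \<le> real k * dist x y" by (auto simp: \<phi>_def dist_real_def)
  qed auto
  moreover have "(\<lambda>k. \<phi> k x) \<longlonglongrightarrow> indicator A x" for x
  proof (cases "x \<in> A")
    case True
    have "infdist x (- A) > 0"
      using False True assms by (intro infdist_pos_not_in_closed) (auto simp: closed_def)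
    then obtain N :: nat where N: "1 < real N * infdist x (- A)"
      using reals_Archimedean3 by blast
    have "\<forall>\<^sub>F k in sequentially. \<phi> k x = 1"
      using eventually_ge_at_top[of N]
    proof eventually_elim
      case (elim k)
      have "real N * infdist x (- A) \<le> real k * infdist x (- A)"
        using elim by (intro mult_right_mono infdist_nonneg) auto
      then show ?case using N by (simp add: \<phi>_def)
    qed
    then show ?thesis using True by (auto intro: tendsto_eventually)
  next
    case False
    then have "\<phi> k x = 0" for k by (simp add: \<phi>_def)
    then show ?thesis using False by simp
  qed
  moreover have "0 \<le> \<phi> k x" "\<phi> k x \<le> 1" for k x by (auto simp: \<phi>_def infdist_nonneg)
  ultimately show ?thesis by (intro that[of \<phi>] LipI)
qed

text \<open>The sets that can be approximated form a \<sigma>-algebra containing the open sets. One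
  function has to serve both measures, because patching them splits a single test function.\<close>

lemma lipschitz_approx_indicator:
  fixes \<mu> \<nu> :: "'a::metric_space measure"
  assumes \<mu>: "finite_borel_measure \<mu>" and \<nu>: "finite_borel_measure \<nu>" and A: "A \<in> sets borel" and "\<epsilon> > 0"
  shows "\<exists>\<phi>\<in>Lip_b. (\<forall>x. 0 \<le> \<phi> x \<and> \<phi> x \<le> 1) \<and>
    (LINT x|\<mu>. \<bar>\<phi> x - indicator A x\<bar>) < \<epsilon> \<and> (LINT x|\<nu>. \<bar>\<phi> x - indicator A x\<bar>) < \<epsilon>"
proof -
  define Q where "Q \<phi> A e \<longleftrightarrow> \<phi> \<in> Lip_b \<and> (\<forall>x. 0 \<le> \<phi> x \<and> \<phi> x \<le> 1) \<and>
    (LINT x|\<mu>. \<bar>\<phi> x - indicator A x\<bar>) < e \<and> (LINT x|\<nu>. \<bar>\<phi> x - indicator A x\<bar>) < e" for \<phi> :: "'a \<Rightarrow> real" and A e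
  have Qb: "\<phi> \<in> borel_measurable borel" if "Q \<phi> A e" for \<phi> A e
    using that by (auto simp: Q_def intro!: Lip_borel_measurable Lip_b_imp_Lip)
  have int: "integrable \<kappa> (\<lambda>x. \<bar>\<phi> x - indicator A x\<bar>)" if "finite_borel_measure \<kappa>" "A \<in> sets borel"
    "\<phi> \<in> borel_measurable borel" "\<And>x. 0 \<le> \<phi> x \<and> \<phi> x \<le> 1" for \<kappa> and \<phi> :: "'a \<Rightarrow> real" and A
  proof (rule integrable_bounded_borel[OF that(1)])
    show "(\<lambda>x. \<bar>\<phi> x - indicator A x\<bar>) \<in> borel_measurable borel" using that(2,3) by measurable
    show "\<bar>\<bar>\<phi> x - indicator A x\<bar>\<bar> \<le> 1" for x using that(4)[of x] by (auto simp: indicator_def)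
  qed
  have tri: "(LINT x|\<kappa>. \<bar>\<omega> x - indicator C x\<bar>) \<le> (LINT x|\<kappa>. \<bar>\<phi> x - indicator A x\<bar>) + (LINT x|\<kappa>. \<bar>\<psi> x - indicator B x\<bar>)"
    if \<kappa>: "finite_borel_measure \<kappa>" and ABC: "A \<in> sets borel" "B \<in> sets borel" "C \<in> sets borel"
      and f: "\<phi> \<in> borel_measurable borel" "\<psi> \<in> borel_measurable borel" "\<omega> \<in> borel_measurable borel"
       "\<And>x. 0 \<le> \<phi> x \<and> \<phi> x \<le> 1" "\<And>x. 0 \<le> \<psi> x \<and> \<psi> x \<le> 1" "\<And>x. 0 \<le> \<omega> x \<and> \<omega> x \<le> 1"
      and le: "\<And>x. \<bar>\<omega> x - indicator C x\<bar> \<le> \<bar>\<phi> x - indicator A x\<bar> + \<bar>\<psi> x - indicator B x\<bar>"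
    for \<kappa> and \<phi> \<psi> \<omega> :: "'a \<Rightarrow> real" and A B C
  proof -
    have "(LINT x|\<kappa>. \<bar>\<omega> x - indicator C x\<bar>) \<le> (LINT x|\<kappa>. \<bar>\<phi> x - indicator A x\<bar> + \<bar>\<psi> x - indicator B x\<bar>)"
      using ABC f le by (intro integral_mono Bochner_Integration.integrable_add int \<kappa>) auto
    also have "\<dots> = (LINT x|\<kappa>. \<bar>\<phi> x - indicator A x\<bar>) + (LINT x|\<kappa>. \<bar>\<psi> x - indicator B x\<bar>)"
      using ABC f by (intro Bochner_Integration.integral_add int \<kappa>) auto
    finally show ?thesis .
  qed
  have "A \<in> sigma_sets UNIV {S :: 'a set. open S}" using A by (simp add: borel_def)
  then have "\<forall>e>0. \<exists>\<phi>. Q \<phi> A e"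
  proof induction
    case (Basic A)
    then obtain \<phi> :: "nat \<Rightarrow> 'a \<Rightarrow> real" where \<phi>: "\<And>k. \<phi> k \<in> Lip" "\<And>k x. 0 \<le> \<phi> k x" "\<And>k x. \<phi> k x \<le> 1"
      "\<And>x. (\<lambda>k. \<phi> k x) \<longlonglongrightarrow> indicator A x"
      using open_indicator_lipschitz_limit[of A] by auto
    have A: "A \<in> sets borel" using Basic by auto
    have "(\<lambda>k. LINT x|\<kappa>. \<bar>\<phi> k x - indicator A x\<bar>) \<longlonglongrightarrow> (LINT x|\<kappa>. 0)" if \<kappa>: "finite_borel_measure \<kappa>" for \<kappa>
    proof (rule integral_dominated_convergence)
      show "integrable \<kappa> (\<lambda>x. 1::real)" by (rule integrable_bounded_borel[OF \<kappa>, of _ 1]) auto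
      have "(\<lambda>x. \<bar>\<phi> k x - indicator A x\<bar>) \<in> borel_measurable borel" for k
        using Lip_borel_measurable[OF \<phi>(1)] A by auto
      then show "(\<lambda>x. \<bar>\<phi> k x - indicator A x\<bar>) \<in> borel_measurable \<kappa>" for k
        by (simp add: borel_measurable_finite_borel_measure[OF \<kappa>])
      have "(\<lambda>k. \<bar>\<phi> k x - indicator A x\<bar>) \<longlonglongrightarrow> \<bar>indicator A x - indicator A x\<bar>" for x
        by (intro tendsto_intros \<phi>)
      then show "AE x in \<kappa>. (\<lambda>k. \<bar>\<phi> k x - indicator A x\<bar>) \<longlonglongrightarrow> 0" by auto
      show "AE x in \<kappa>. norm \<bar>\<phi> k x - indicator A x\<bar> \<le> 1" for k
        using abs_diff_indicator_le[OF \<phi>(2,3)] by (intro AE_I2) simp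
    qed simp
    then have *: "(\<lambda>k. LINT x|\<kappa>. \<bar>\<phi> k x - indicator A x\<bar>) \<longlonglongrightarrow> 0" if "finite_borel_measure \<kappa>" for \<kappa>
      using that by simp
    show ?case
    proof (intro allI impI)
      fix e :: real assume "e > 0"
      then have "\<forall>\<^sub>F k in sequentially. (LINT x|\<mu>. \<bar>\<phi> k x - indicator A x\<bar>) < e \<and> (LINT x|\<nu>. \<bar>\<phi> k x - indicator A x\<bar>) < e"
        by (intro eventually_conj order_tendstoD(2)[OF *] \<mu> \<nu>)
      then obtain k where "(LINT x|\<mu>. \<bar>\<phi> k x - indicator A x\<bar>) < e" "(LINT x|\<nu>. \<bar>\<phi> k x - indicator A x\<bar>) < e"
        by (auto simp: eventually_sequentially)
      moreover have "\<phi> k \<in> Lip_b" using \<phi>(2,3)[of k] by (intro Lip_bI[OF \<phi>(1), of _ 1]) (auto simp: abs_le_iff)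
      ultimately show "\<exists>\<phi>. Q \<phi> A e" using \<phi> by (auto simp: Q_def)
    qed
  next
    case Empty
    then show ?case by (auto simp: Q_def intro!: exI[of _ "\<lambda>_. 0"])
  next
    case (Compl A)
    show ?case
    proof (intro allI impI)
      fix e :: real assume "e > 0"
      then obtain \<phi> where \<phi>: "Q \<phi> A e" using Compl.IH by blast
      have "\<bar>1 - \<phi> x - indicator (UNIV - A) x\<bar> = \<bar>\<phi> x - indicator A x\<bar>" for x
        by (auto simp: indicator_def)
      moreover have "(\<lambda>x. 1 - \<phi> x) \<in> Lip_b"
        using Lip_b_lincomb[OF Lip_b_const[of 1], of \<phi> 1 "- 1"] \<phi> by (simp add: Q_def)
      ultimately have "Q (\<lambda>x. 1 - \<phi> x) (UNIV - A) e" using \<phi> by (auto simp: Q_def)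
      then show "\<exists>\<phi>. Q \<phi> (UNIV - A) e" by blast
    qed
  next
    case (Union A)
    have mA: "A i \<in> sets borel" for i using Union.hyps by (auto simp: borel_def)
    \<comment> \<open>The maximum of two approximants misses the indicator of the union by at most
      the sum of their errors, hence the halving of e.\<close>
    have fin: "\<exists>\<phi>. Q \<phi> (\<Union>i<N. A i) e" if "e > 0" for N :: nat and e
      using that
    proof (induction N arbitrary: e)
      case 0
      then show ?case by (auto simp: Q_def intro!: exI[of _ "\<lambda>_. 0"])
    next
      case (Suc N)
      obtain \<phi> where \<phi>: "Q \<phi> (\<Union>i<N. A i) (e / 2)" using Suc.IH[of "e / 2"] Suc.prems by auto
      obtain \<psi> where \<psi>: "Q \<psi> (A N) (e / 2)" using Union.IH Suc.prems half_gt_zero by blast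
      let ?\<omega> = "\<lambda>x. max (\<phi> x) (\<psi> x)"
      have \<omega>01: "0 \<le> ?\<omega> x \<and> ?\<omega> x \<le> 1" for x using \<phi> \<psi> by (auto simp: Q_def le_max_iff_disj)
      have "?\<omega> \<in> Lip"
      proof (rule LipI, rule lipschitz_onI)
        fix x y
        have "\<bar>\<phi> x - \<phi> y\<bar> \<le> lip_const \<phi> * dist x y" "\<bar>\<psi> x - \<psi> y\<bar> \<le> lip_const \<psi> * dist x y"
          using \<phi> \<psi> by (auto simp: Q_def intro!: Lip_dist_le Lip_b_imp_Lip)
        then have "\<bar>?\<omega> x - ?\<omega> y\<bar> \<le> lip_const \<phi> * dist x y + lip_const \<psi> * dist x y" by linarith
        then show "dist (?\<omega> x) (?\<omega> y) \<le> (lip_const \<phi> + lip_const \<psi>) * dist x y"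
          by (simp add: dist_real_def algebra_simps)
      qed (use \<phi> \<psi> in \<open>auto simp: Q_def intro!: add_nonneg_nonneg lip_const_nonneg Lip_b_imp_Lip\<close>)
      then have L: "?\<omega> \<in> Lip_b" using \<omega>01 by (intro Lip_bI[of _ 1]) (simp add: abs_le_iff, smt (verit))
      have le: "\<bar>?\<omega> x - indicator (\<Union>i<Suc N. A i) x\<bar> \<le> \<bar>\<phi> x - indicator (\<Union>i<N. A i) x\<bar> + \<bar>\<psi> x - indicator (A N) x\<bar>" for x
      proof -
        have U: "(indicator (\<Union>i<Suc N. A i) x :: real) = max (indicator (\<Union>i<N. A i) x) (indicator (A N) x)"
          by (auto simp: indicator_def less_Suc_eq)
        show ?thesis unfolding U by linarith
      qed
      have "(LINT x|\<kappa>. \<bar>?\<omega> x - indicator (\<Union>i<Suc N. A i) x\<bar>) \<le>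
        (LINT x|\<kappa>. \<bar>\<phi> x - indicator (\<Union>i<N. A i) x\<bar>) + (LINT x|\<kappa>. \<bar>\<psi> x - indicator (A N) x\<bar>)" if "finite_borel_measure \<kappa>" for \<kappa>
        using \<phi> \<psi> \<omega>01 le mA
        by (intro tri[OF that] Qb[OF \<phi>] Qb[OF \<psi>] borel_measurable_max sets.finite_UN) (auto simp: Q_def)
      from this[OF \<mu>] this[OF \<nu>] have "Q ?\<omega> (\<Union>i<Suc N. A i) e"
        using \<phi> \<psi> L \<omega>01 unfolding Q_def by auto
      then show ?case by blast
    qed
    \<comment> \<open>For finite measures the finite unions converge to the countable one in mean,
      so a late enough finite union replaces it at cost e / 2.\<close>
    have conv: "(\<lambda>N. LINT x|\<kappa>. \<bar>indicator (\<Union>i<N. A i) x - indicator (\<Union>i. A i) x :: real\<bar>) \<longlonglongrightarrow> 0"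
      if \<kappa>: "finite_borel_measure \<kappa>" for \<kappa>
    proof -
      have "(\<lambda>N. LINT x|\<kappa>. \<bar>indicator (\<Union>i<N. A i) x - indicator (\<Union>i. A i) x :: real\<bar>) \<longlonglongrightarrow> (LINT x|\<kappa>. 0)"
      proof (rule integral_dominated_convergence)
        show "integrable \<kappa> (\<lambda>x. 1::real)" by (rule integrable_bounded_borel[OF \<kappa>, of _ 1]) auto
        have "(\<lambda>x. \<bar>indicator (\<Union>i<N. A i) x - indicator (\<Union>i. A i) x :: real\<bar>) \<in> borel_measurable borel" for N
          using mA by measurable
        then show "(\<lambda>x. \<bar>indicator (\<Union>i<N. A i) x - indicator (\<Union>i. A i) x :: real\<bar>) \<in> borel_measurable \<kappa>" for N
          by (simp add: borel_measurable_finite_borel_measure[OF \<kappa>])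
        have "(\<lambda>N. \<bar>indicator (\<Union>i<N. A i) x - indicator (\<Union>i. A i) x :: real\<bar>) \<longlonglongrightarrow> \<bar>indicator (\<Union>i. A i) x - indicator (\<Union>i. A i) x\<bar>" for x
          by (intro tendsto_intros LIMSEQ_indicator_UN)
        then show "AE x in \<kappa>. (\<lambda>N. \<bar>indicator (\<Union>i<N. A i) x - indicator (\<Union>i. A i) x :: real\<bar>) \<longlonglongrightarrow> 0" by auto
      qed (auto simp: indicator_def)
      then show ?thesis by simp
    qed
    show ?case
    proof (intro allI impI)
      fix e :: real assume e: "e > 0"
      then have "\<forall>\<^sub>F N in sequentially. (LINT x|\<mu>. \<bar>indicator (\<Union>i<N. A i) x - indicator (\<Union>i. A i) x :: real\<bar>) < e / 2 \<and>
          (LINT x|\<nu>. \<bar>indicator (\<Union>i<N. A i) x - indicator (\<Union>i. A i) x :: real\<bar>) < e / 2"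
        by (intro eventually_conj order_tendstoD(2)[OF conv] \<mu> \<nu>) auto
      then obtain N where N: "(LINT x|\<mu>. \<bar>indicator (\<Union>i<N. A i) x - indicator (\<Union>i. A i) x :: real\<bar>) < e / 2"
          "(LINT x|\<nu>. \<bar>indicator (\<Union>i<N. A i) x - indicator (\<Union>i. A i) x :: real\<bar>) < e / 2"
        by (auto simp: eventually_sequentially)
      obtain \<phi> where \<phi>: "Q \<phi> (\<Union>i<N. A i) (e / 2)" using fin e half_gt_zero by blast
      have "(LINT x|\<kappa>. \<bar>\<phi> x - indicator (\<Union>i. A i) x\<bar>) \<le>
        (LINT x|\<kappa>. \<bar>\<phi> x - indicator (\<Union>i<N. A i) x\<bar>) + (LINT x|\<kappa>. \<bar>indicator (\<Union>i<N. A i) x - indicator (\<Union>i. A i) x\<bar>)"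
        if "finite_borel_measure \<kappa>" for \<kappa>
      proof (rule tri[OF that])
        show "(indicator (\<Union>i<N. A i) :: 'a \<Rightarrow> real) \<in> borel_measurable borel" using mA by measurable
      qed (use \<phi> mA Qb[OF \<phi>] in \<open>auto simp: Q_def indicator_def\<close>)
      from this[OF \<mu>] this[OF \<nu>] have "Q \<phi> (\<Union>i. A i) e"
        using \<phi> N unfolding Q_def by auto
      then show "\<exists>\<phi>. Q \<phi> (\<Union>i. A i) e" by blast
    qed
  qed
  then show ?thesis using \<open>\<epsilon> > 0\<close> unfolding Q_def by blast
qed

text \<open>Two measures controlling \<open>T\<close> may be used on complementary Borel sets; this makes the set of
  controlling measures closed under infima, so that it has a least element.\<close>

lemma mass_bound_patch:
  assumes T: "bilinear_functional T" and \<mu>: "mass_bound T \<mu>" and \<nu>: "mass_bound T \<nu>"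
    and A: "A \<in> sets borel" and f: "f \<in> Lip_b" and \<pi>: "\<pi> \<in> Lip"
  shows "\<bar>T f \<pi>\<bar> \<le> lip_const \<pi> * ((LINT x|\<mu>. indicator A x * \<bar>f x\<bar>) + (LINT x|\<nu>. indicator (- A) x * \<bar>f x\<bar>))"
proof -
  have fin: "finite_borel_measure \<mu>" "finite_borel_measure \<nu>" using \<mu> \<nu> by (auto simp: mass_bound_def)
  obtain B where B: "B \<ge> 0" "\<And>x. \<bar>f x\<bar> \<le> B" using Lip_bE[OF f] by blast
  have l: "lip_const \<pi> \<ge> 0" using \<pi> by (rule lip_const_nonneg)
  have mf: "f \<in> borel_measurable borel" using f by (intro Lip_borel_measurable Lip_b_imp_Lip)
  let ?S = "(LINT x|\<mu>. indicator A x * \<bar>f x\<bar>) + (LINT x|\<nu>. indicator (- A) x * \<bar>f x\<bar>)"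
  \<comment> \<open>Split f into f \<phi> and f (1 - \<phi>) with \<phi> close to the indicator of
    A, and control the first part by \<mu> and the second by \<nu>. Replacing \<phi> by the
    indicator costs B e for each measure.\<close>
  have key: "\<bar>T f \<pi>\<bar> \<le> lip_const \<pi> * (?S + 2 * B * e)" if e: "e > 0" for e
  proof -
    obtain \<phi> where \<phi>: "\<phi> \<in> Lip_b" "\<And>x. 0 \<le> \<phi> x" "\<And>x. \<phi> x \<le> 1"
      "(LINT x|\<mu>. \<bar>\<phi> x - indicator A x\<bar>) < e" "(LINT x|\<nu>. \<bar>\<phi> x - indicator A x\<bar>) < e"
      using lipschitz_approx_indicator[OF fin A e] by blast
    have m\<phi>: "\<phi> \<in> borel_measurable borel" using \<phi> by (intro Lip_borel_measurable Lip_b_imp_Lip)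
    have \<psi>: "(\<lambda>x. 1 - \<phi> x) \<in> Lip_b"
      using Lip_b_lincomb[OF Lip_b_const[of 1] \<phi>(1), of 1 "- 1"] by simp
    have est: "(LINT x|\<kappa>. \<bar>f x * \<omega> x\<bar>) \<le> (LINT x|\<kappa>. indicator C x * \<bar>f x\<bar>) + B * (LINT x|\<kappa>. \<bar>\<phi> x - indicator A x\<bar>)"
      if \<kappa>: "finite_borel_measure \<kappa>" and C: "C \<in> sets borel" and \<omega>: "\<omega> \<in> borel_measurable borel"
        "\<And>x. 0 \<le> \<omega> x \<and> \<omega> x \<le> 1" "\<And>x. \<bar>\<omega> x - indicator C x\<bar> = \<bar>\<phi> x - indicator A x\<bar>" for \<kappa> C \<omega>
    proof -
      note [measurable] = mf \<omega>(1) C m\<phi> A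
      have i1: "integrable \<kappa> (\<lambda>x. \<bar>f x * \<omega> x\<bar>)"
        using mult_mono[OF B(2), of "\<bar>\<omega> _\<bar>" 1] \<omega>(2) B
        by (intro integrable_bounded_borel[OF \<kappa>, of _ "B * 1"]) (auto simp: abs_mult)
      have i2: "integrable \<kappa> (\<lambda>x. indicator C x * \<bar>f x\<bar>)"
        using B by (intro integrable_bounded_borel[OF \<kappa>, of _ B]) (auto simp: abs_mult indicator_def)
      have i3: "integrable \<kappa> (\<lambda>x. \<bar>\<phi> x - indicator A x\<bar>)"
        using abs_diff_indicator_le[OF \<phi>(2,3)] by (intro integrable_bounded_borel[OF \<kappa>, of _ 1]) auto
      have "(LINT x|\<kappa>. \<bar>f x * \<omega> x\<bar>) \<le> (LINT x|\<kappa>. indicator C x * \<bar>f x\<bar> + B * \<bar>\<phi> x - indicator A x\<bar>)"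
      proof (rule integral_mono[OF i1])
        fix x
        have "\<bar>f x * \<omega> x\<bar> = \<bar>f x\<bar> * \<omega> x" using \<omega>(2) by (simp add: abs_mult)
        also have "\<dots> \<le> \<bar>f x\<bar> * (indicator C x + \<bar>\<phi> x - indicator A x\<bar>)"
          using \<omega>(3)[of x] by (intro mult_left_mono) auto
        also have "\<dots> \<le> indicator C x * \<bar>f x\<bar> + B * \<bar>\<phi> x - indicator A x\<bar>"
          using mult_right_mono[OF B(2), of "\<bar>\<phi> x - indicator A x\<bar>"] by (simp add: algebra_simps)
        finally show "\<bar>f x * \<omega> x\<bar> \<le> indicator C x * \<bar>f x\<bar> + B * \<bar>\<phi> x - indicator A x\<bar>" .
      qed (use i2 i3 in auto)
      also have "\<dots> = (LINT x|\<kappa>. indicator C x * \<bar>f x\<bar>) + B * (LINT x|\<kappa>. \<bar>\<phi> x - indicator A x\<bar>)"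
        using i2 i3 by simp
      finally show ?thesis .
    qed
    have e1: "(LINT x|\<mu>. \<bar>f x * \<phi> x\<bar>) \<le> (LINT x|\<mu>. indicator A x * \<bar>f x\<bar>) + B * (LINT x|\<mu>. \<bar>\<phi> x - indicator A x\<bar>)"
      using \<phi> by (intro est fin A m\<phi>) auto
    have e2: "(LINT x|\<nu>. \<bar>f x * (1 - \<phi> x)\<bar>) \<le> (LINT x|\<nu>. indicator (- A) x * \<bar>f x\<bar>) + B * (LINT x|\<nu>. \<bar>\<phi> x - indicator A x\<bar>)"
      using \<phi> m\<phi> A by (intro est fin) (auto simp: indicator_def)
    have "T f \<pi> = T (\<lambda>x. 1 * (f x * \<phi> x) + 1 * (f x * (1 - \<phi> x))) \<pi>" by (simp add: algebra_simps)
    also have "\<dots> = T (\<lambda>x. f x * \<phi> x) \<pi> + T (\<lambda>x. f x * (1 - \<phi> x)) \<pi>"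
      using bilinear_functionalD(1)[OF T Lip_b_mult[OF f \<phi>(1)] Lip_b_mult[OF f \<psi>] \<pi>, of 1 1] by simp
    finally have "\<bar>T f \<pi>\<bar> \<le> \<bar>T (\<lambda>x. f x * \<phi> x) \<pi>\<bar> + \<bar>T (\<lambda>x. f x * (1 - \<phi> x)) \<pi>\<bar>" by simp
    also have "\<dots> \<le> lip_const \<pi> * (LINT x|\<mu>. \<bar>f x * \<phi> x\<bar>) + lip_const \<pi> * (LINT x|\<nu>. \<bar>f x * (1 - \<phi> x)\<bar>)"
      by (intro add_mono mass_boundD[OF \<mu> Lip_b_mult[OF f \<phi>(1)] \<pi>] mass_boundD[OF \<nu> Lip_b_mult[OF f \<psi>] \<pi>])
    also have "\<dots> = lip_const \<pi> * ((LINT x|\<mu>. \<bar>f x * \<phi> x\<bar>) + (LINT x|\<nu>. \<bar>f x * (1 - \<phi> x)\<bar>))"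
      by (simp add: algebra_simps)
    also have "\<dots> \<le> lip_const \<pi> * (?S + 2 * B * e)"
    proof (intro mult_left_mono l)
      have "B * (LINT x|\<mu>. \<bar>\<phi> x - indicator A x\<bar>) \<le> B * e" "B * (LINT x|\<nu>. \<bar>\<phi> x - indicator A x\<bar>) \<le> B * e"
        using \<phi>(4,5) B by (auto intro: mult_left_mono)
      then show "(LINT x|\<mu>. \<bar>f x * \<phi> x\<bar>) + (LINT x|\<nu>. \<bar>f x * (1 - \<phi> x)\<bar>) \<le> ?S + 2 * B * e"
        using e1 e2 by linarith
    qed
    finally show ?thesis .
  qed
  show ?thesis
  proof (rule tendsto_lowerbound)
    show "((\<lambda>e. lip_const \<pi> * (?S + 2 * B * e)) \<longlongrightarrow> lip_const \<pi> * ?S) (at_right 0)"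
      by (auto intro!: tendsto_eq_intros)
    show "\<forall>\<^sub>F e in at_right 0. \<bar>T f \<pi>\<bar> \<le> lip_const \<pi> * (?S + 2 * B * e)"
      using eventually_at_right_less[of "0::real"] by eventually_elim (rule key)
  qed simp
qed

text \<open>Fixing \<mu> turns controlling measures into functions, for which minima and decreasing
  limits are taken pointwise and size is a single number, the integral.\<close>

definition mass_density :: "'a::metric_space functional \<Rightarrow> 'a measure \<Rightarrow> ('a \<Rightarrow> real) \<Rightarrow> bool"
  where "mass_density T \<mu> d \<longleftrightarrow> d \<in> borel_measurable borel \<and> (\<forall>x. 0 \<le> d x) \<and> integrable \<mu> d \<and>
    (\<forall>f\<in>Lip_b. \<forall>\<pi>\<in>Lip. \<bar>T f \<pi>\<bar> \<le> lip_const \<pi> * (LINT x|\<mu>. d x * \<bar>f x\<bar>))"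

lemma integral_density_real:
  fixes d f :: "'a::topological_space \<Rightarrow> real"
  assumes "finite_borel_measure \<mu>" "d \<in> borel_measurable borel" "\<And>x. 0 \<le> d x" "f \<in> borel_measurable borel"
  shows "(LINT x|density \<mu> (\<lambda>x. ennreal (d x)). f x) = (LINT x|\<mu>. d x * f x)"
  using assms by (subst integral_density) (auto simp: borel_measurable_finite_borel_measure[OF assms(1)])

lemma mass_bound_density:
  assumes \<mu>: "finite_borel_measure \<mu>" and d: "mass_density T \<mu> d"
  shows "mass_bound T (density \<mu> (\<lambda>x. ennreal (d x)))"
    "measure (density \<mu> (\<lambda>x. ennreal (d x))) UNIV = (LINT x|\<mu>. d x)"
proof -
  have d': "d \<in> borel_measurable borel" "\<And>x. 0 \<le> d x" "integrable \<mu> d"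
    "\<And>f \<pi>. f \<in> Lip_b \<Longrightarrow> \<pi> \<in> Lip \<Longrightarrow> \<bar>T f \<pi>\<bar> \<le> lip_const \<pi> * (LINT x|\<mu>. d x * \<bar>f x\<bar>)"
    using d unfolding mass_density_def by blast+
  have sp: "space \<mu> = UNIV" using \<mu> by (metis finite_borel_measure_def sets_eq_imp_space_eq space_borel)
  have "emeasure (density \<mu> (\<lambda>x. ennreal (d x))) (space \<mu>) = (\<integral>\<^sup>+x. ennreal (d x) \<partial>\<mu>)"
    using d' by (subst emeasure_density) (auto simp: borel_measurable_finite_borel_measure[OF \<mu>] intro!: nn_integral_cong)
  also have "\<dots> = ennreal (LINT x|\<mu>. d x)"
    using d' by (intro nn_integral_eq_integral) auto
  finally have em: "emeasure (density \<mu> (\<lambda>x. ennreal (d x))) (space \<mu>) = ennreal (LINT x|\<mu>. d x)" .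
  show "measure (density \<mu> (\<lambda>x. ennreal (d x))) UNIV = (LINT x|\<mu>. d x)"
    using em d'(2) sp by (simp add: measure_def)
  have "finite_borel_measure (density \<mu> (\<lambda>x. ennreal (d x)))"
    using em \<mu> by (auto simp: finite_borel_measure_def intro!: finite_measureI)
  moreover have "(LINT x|density \<mu> (\<lambda>x. ennreal (d x)). \<bar>f x\<bar>) = (LINT x|\<mu>. d x * \<bar>f x\<bar>)" if "f \<in> Lip_b" for f
    using Lip_borel_measurable[OF Lip_b_imp_Lip[OF that]] by (intro integral_density_real[OF \<mu> d'(1,2)]) measurable
  ultimately show "mass_bound T (density \<mu> (\<lambda>x. ennreal (d x)))"
    using d'(4) by (simp add: mass_bound_def)
qed

lemma mass_density_mult_integrable:
  assumes \<mu>: "finite_borel_measure \<mu>" and d: "d \<in> borel_measurable borel" "integrable \<mu> d"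
    and f: "f \<in> Lip_b"
  shows "integrable \<mu> (\<lambda>x. d x * \<bar>f x\<bar>)"
proof -
  obtain B where B: "B \<ge> 0" "\<And>x. \<bar>f x\<bar> \<le> B" using Lip_bE[OF f] by blast
  have m: "f \<in> borel_measurable borel" using f by (intro Lip_borel_measurable Lip_b_imp_Lip)
  show ?thesis
  proof (rule Bochner_Integration.integrable_bound[OF integrable_mult_left[OF d(2), of B]])
    have "(\<lambda>x. d x * \<bar>f x\<bar>) \<in> borel_measurable borel" using m d by measurable
    then show "(\<lambda>x. d x * \<bar>f x\<bar>) \<in> borel_measurable \<mu>" by (simp add: borel_measurable_finite_borel_measure[OF \<mu>])
    show "AE x in \<mu>. norm (d x * \<bar>f x\<bar>) \<le> norm (d x * B)"
      using B by (intro AE_I2) (auto simp: abs_mult intro!: mult_left_mono)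
  qed
qed

text \<open>The two measures are patched along the set where d \<le> e, so that each is used where
  its density is the smaller one.\<close>

lemma mass_density_min:
  assumes T: "bilinear_functional T" and \<mu>: "finite_borel_measure \<mu>"
    and d: "mass_density T \<mu> d" and e: "mass_density T \<mu> e"
  shows "mass_density T \<mu> (\<lambda>x. min (d x) (e x))"
proof -
  have d': "d \<in> borel_measurable borel" "\<And>x. 0 \<le> d x" "integrable \<mu> d"
    and e': "e \<in> borel_measurable borel" "\<And>x. 0 \<le> e x" "integrable \<mu> e"
    using d e unfolding mass_density_def by blast+
  note [measurable] = d'(1) e'(1)
  define A where "A = {x. d x \<le> e x}"
  have A [measurable]: "A \<in> sets borel" unfolding A_def by measurable
  have i: "integrable \<mu> (\<lambda>x. min (d x) (e x))" using d' e' by simp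
  have "\<bar>T f \<pi>\<bar> \<le> lip_const \<pi> * (LINT x|\<mu>. min (d x) (e x) * \<bar>f x\<bar>)" if f: "f \<in> Lip_b" and \<pi>: "\<pi> \<in> Lip" for f \<pi>
  proof -
    have mf [measurable]: "f \<in> borel_measurable borel" using f by (intro Lip_borel_measurable Lip_b_imp_Lip)
    have sets: "sets \<mu> = sets borel" using \<mu> by (simp add: finite_borel_measure_def)
    have i1: "integrable \<mu> (\<lambda>x. indicator A x * (d x * \<bar>f x\<bar>))"
      using integrable_mult_indicator[OF _ mass_density_mult_integrable[OF \<mu> d'(1,3) f], of A] A sets by simp
    have i2: "integrable \<mu> (\<lambda>x. indicator (- A) x * (e x * \<bar>f x\<bar>))"
      using integrable_mult_indicator[OF _ mass_density_mult_integrable[OF \<mu> e'(1,3) f], of "- A"] A sets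
      by (simp add: borel_comp)
    have "\<bar>T f \<pi>\<bar> \<le> lip_const \<pi> * ((LINT x|density \<mu> (\<lambda>x. ennreal (d x)). indicator A x * \<bar>f x\<bar>) +
        (LINT x|density \<mu> (\<lambda>x. ennreal (e x)). indicator (- A) x * \<bar>f x\<bar>))"
      by (rule mass_bound_patch[OF T mass_bound_density(1)[OF \<mu> d] mass_bound_density(1)[OF \<mu> e] A f \<pi>])
    also have "(LINT x|density \<mu> (\<lambda>x. ennreal (d x)). indicator A x * \<bar>f x\<bar>) = (LINT x|\<mu>. indicator A x * (d x * \<bar>f x\<bar>))"
      by (subst integral_density_real[OF \<mu> d'(1,2)]) (auto simp: mult_ac)
    also have "(LINT x|density \<mu> (\<lambda>x. ennreal (e x)). indicator (- A) x * \<bar>f x\<bar>) = (LINT x|\<mu>. indicator (- A) x * (e x * \<bar>f x\<bar>))"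
      by (subst integral_density_real[OF \<mu> e'(1,2)]) (auto simp: mult_ac)
    also have "(LINT x|\<mu>. indicator A x * (d x * \<bar>f x\<bar>)) + (LINT x|\<mu>. indicator (- A) x * (e x * \<bar>f x\<bar>)) =
      (LINT x|\<mu>. indicator A x * (d x * \<bar>f x\<bar>) + indicator (- A) x * (e x * \<bar>f x\<bar>))"
      using i1 i2 by simp
    also have "\<dots> = (LINT x|\<mu>. min (d x) (e x) * \<bar>f x\<bar>)"
      by (rule Bochner_Integration.integral_cong) (auto simp: indicator_def A_def min_def)
    finally show ?thesis .
  qed
  then show ?thesis using i d' e' by (auto simp: mass_density_def)
qed

text \<open>Dominated convergence with e 0 as majorant, which the monotonicity provides.\<close>

lemma mass_density_limit:
  assumes \<mu>: "finite_borel_measure \<mu>"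
    and e: "\<And>n::nat. mass_density T \<mu> (e n)" and dec: "\<And>x. decseq (\<lambda>n. e n x)"
    and lim: "\<And>x. (\<lambda>n. e n x) \<longlonglongrightarrow> d x"
  shows "mass_density T \<mu> d" "(\<lambda>n. LINT x|\<mu>. e n x) \<longlonglongrightarrow> (LINT x|\<mu>. d x)"
proof -
  have e': "e n \<in> borel_measurable borel" "\<And>x. 0 \<le> e n x" "integrable \<mu> (e n)"
    "\<And>f \<pi>. f \<in> Lip_b \<Longrightarrow> \<pi> \<in> Lip \<Longrightarrow> \<bar>T f \<pi>\<bar> \<le> lip_const \<pi> * (LINT x|\<mu>. e n x * \<bar>f x\<bar>)" for n
    using e[of n] unfolding mass_density_def by blast+
  have d0: "0 \<le> d x" for x
    by (rule LIMSEQ_le_const[OF lim]) (auto intro: e'(2))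
  have dm: "d \<in> borel_measurable borel"
    by (rule borel_measurable_LIMSEQ_real[OF lim]) (rule e'(1))
  have le0: "e n x \<le> e 0 x" for n x using dec[of x] by (simp add: decseq_def)
  have conv: "integrable \<mu> (\<lambda>x. d x * \<bar>f x\<bar>)" "(\<lambda>n. LINT x|\<mu>. e n x * \<bar>f x\<bar>) \<longlonglongrightarrow> (LINT x|\<mu>. d x * \<bar>f x\<bar>)"
    if f: "f \<in> Lip_b" for f
  proof -
    have mf [measurable]: "f \<in> borel_measurable borel" using f by (intro Lip_borel_measurable Lip_b_imp_Lip)
    note [measurable] = dm e'(1)
    have m1: "(\<lambda>x. d x * \<bar>f x\<bar>) \<in> borel_measurable \<mu>"
      unfolding borel_measurable_finite_borel_measure[OF \<mu>] by measurable
    have m2: "(\<lambda>x. e n x * \<bar>f x\<bar>) \<in> borel_measurable \<mu>" for n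
      unfolding borel_measurable_finite_borel_measure[OF \<mu>] by measurable
    have l: "AE x in \<mu>. (\<lambda>n. e n x * \<bar>f x\<bar>) \<longlonglongrightarrow> d x * \<bar>f x\<bar>"
      by (intro AE_I2 tendsto_intros lim)
    have b: "AE x in \<mu>. norm (e n x * \<bar>f x\<bar>) \<le> e 0 x * \<bar>f x\<bar>" for n
      using le0 e'(2) by (intro AE_I2) (simp add: abs_mult mult_right_mono)
    note i0 = mass_density_mult_integrable[OF \<mu> e'(1,3) f, of 0]
    show "integrable \<mu> (\<lambda>x. d x * \<bar>f x\<bar>)" "(\<lambda>n. LINT x|\<mu>. e n x * \<bar>f x\<bar>) \<longlonglongrightarrow> (LINT x|\<mu>. d x * \<bar>f x\<bar>)"
      by (rule integrable_dominated_convergence[OF m1 m2 i0 l b] integral_dominated_convergence[OF m1 m2 i0 l b])+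
  qed
  show "(\<lambda>n. LINT x|\<mu>. e n x) \<longlonglongrightarrow> (LINT x|\<mu>. d x)"
    using conv(2)[OF Lip_b_const[of 1]] by simp
  have "\<bar>T f \<pi>\<bar> \<le> lip_const \<pi> * (LINT x|\<mu>. d x * \<bar>f x\<bar>)" if f: "f \<in> Lip_b" and \<pi>: "\<pi> \<in> Lip" for f \<pi>
  proof (rule LIMSEQ_le_const)
    show "(\<lambda>n. lip_const \<pi> * (LINT x|\<mu>. e n x * \<bar>f x\<bar>)) \<longlonglongrightarrow> lip_const \<pi> * (LINT x|\<mu>. d x * \<bar>f x\<bar>)"
      by (intro tendsto_intros conv f)
  qed (use e'(4)[OF f \<pi>] in auto)
  then show "mass_density T \<mu> d"
    using d0 dm conv(1)[OF Lip_b_const[of 1]] by (simp add: mass_density_def)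
qed

text \<open>Running minima of a minimizing sequence are still admissible and decrease pointwise, so
  they have a limit, and this limit attains the infimum of the integrals.\<close>

lemma mass_density_minimal:
  assumes T: "bilinear_functional T" and \<mu>: "mass_bound T \<mu>"
  obtains d where "mass_density T \<mu> d" "\<And>e. mass_density T \<mu> e \<Longrightarrow> (LINT x|\<mu>. d x) \<le> (LINT x|\<mu>. e x)"
proof -
  have fin: "finite_borel_measure \<mu>" using \<mu> by (simp add: mass_bound_def)
  define I where "I = (\<lambda>d. LINT x|\<mu>. d x) ` {d. mass_density T \<mu> d}"
  \<comment> \<open>The constant 1 stands for \<mu> itself; it shows that the infimum is taken over
    a nonempty set.\<close>
  have "mass_density T \<mu> (\<lambda>_. 1)"
    unfolding mass_density_def
  proof (intro conjI allI ballI)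
    show "integrable \<mu> (\<lambda>_. 1 :: real)" by (rule integrable_bounded_borel[OF fin, of _ 1]) auto
  qed (simp_all add: mass_boundD[OF \<mu>])
  then have ne: "I \<noteq> {}" by (auto simp: I_def)
  have bdd: "bdd_below I"
    by (rule bdd_belowI[of _ 0]) (auto simp: I_def mass_density_def)
  define m where "m = Inf I"
  have "\<exists>d. mass_density T \<mu> d \<and> (LINT x|\<mu>. d x) < m + 1 / Suc n" for n
  proof -
    have "Inf I < m + 1 / Suc n" by (simp add: m_def)
    then obtain i where "i \<in> I" "i < m + 1 / Suc n" using cInf_lessD[OF ne] by blast
    then show ?thesis by (auto simp: I_def)
  qed
  then obtain D where D: "\<And>n. mass_density T \<mu> (D n)" "\<And>n. (LINT x|\<mu>. D n x) < m + 1 / Suc n" by metis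
  define e where "e = rec_nat (D 0) (\<lambda>n p x. min (p x) (D (Suc n) x))"
  have e0: "e 0 = D 0" and eS: "e (Suc n) = (\<lambda>x. min (e n x) (D (Suc n) x))" for n by (simp_all add: e_def)
  have e: "mass_density T \<mu> (e n)" for n
    by (induction n) (auto simp: e0 eS intro!: mass_density_min[OF T fin] D)
  have e': "e n \<in> borel_measurable borel" "\<And>x. 0 \<le> e n x" "integrable \<mu> (e n)" for n
    using e[of n] unfolding mass_density_def by blast+
  have dec: "decseq (\<lambda>n. e n x)" for x by (rule decseq_SucI) (simp add: eS)
  define d where "d x = lim (\<lambda>n. e n x)" for x
  have lim: "(\<lambda>n. e n x) \<longlonglongrightarrow> d x" for x
  proof -
    have "\<forall>i. 0 \<le> e i x" using e'(2) by blast
    then have "convergent (\<lambda>n. e n x)"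
      by (rule decseq_convergent[OF dec[of x]]) (rule convergentI)
    then show ?thesis by (simp add: d_def convergent_LIMSEQ_iff)
  qed
  note L = mass_density_limit[OF fin e dec lim]
  have "(LINT x|\<mu>. d x) \<le> m"
  proof (rule LIMSEQ_le[OF L(2)])
    show "(\<lambda>n. m + 1 / Suc n) \<longlonglongrightarrow> m"
      using tendsto_add[OF tendsto_const LIMSEQ_inverse_real_of_nat, of m] by (simp add: inverse_eq_divide)
    have "(LINT x|\<mu>. e n x) \<le> (LINT x|\<mu>. D n x)" for n
    proof (rule integral_mono)
      show "integrable \<mu> (D n)" using D(1)[of n] by (simp add: mass_density_def)
      show "e n x \<le> D n x" for x by (cases n) (auto simp: e0 eS)
    qed (rule e')
    then show "\<exists>N. \<forall>n\<ge>N. (LINT x|\<mu>. e n x) \<le> m + 1 / Suc n"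
      using D(2) by (meson order_trans less_imp_le)
  qed
  moreover have "m \<le> (LINT x|\<mu>. e x)" if "mass_density T \<mu> e" for e
    unfolding m_def using that by (intro cInf_lower[OF _ bdd]) (auto simp: I_def)
  ultimately show ?thesis using L(1) that by (meson order_trans)
qed

text \<open>The candidate \<kappa> has a density of minimal integral relative to \<mu>. A competitor
  \<nu> may be singular to \<mu>, so a Hahn decomposition is made first: on Y there is nothing to
  show, and off Y the measure \<nu> lies below \<kappa>, hence has a density relative to \<mu> and
  can be compared by minimality.\<close>

lemma mass_bound_least:
  assumes T: "bilinear_functional T" and \<mu>: "mass_bound T \<mu>"
  shows "\<exists>\<kappa>. mass_bound T \<kappa> \<and> (\<forall>\<nu>. mass_bound T \<nu> \<longrightarrow> \<kappa> \<le> \<nu>)"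
proof -
  have fin: "finite_borel_measure \<mu>" using \<mu> by (simp add: mass_bound_def)
  have s\<mu>: "sets \<mu> = sets borel" using fin by (simp add: finite_borel_measure_def)
  have sp: "space \<mu> = UNIV" using sets_eq_imp_space_eq[OF s\<mu>] by simp
  interpret \<mu>: finite_measure \<mu> using fin by (simp add: finite_borel_measure_def)
  obtain d where d: "mass_density T \<mu> d" "\<And>e. mass_density T \<mu> e \<Longrightarrow> (LINT x|\<mu>. d x) \<le> (LINT x|\<mu>. e x)"
    using mass_density_minimal[OF T \<mu>] by blast
  have d': "d \<in> borel_measurable borel" "\<And>x. 0 \<le> d x" "integrable \<mu> d"
    using d(1) unfolding mass_density_def by blast+
  define \<kappa> where "\<kappa> = density \<mu> (\<lambda>x. ennreal (d x))"
  have \<kappa>: "mass_bound T \<kappa>" unfolding \<kappa>_def by (rule mass_bound_density(1)[OF fin d(1)])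
  then have fin\<kappa>: "finite_borel_measure \<kappa>" by (simp add: mass_bound_def)
  then have s\<kappa>: "sets \<kappa> = sets borel" and f\<kappa>: "finite_measure \<kappa>" by (auto simp: finite_borel_measure_def)
  have "\<kappa> \<le> \<nu>" if \<nu>: "mass_bound T \<nu>" for \<nu>
  proof -
    have fin\<nu>: "finite_borel_measure \<nu>" using \<nu> by (simp add: mass_bound_def)
    then have s\<nu>: "sets \<nu> = sets borel" and f\<nu>: "finite_measure \<nu>" by (auto simp: finite_borel_measure_def)
    interpret \<nu>: finite_measure \<nu> by fact
    interpret \<kappa>: finite_measure \<kappa> by fact
    have sp\<nu>: "space \<nu> = UNIV" and sp\<kappa>: "space \<kappa> = UNIV"
      using sets_eq_imp_space_eq[OF s\<nu>] sets_eq_imp_space_eq[OF s\<kappa>] by auto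
    obtain Y where Y: "Y \<in> sets borel"
      and le1: "\<And>X. X \<in> sets borel \<Longrightarrow> X \<subseteq> Y \<Longrightarrow> emeasure \<kappa> X \<le> emeasure \<nu> X"
      and le2: "\<And>X. X \<in> sets borel \<Longrightarrow> X \<inter> Y = {} \<Longrightarrow> emeasure \<nu> X \<le> emeasure \<kappa> X"
      using finite_unsigned_Hahn_decomposition[OF f\<nu> f\<kappa>] s\<nu> s\<kappa> by auto
    have Yc: "- Y \<in> sets borel" using Y by (simp add: borel_comp)
    define \<nu>' where "\<nu>' = density \<nu> (indicator (- Y))"
    have s\<nu>': "sets \<nu>' = sets borel" by (simp add: \<nu>'_def s\<nu>)
    have em\<nu>': "emeasure \<nu>' X = emeasure \<nu> (X - Y)" if "X \<in> sets borel" for X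
    proof -
      have "emeasure \<nu>' X = (\<integral>\<^sup>+x. indicator (X - Y) x \<partial>\<nu>)"
        unfolding \<nu>'_def using that Yc s\<nu>
        by (subst emeasure_density) (auto simp: indicator_def intro!: nn_integral_cong borel_measurable_indicator)
      then show ?thesis using that Y s\<nu> by (simp add: sets.Diff)
    qed
    have ac: "absolutely_continuous \<mu> \<nu>'"
      unfolding absolutely_continuous_def
    proof
      fix N assume N: "N \<in> null_sets \<mu>"
      then have bN: "N \<in> sets borel" using s\<mu> by auto
      have "N \<in> null_sets \<kappa>"
      proof -
        have "absolutely_continuous \<mu> \<kappa>" unfolding \<kappa>_def
          by (rule absolutely_continuousI_density) (use d'(1) in \<open>simp add: borel_measurable_finite_borel_measure[OF fin]\<close>)
        then show ?thesis using N by (auto simp: absolutely_continuous_def)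
      qed
      have "emeasure \<nu>' N = emeasure \<nu> (N - Y)" by (rule em\<nu>'[OF bN])
      also have "\<dots> \<le> emeasure \<kappa> (N - Y)" using bN Y by (intro le2) auto
      also have "\<dots> \<le> emeasure \<kappa> N" using bN s\<kappa> by (intro emeasure_mono) auto
      also have "\<dots> = 0" using \<open>N \<in> null_sets \<kappa>\<close> by auto
      finally show "N \<in> null_sets \<nu>'" using bN s\<nu>' by auto
    qed
    obtain g where g: "g \<in> borel_measurable borel" "density \<mu> g = \<nu>'"
      using \<mu>.Radon_Nikodym[OF ac] s\<nu>' s\<mu> borel_measurable_finite_borel_measure[OF fin] by auto
    have gm: "g \<in> borel_measurable \<mu>" using g(1) by (simp add: borel_measurable_finite_borel_measure[OF fin])
    have gint: "(\<integral>\<^sup>+x. g x \<partial>\<mu>) = emeasure \<nu> (- Y)"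
    proof -
      have "(\<integral>\<^sup>+x. g x \<partial>\<mu>) = emeasure (density \<mu> g) UNIV"
        using gm sp s\<mu> by (subst emeasure_density) (auto intro!: nn_integral_cong)
      then show ?thesis unfolding g(2) by (simp add: em\<nu>' Compl_eq_Diff_UNIV)
    qed
    have "AE x in \<mu>. g x \<noteq> \<infinity>"
      by (rule nn_integral_noteq_infinite[OF gm]) (simp add: gint)
    define k where "k x = enn2real (g x)" for x
    have k: "k \<in> borel_measurable borel" "\<And>x. 0 \<le> k x" unfolding k_def using g(1) by measurable
    have gk: "AE x in \<mu>. g x = ennreal (k x)"
      using \<open>AE x in \<mu>. g x \<noteq> \<infinity>\<close> by eventually_elim (auto simp: k_def top.not_eq_extremum)
    have km: "k \<in> borel_measurable \<mu>" using k(1) by (simp add: borel_measurable_finite_borel_measure[OF fin])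
    have \<nu>'k: "\<nu>' = density \<mu> (\<lambda>x. ennreal (k x))"
      unfolding g(2)[symmetric] by (rule density_cong[OF gm _ gk]) (use km in auto)
    have nnk: "(\<integral>\<^sup>+x. ennreal (k x) \<partial>\<mu>) = emeasure \<nu> (- Y)"
      unfolding gint[symmetric] by (rule nn_integral_cong_AE) (use gk in auto)
    have ik: "integrable \<mu> k"
      by (rule integrableI_nonneg[OF km]) (use k nnk in \<open>auto simp: \<nu>.emeasure_eq_measure\<close>)
    have Ik: "(LINT x|\<mu>. k x) = measure \<nu> (- Y)"
      using nnk k(2) by (subst integral_eq_nn_integral[OF km]) (auto simp: measure_def)
    \<comment> \<open>The density that uses \<kappa> on Y and \<nu> off Y. It is admissible by
      patching, and minimality of d then compares the total masses on the complement of Y.\<close>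
    define e where "e x = indicator Y x * d x + k x" for x
    have iYd: "integrable \<mu> (\<lambda>x. indicator Y x * d x)"
      using integrable_mult_indicator[OF _ d'(3), of Y] Y s\<mu> by simp
    have "mass_density T \<mu> e"
      unfolding mass_density_def
    proof (intro conjI allI ballI)
      show "e \<in> borel_measurable borel" unfolding e_def using Y d' k by measurable
      show "0 \<le> e x" for x using d' k by (simp add: e_def)
      show "integrable \<mu> e" unfolding e_def using iYd ik by simp
      fix f \<pi> :: "'a \<Rightarrow> real" assume f: "f \<in> Lip_b" and \<pi>: "\<pi> \<in> Lip"
      have mf [measurable]: "f \<in> borel_measurable borel" using f by (intro Lip_borel_measurable Lip_b_imp_Lip)
      note [measurable] = Y Yc
      have i1: "integrable \<mu> (\<lambda>x. indicator Y x * (d x * \<bar>f x\<bar>))"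
        using integrable_mult_indicator[OF _ mass_density_mult_integrable[OF fin d'(1,3) f], of Y] Y s\<mu> by simp
      have i2: "integrable \<mu> (\<lambda>x. k x * \<bar>f x\<bar>)" by (rule mass_density_mult_integrable[OF fin k(1) ik f])
      have "\<bar>T f \<pi>\<bar> \<le> lip_const \<pi> * ((LINT x|\<kappa>. indicator Y x * \<bar>f x\<bar>) + (LINT x|\<nu>. indicator (- Y) x * \<bar>f x\<bar>))"
        by (rule mass_bound_patch[OF T \<kappa> \<nu> Y f \<pi>])
      also have "(LINT x|\<kappa>. indicator Y x * \<bar>f x\<bar>) = (LINT x|\<mu>. indicator Y x * (d x * \<bar>f x\<bar>))"
        unfolding \<kappa>_def by (subst integral_density_real[OF fin d'(1,2)]) (auto simp: mult_ac)
      also have "(LINT x|\<nu>. indicator (- Y) x * \<bar>f x\<bar>) = (LINT x|\<nu>'. \<bar>f x\<bar>)"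
      proof -
        have "(LINT x|density \<nu> (\<lambda>x. ennreal (indicator (- Y) x)). \<bar>f x\<bar>) = (LINT x|\<nu>. indicator (- Y) x * \<bar>f x\<bar>)"
          by (rule integral_density_real[OF fin\<nu>]) auto
        then show ?thesis by (simp add: \<nu>'_def ennreal_indicator)
      qed
      also have "\<dots> = (LINT x|\<mu>. k x * \<bar>f x\<bar>)"
        unfolding \<nu>'k by (rule integral_density_real[OF fin k]) auto
      also have "(LINT x|\<mu>. indicator Y x * (d x * \<bar>f x\<bar>)) + (LINT x|\<mu>. k x * \<bar>f x\<bar>) = (LINT x|\<mu>. e x * \<bar>f x\<bar>)"
        using i1 i2 by (simp add: e_def algebra_simps)
      finally show "\<bar>T f \<pi>\<bar> \<le> lip_const \<pi> * (LINT x|\<mu>. e x * \<bar>f x\<bar>)" .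
    qed
    then have "(LINT x|\<mu>. d x) \<le> (LINT x|\<mu>. e x)" by (rule d(2))
    also have "\<dots> = (LINT x|\<mu>. indicator Y x * d x) + measure \<nu> (- Y)"
      using iYd ik Ik by (simp add: e_def)
    finally have "(LINT x|\<mu>. d x) - (LINT x|\<mu>. indicator Y x * d x) \<le> measure \<nu> (- Y)" by simp
    moreover have m\<kappa>: "measure \<kappa> X = (LINT x|\<mu>. indicator X x * d x)" if X: "X \<in> sets borel" for X
    proof -
      have "measure \<kappa> X = (LINT x|\<kappa>. indicator X x)" using sp\<kappa> s\<kappa> X by simp
      also have "\<dots> = (LINT x|\<mu>. d x * indicator X x)"
        unfolding \<kappa>_def by (rule integral_density_real[OF fin d'(1,2)]) (use X in auto)
      finally show ?thesis by (simp add: mult.commute)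
    qed
    ultimately have "measure \<kappa> UNIV - measure \<kappa> Y \<le> measure \<nu> (- Y)"
      using m\<kappa>[of UNIV] m\<kappa>[OF Y] by simp
    then have tot: "measure \<kappa> (- Y) \<le> measure \<nu> (- Y)"
      using \<kappa>.finite_measure_compl[of Y] Y s\<kappa> sp\<kappa> by (simp add: Compl_eq_Diff_UNIV)
    \<comment> \<open>Off Y the setwise inequality \<open>le2\<close> points the wrong way. Applied
      to the part of - Y outside X and subtracted from \<open>tot\<close>, it yields the wanted
      inequality on X - Y.\<close>
    have "emeasure \<kappa> X \<le> emeasure \<nu> X" if X: "X \<in> sets borel" for X
    proof -
      have b: "X \<inter> Y \<in> sets borel" "X - Y \<in> sets borel" "- Y - X \<in> sets borel" using X Y Yc by auto
      have "measure \<nu> (- Y - X) \<le> measure \<kappa> (- Y - X)"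
        using le2[of "- Y - X"] b by (auto simp: \<nu>.emeasure_eq_measure \<kappa>.emeasure_eq_measure)
      moreover have "measure \<kappa> (- Y) = measure \<kappa> (X - Y) + measure \<kappa> (- Y - X)"
        using b s\<kappa> by (subst \<kappa>.finite_measure_Union[symmetric]) (auto intro!: arg_cong[where f="measure \<kappa>"])
      moreover have "measure \<nu> (- Y) = measure \<nu> (X - Y) + measure \<nu> (- Y - X)"
        using b s\<nu> by (subst \<nu>.finite_measure_Union[symmetric]) (auto intro!: arg_cong[where f="measure \<nu>"])
      ultimately have 1: "measure \<kappa> (X - Y) \<le> measure \<nu> (X - Y)" using tot by linarith
      have 2: "measure \<kappa> (X \<inter> Y) \<le> measure \<nu> (X \<inter> Y)"
        using le1[of "X \<inter> Y"] b by (auto simp: \<nu>.emeasure_eq_measure \<kappa>.emeasure_eq_measure)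
      have "measure \<kappa> X = measure \<kappa> (X \<inter> Y) + measure \<kappa> (X - Y)"
        using b s\<kappa> by (subst \<kappa>.finite_measure_Union[symmetric]) (auto intro!: arg_cong[where f="measure \<kappa>"])
      moreover have "measure \<nu> X = measure \<nu> (X \<inter> Y) + measure \<nu> (X - Y)"
        using b s\<nu> by (subst \<nu>.finite_measure_Union[symmetric]) (auto intro!: arg_cong[where f="measure \<nu>"])
      ultimately have "measure \<kappa> X \<le> measure \<nu> X" using 1 2 by linarith
      then show ?thesis by (simp add: \<nu>.emeasure_eq_measure \<kappa>.emeasure_eq_measure ennreal_leI)
    qed
    then have "emeasure \<kappa> \<le> emeasure \<nu>"
      using s\<nu> s\<kappa> by (auto simp: le_fun_def) (metis emeasure_notin_sets order_refl zero_le)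
    then show ?thesis using s\<nu> s\<kappa> sp\<nu> sp\<kappa> by (simp add: le_measure_iff)
  qed
  then show ?thesis using \<kappa> by blast
qed

text \<open>Existence of a least controlling measure gives the LEAST in \<open>mass_measure\<close>
  its meaning. Together with \<open>mass_nonneg\<close>, this is how the later estimates get at
  \<open>mass\<close>.\<close>

lemma mass_le_measure:
  assumes T: "bilinear_functional T" and \<mu>: "mass_bound T \<mu>"
  shows "mass T \<le> measure \<mu> UNIV"
proof -
  obtain \<kappa> where \<kappa>: "mass_bound T \<kappa>" "\<And>\<nu>. mass_bound T \<nu> \<Longrightarrow> \<kappa> \<le> \<nu>"
    using mass_bound_least[OF T \<mu>] by blast
  have "mass_measure T = \<kappa>"
    unfolding mass_measure_def using \<kappa> by (intro Least_equality)
  moreover have "emeasure \<kappa> UNIV \<le> emeasure \<mu> UNIV"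
    using \<kappa>(2)[OF \<mu>] by (rule le_measureD3) (use \<kappa>(1) \<mu> in \<open>auto simp: mass_bound_def finite_borel_measure_def\<close>)
  moreover have "emeasure \<mu> UNIV < \<infinity>"
    using \<mu> finite_measure.emeasure_finite[of \<mu> UNIV]
    by (auto simp: mass_bound_def finite_borel_measure_def top.not_eq_extremum)
  ultimately show ?thesis by (simp add: mass_def measure_def enn2real_mono)
qed

lemma mass_nonneg: "0 \<le> mass T"
  by (simp add: mass_def)

section \<open>Countable sums of currents\<close>

text \<open>The sum of countably many measures is the controlling measure of a series of currents.
  The integral formula is proved by induction over measurable functions, starting from
  indicators.\<close>

lemma sum_measure_exists:
  fixes \<mu> :: "nat \<Rightarrow> 'a::topological_space measure"
  assumes \<mu>: "\<And>n. sets (\<mu> n) = sets borel"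
  obtains \<kappa> :: "'a measure" where "sets \<kappa> = sets borel"
    "\<And>f. f \<in> borel_measurable borel \<Longrightarrow> (\<integral>\<^sup>+x. f x \<partial>\<kappa>) = (\<Sum>n. \<integral>\<^sup>+x. f x \<partial>\<mu> n)"
proof -
  define \<kappa> :: "'a measure" where "\<kappa> = measure_of UNIV (sets borel) (\<lambda>A. \<Sum>n. emeasure (\<mu> n) A)"
  have s\<kappa>: "sets \<kappa> = sets borel"
    unfolding \<kappa>_def by (metis sets.sets_measure_of_eq space_borel)
  have em: "emeasure \<kappa> A = (\<Sum>n. emeasure (\<mu> n) A)" if "A \<in> sets borel" for A
    unfolding \<kappa>_def
  proof (rule emeasure_measure_of[OF refl])
    show "sets borel \<subseteq> Pow (UNIV :: 'a set)" by simp
    show "A \<in> sets (measure_of UNIV (sets borel) (\<lambda>A. \<Sum>n. emeasure (\<mu> n) A))"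
      using that s\<kappa> by (simp add: \<kappa>_def)
    show "positive (sets (measure_of UNIV (sets borel) (\<lambda>A. \<Sum>n. emeasure (\<mu> n) A))) (\<lambda>A. \<Sum>n. emeasure (\<mu> n) A)"
      by (simp add: positive_def)
    show "countably_additive (sets (measure_of UNIV (sets borel) (\<lambda>A. \<Sum>n. emeasure (\<mu> n) A))) (\<lambda>A. \<Sum>n. emeasure (\<mu> n) A)"
      unfolding \<kappa>_def[symmetric] s\<kappa>
    proof (rule countably_additiveI)
      fix A :: "nat \<Rightarrow> 'a set" assume A: "range A \<subseteq> sets borel" "disjoint_family A"
      \<comment> \<open>Reading one of the two sums as an integral against counting measure allows
        the interchange.\<close>
      have "(\<Sum>i. \<Sum>n. emeasure (\<mu> n) (A i)) = (\<Sum>i. \<integral>\<^sup>+n. emeasure (\<mu> n) (A i) \<partial>count_space UNIV)"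
        by (simp add: nn_integral_count_space_nat)
      also have "\<dots> = (\<integral>\<^sup>+n. (\<Sum>i. emeasure (\<mu> n) (A i)) \<partial>count_space UNIV)"
        by (rule nn_integral_suminf[symmetric]) simp
      also have "\<dots> = (\<Sum>n. \<Sum>i. emeasure (\<mu> n) (A i))"
        by (simp add: nn_integral_count_space_nat)
      also have "\<dots> = (\<Sum>n. emeasure (\<mu> n) (\<Union>i. A i))"
        using A \<mu> by (intro suminf_cong suminf_emeasure) auto
      finally show "(\<Sum>i. \<Sum>n. emeasure (\<mu> n) (A i)) = (\<Sum>n. emeasure (\<mu> n) (\<Union>i. A i))" .
    qed
  qed
  have meas: "f \<in> borel_measurable borel \<Longrightarrow> f \<in> borel_measurable (\<mu> n)" for f :: "'a \<Rightarrow> ennreal" and n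
    using measurable_cong_sets[OF \<mu> refl] by blast
  have meas\<kappa>: "f \<in> borel_measurable borel \<Longrightarrow> f \<in> borel_measurable \<kappa>" for f :: "'a \<Rightarrow> ennreal"
    using measurable_cong_sets[OF s\<kappa> refl] by blast
  have "(\<integral>\<^sup>+x. f x \<partial>\<kappa>) = (\<Sum>n. \<integral>\<^sup>+x. f x \<partial>\<mu> n)" if "f \<in> borel_measurable borel" for f
    using that
  proof (induction rule: borel_measurable_induct)
    case (cong f g)
    then have "f = g" by (simp add: fun_eq_iff)
    then show ?case using cong by simp
  next
    case (set A)
    then show ?case by (simp add: em \<mu> s\<kappa>)
  next
    case (mult u c)
    then show ?case by (simp add: nn_integral_cmult meas meas\<kappa> ennreal_suminf_cmult)
  next
    case (add u v)
    then show ?case by (simp add: nn_integral_add meas meas\<kappa> suminf_add)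
  next
    case (seq U)
    have "(\<integral>\<^sup>+x. (SUP i. U i) x \<partial>\<kappa>) = (\<integral>\<^sup>+x. (SUP i. U i x) \<partial>\<kappa>)"
      by (simp add: image_comp)
    also have "\<dots> = (SUP i. \<integral>\<^sup>+x. U i x \<partial>\<kappa>)"
      using seq by (intro nn_integral_monotone_convergence_SUP) (auto intro: meas\<kappa>)
    also have "\<dots> = (SUP i. \<Sum>n. \<integral>\<^sup>+x. U i x \<partial>\<mu> n)"
      using seq by simp
    also have "\<dots> = (\<Sum>n. SUP i. \<integral>\<^sup>+x. U i x \<partial>\<mu> n)"
      using seq(3) by (intro ennreal_suminf_SUP_eq[symmetric])
        (auto simp: incseq_def le_fun_def intro!: nn_integral_mono)
    also have "\<dots> = (\<Sum>n. \<integral>\<^sup>+x. (SUP i. U i x) \<partial>\<mu> n)"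
      using seq by (intro suminf_cong nn_integral_monotone_convergence_SUP[symmetric]) (auto intro: meas)
    also have "\<dots> = (\<Sum>n. \<integral>\<^sup>+x. (SUP i. U i) x \<partial>\<mu> n)"
      by (simp add: image_comp)
    finally show ?case .
  qed
  then show ?thesis using s\<kappa> that by blast
qed

lemma Lip_b_integrable:
  assumes "finite_borel_measure \<mu>" "f \<in> Lip_b"
  shows "integrable \<mu> (\<lambda>x. \<bar>f x\<bar>)"
proof -
  obtain B where B: "\<And>x. \<bar>f x\<bar> \<le> B" using Lip_bE[OF assms(2)] by blast
  have [measurable]: "f \<in> borel_measurable borel" using assms by (intro Lip_borel_measurable Lip_b_imp_Lip)
  show ?thesis by (rule integrable_bounded_borel[OF assms(1), of _ B]) (use B in auto)
qed

text \<open>Summable total masses make the sum measure finite, which converts the identity in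
  \<open>ennreal\<close> into convergent real series.\<close>

lemma finite_sum_measure_exists:
  fixes \<mu> :: "nat \<Rightarrow> 'a::metric_space measure"
  assumes \<mu>: "\<And>n. finite_borel_measure (\<mu> n)" and sm: "summable (\<lambda>n. measure (\<mu> n) UNIV)"
  obtains \<kappa> where "finite_borel_measure \<kappa>" "measure \<kappa> UNIV = (\<Sum>n. measure (\<mu> n) UNIV)"
    "\<And>f. f \<in> Lip_b \<Longrightarrow> (\<lambda>n. LINT x|\<mu> n. \<bar>f x\<bar>) sums (LINT x|\<kappa>. \<bar>f x\<bar>)"
proof -
  have s\<mu>: "sets (\<mu> n) = sets borel" for n using \<mu> by (simp add: finite_borel_measure_def)
  have sp: "space (\<mu> n) = UNIV" for n using sets_eq_imp_space_eq[OF s\<mu>] by simp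
  obtain \<kappa> :: "'a measure" where \<kappa>: "sets \<kappa> = sets borel"
    "\<And>f. f \<in> borel_measurable borel \<Longrightarrow> (\<integral>\<^sup>+x. f x \<partial>\<kappa>) = (\<Sum>n. \<integral>\<^sup>+x. f x \<partial>\<mu> n)"
    by (rule sum_measure_exists[of \<mu>, OF s\<mu>]) blast
  have sp\<kappa>: "space \<kappa> = UNIV" using sets_eq_imp_space_eq[OF \<kappa>(1)] by simp
  have "emeasure \<kappa> UNIV = (\<Sum>n. emeasure (\<mu> n) UNIV)"
    using \<kappa>(2)[of "\<lambda>_. 1"] sp sp\<kappa> by simp
  also have "\<dots> = (\<Sum>n. ennreal (measure (\<mu> n) UNIV))"
    using \<mu> by (intro suminf_cong finite_measure.emeasure_eq_measure) (simp add: finite_borel_measure_def)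
  also have "\<dots> = ennreal (\<Sum>n. measure (\<mu> n) UNIV)"
    using sm by (intro suminf_ennreal2) auto
  finally have em: "emeasure \<kappa> UNIV = ennreal (\<Sum>n. measure (\<mu> n) UNIV)" .
  have fin: "finite_borel_measure \<kappa>"
    using em \<kappa>(1) sp\<kappa> by (auto simp: finite_borel_measure_def intro!: finite_measureI)
  show ?thesis
  proof (rule that[OF fin])
    show "measure \<kappa> UNIV = (\<Sum>n. measure (\<mu> n) UNIV)"
      using em sm by (simp add: measure_def suminf_nonneg)
    fix f :: "'a \<Rightarrow> real" assume f: "f \<in> Lip_b"
    obtain B where B: "B \<ge> 0" "\<And>x. \<bar>f x\<bar> \<le> B" using Lip_bE[OF f] by blast
    have [measurable]: "f \<in> borel_measurable borel" using f by (intro Lip_borel_measurable Lip_b_imp_Lip)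
    have le: "(LINT x|\<mu> n. \<bar>f x\<bar>) \<le> B * measure (\<mu> n) UNIV" for n
    proof -
      have "(LINT x|\<mu> n. \<bar>f x\<bar>) \<le> (LINT x|\<mu> n. B)"
        by (intro integral_mono Lip_b_integrable[OF \<mu> f] integrable_bounded_borel[OF \<mu>, of _ "\<bar>B\<bar>"]) (use B in auto)
      then show ?thesis using sp by (simp add: mult.commute)
    qed
    have sm': "summable (\<lambda>n. LINT x|\<mu> n. \<bar>f x\<bar>)"
      by (rule summable_comparison_test'[OF summable_mult[OF sm, of B]]) (use le in auto)
    have "ennreal (LINT x|\<kappa>. \<bar>f x\<bar>) = (\<integral>\<^sup>+x. ennreal \<bar>f x\<bar> \<partial>\<kappa>)"
      by (rule nn_integral_eq_integral[symmetric, OF Lip_b_integrable[OF fin f]]) auto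
    also have "\<dots> = (\<Sum>n. \<integral>\<^sup>+x. ennreal \<bar>f x\<bar> \<partial>\<mu> n)" by (rule \<kappa>(2)) measurable
    also have "\<dots> = (\<Sum>n. ennreal (LINT x|\<mu> n. \<bar>f x\<bar>))"
      by (intro suminf_cong nn_integral_eq_integral Lip_b_integrable[OF \<mu> f]) auto
    also have "\<dots> = ennreal (\<Sum>n. LINT x|\<mu> n. \<bar>f x\<bar>)"
      by (rule suminf_ennreal2[OF _ sm']) auto
    finally have "(LINT x|\<kappa>. \<bar>f x\<bar>) = (\<Sum>n. LINT x|\<mu> n. \<bar>f x\<bar>)"
      using sm' by (simp add: suminf_nonneg)
    then show "(\<lambda>n. LINT x|\<mu> n. \<bar>f x\<bar>) sums (LINT x|\<kappa>. \<bar>f x\<bar>)" using sm' by (simp add: sums_iff)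
  qed
qed

text \<open>The bound is put on some controlling measure and not on \<open>mass\<close>: controlling
  measures of summands can be added, so this form passes to multiples and to infinite
  series.\<close>

definition current_mass_le :: "'a::metric_space functional \<Rightarrow> real \<Rightarrow> bool"
  where "current_mass_le T m \<longleftrightarrow> metric_current T \<and> (\<exists>\<mu>. mass_bound T \<mu> \<and> measure \<mu> UNIV \<le> m)"

lemma metric_current_bilinear: "metric_current T \<Longrightarrow> bilinear_functional T"
  by (simp add: metric_current_def)

lemma metric_current_continuous:
  assumes "metric_current T" "f \<in> Lip_b" "\<pi> \<in> Lip" "\<And>j::nat. \<pi>s j \<in> Lip"
    "bdd_above (range (\<lambda>j. lip_const (\<pi>s j)))" "\<And>x. (\<lambda>j. \<pi>s j x) \<longlonglongrightarrow> \<pi> x"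
  shows "(\<lambda>j. T f (\<pi>s j)) \<longlonglongrightarrow> T f \<pi>"
  using assms unfolding metric_current_def by blast

lemma metric_current_local:
  assumes "metric_current T" "f \<in> Lip_b" "\<pi> \<in> Lip" "open U" "closure {x. f x \<noteq> 0} \<subseteq> U" "\<And>x. x \<in> U \<Longrightarrow> \<pi> x = a"
  shows "T f \<pi> = 0"
proof -
  have "\<forall>f\<in>Lip_b. \<forall>\<pi>\<in>Lip. (\<exists>U a. open U \<and> closure {x. f x \<noteq> 0} \<subseteq> U \<and> (\<forall>x\<in>U. \<pi> x = a)) \<longrightarrow> T f \<pi> = 0"
    using assms(1) unfolding metric_current_def by (elim conjE)
  from this[rule_format, OF assms(2,3)] show ?thesis using assms(4-6) by metis
qed

lemma metric_currentI:
  assumes "bilinear_functional T" "mass_bound T \<mu>"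
    and "\<And>f \<pi> \<pi>s. f \<in> Lip_b \<Longrightarrow> \<pi> \<in> Lip \<Longrightarrow> (\<And>j::nat. \<pi>s j \<in> Lip) \<Longrightarrow>
      bdd_above (range (\<lambda>j. lip_const (\<pi>s j))) \<Longrightarrow> (\<And>x. (\<lambda>j. \<pi>s j x) \<longlonglongrightarrow> \<pi> x) \<Longrightarrow> (\<lambda>j. T f (\<pi>s j)) \<longlonglongrightarrow> T f \<pi>"
    and "\<And>f \<pi> U a. f \<in> Lip_b \<Longrightarrow> \<pi> \<in> Lip \<Longrightarrow> open U \<Longrightarrow> closure {x. f x \<noteq> 0} \<subseteq> U \<Longrightarrow> (\<And>x. x \<in> U \<Longrightarrow> \<pi> x = a) \<Longrightarrow> T f \<pi> = 0"
  shows "metric_current T"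
  unfolding metric_current_def
proof (intro conjI ballI allI impI)
  fix f \<pi> :: "'a \<Rightarrow> real" assume f: "f \<in> Lip_b" and \<pi>: "\<pi> \<in> Lip"
  {
    fix \<pi>s :: "nat \<Rightarrow> 'a \<Rightarrow> real"
    assume *: "(\<forall>j. \<pi>s j \<in> Lip) \<and> bdd_above (range (\<lambda>j. lip_const (\<pi>s j))) \<and> (\<forall>x. (\<lambda>j. \<pi>s j x) \<longlonglongrightarrow> \<pi> x)"
    show "(\<lambda>j. T f (\<pi>s j)) \<longlonglongrightarrow> T f \<pi>" by (rule assms(3)[OF f \<pi>]) (use * in auto)
  }
  assume "\<exists>U a. open U \<and> closure {x. f x \<noteq> 0} \<subseteq> U \<and> (\<forall>x\<in>U. \<pi> x = a)"
  then obtain U a where U: "open U" "closure {x. f x \<noteq> 0} \<subseteq> U" "\<And>x. x \<in> U \<Longrightarrow> \<pi> x = a" by blast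
  show "T f \<pi> = 0" by (rule assms(4)[OF f \<pi> U])
qed (use assms(1,2) in auto)

lemma current_mass_le_mass:
  assumes "current_mass_le T m" shows "metric_current T" "mass T \<le> m" "0 \<le> m"
proof -
  show "metric_current T" using assms by (simp add: current_mass_le_def)
  obtain \<mu> where \<mu>: "mass_bound T \<mu>" "measure \<mu> UNIV \<le> m" using assms by (auto simp: current_mass_le_def)
  then show "mass T \<le> m"
    using mass_le_measure[OF metric_current_bilinear[OF \<open>metric_current T\<close>] \<mu>(1)] by linarith
  then show "0 \<le> m" using mass_nonneg[of T] by linarith
qed

text \<open>Functionals are total, but series of currents are known to converge on Lipschitz pairs
  alone; identities between currents are therefore available only there.\<close>

lemma current_mass_le_cong:
  assumes T: "current_mass_le T m" and eq: "\<And>f \<pi>. f \<in> Lip_b \<Longrightarrow> \<pi> \<in> Lip \<Longrightarrow> T' f \<pi> = T f \<pi>"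
  shows "current_mass_le T' m"
proof -
  obtain \<mu> where \<mu>: "mass_bound T \<mu>" "measure \<mu> UNIV \<le> m" using T by (auto simp: current_mass_le_def)
  have cur: "metric_current T" using T by (simp add: current_mass_le_def)
  have \<mu>': "mass_bound T' \<mu>" using \<mu>(1) eq by (simp add: mass_bound_def)
  have "metric_current T'"
  proof (rule metric_currentI[OF _ \<mu>'])
    show "bilinear_functional T'"
      unfolding bilinear_functional_def
      by (simp add: eq Lip_lincomb Lip_b_lincomb bilinear_functionalD[OF metric_current_bilinear[OF cur]])
  qed (use metric_current_continuous[OF cur] metric_current_local[OF cur] eq in auto)
  then show ?thesis using \<mu>' \<mu>(2) by (auto simp: current_mass_le_def)
qed

lemma current_mass_le_cmult:
  assumes T: "current_mass_le T m"
  shows "current_mass_le (\<lambda>f \<pi>. a * T f \<pi>) (\<bar>a\<bar> * m)"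
proof -
  obtain \<mu> where \<mu>: "mass_bound T \<mu>" "measure \<mu> UNIV \<le> m" using T by (auto simp: current_mass_le_def)
  have cur: "metric_current T" using T by (simp add: current_mass_le_def)
  have fin: "finite_borel_measure \<mu>" using \<mu> by (simp add: mass_bound_def)
  have sp: "space \<mu> = UNIV"
    using fin by (metis finite_borel_measure_def sets_eq_imp_space_eq space_borel)
  \<comment> \<open>The multiple is controlled by the constant density |a| relative to
    \<mu>.\<close>
  have d: "mass_density (\<lambda>f \<pi>. a * T f \<pi>) \<mu> (\<lambda>_. \<bar>a\<bar>)"
    unfolding mass_density_def
  proof (intro conjI ballI allI)
    show "integrable \<mu> (\<lambda>_. \<bar>a\<bar>)" by (rule integrable_bounded_borel[OF fin, of _ "\<bar>a\<bar>"]) auto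
    fix f \<pi> :: "'a \<Rightarrow> real" assume "f \<in> Lip_b" "\<pi> \<in> Lip"
    then have "\<bar>a\<bar> * \<bar>T f \<pi>\<bar> \<le> \<bar>a\<bar> * (lip_const \<pi> * (LINT x|\<mu>. \<bar>f x\<bar>))"
      by (intro mult_left_mono mass_boundD[OF \<mu>(1)]) auto
    then show "\<bar>a * T f \<pi>\<bar> \<le> lip_const \<pi> * (LINT x|\<mu>. \<bar>a\<bar> * \<bar>f x\<bar>)"
      by (simp add: abs_mult mult_ac)
  qed auto
  note M = mass_bound_density[OF fin d]
  have "metric_current (\<lambda>f \<pi>. a * T f \<pi>)"
  proof (rule metric_currentI[OF _ M(1)])
    show "bilinear_functional (\<lambda>f \<pi>. a * T f \<pi>)"
      using bilinear_functionalD[OF metric_current_bilinear[OF cur]]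
      unfolding bilinear_functional_def by (simp add: algebra_simps)
  next
    fix f \<pi> :: "'a \<Rightarrow> real" and \<pi>s :: "nat \<Rightarrow> 'a \<Rightarrow> real"
    assume "f \<in> Lip_b" "\<pi> \<in> Lip" "\<And>j. \<pi>s j \<in> Lip" "bdd_above (range (\<lambda>j. lip_const (\<pi>s j)))" "\<And>x. (\<lambda>j. \<pi>s j x) \<longlonglongrightarrow> \<pi> x"
    then show "(\<lambda>j. a * T f (\<pi>s j)) \<longlonglongrightarrow> a * T f \<pi>"
      by (intro tendsto_mult_left metric_current_continuous[OF cur])
  next
    fix f \<pi> :: "'a \<Rightarrow> real" and U b assume "f \<in> Lip_b" "\<pi> \<in> Lip" "open U" "closure {x. f x \<noteq> 0} \<subseteq> U" "\<And>x. x \<in> U \<Longrightarrow> \<pi> x = b"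
    then have "T f \<pi> = 0" by (rule metric_current_local[OF cur])
    then show "a * T f \<pi> = 0" by simp
  qed
  moreover have "measure (density \<mu> (\<lambda>x. ennreal \<bar>a\<bar>)) UNIV \<le> \<bar>a\<bar> * m"
    unfolding M(2) using mult_left_mono[OF \<mu>(2), of "\<bar>a\<bar>"] sp by (simp add: mult.commute)
  ultimately show ?thesis using M(1) by (auto simp: current_mass_le_def)
qed

text \<open>The sum of the controlling measures controls the series and makes it absolutely
  convergent. Bilinearity and locality then hold termwise, and continuity is an interchange of limit
  and sum.\<close>

lemma current_mass_le_suminf:
  assumes Q: "\<And>n. current_mass_le (Q n) (m n)" and m: "summable m"
  shows "current_mass_le (\<lambda>f \<pi>. \<Sum>n. Q n f \<pi>) (\<Sum>n. m n)"
    and "f \<in> Lip_b \<Longrightarrow> \<pi> \<in> Lip \<Longrightarrow> summable (\<lambda>n. Q n f \<pi>)"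
proof -
  have cur: "metric_current (Q n)" for n using Q by (simp add: current_mass_le_def)
  obtain \<mu> where \<mu>: "\<And>n. mass_bound (Q n) (\<mu> n)" "\<And>n. measure (\<mu> n) UNIV \<le> m n"
    using Q unfolding current_mass_le_def by metis
  have fin: "finite_borel_measure (\<mu> n)" for n using \<mu>(1) by (simp add: mass_bound_def)
  have sm: "summable (\<lambda>n. measure (\<mu> n) UNIV)"
    by (rule summable_comparison_test'[OF m]) (use \<mu>(2) in auto)
  obtain \<kappa> where \<kappa>: "finite_borel_measure \<kappa>" "measure \<kappa> UNIV = (\<Sum>n. measure (\<mu> n) UNIV)"
    "\<And>f. f \<in> Lip_b \<Longrightarrow> (\<lambda>n. LINT x|\<mu> n. \<bar>f x\<bar>) sums (LINT x|\<kappa>. \<bar>f x\<bar>)"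
    using finite_sum_measure_exists[OF fin sm] by blast
  have sumb: "summable (\<lambda>n. \<bar>Q n f \<pi>\<bar>)" "(\<Sum>n. \<bar>Q n f \<pi>\<bar>) \<le> lip_const \<pi> * (LINT x|\<kappa>. \<bar>f x\<bar>)"
    if f: "f \<in> Lip_b" and \<pi>: "\<pi> \<in> Lip" for f \<pi>
  proof -
    have s: "(\<lambda>n. lip_const \<pi> * (LINT x|\<mu> n. \<bar>f x\<bar>)) sums (lip_const \<pi> * (LINT x|\<kappa>. \<bar>f x\<bar>))"
      by (rule sums_mult[OF \<kappa>(3)[OF f]])
    show 1: "summable (\<lambda>n. \<bar>Q n f \<pi>\<bar>)"
      by (rule summable_comparison_test'[OF sums_summable[OF s]]) (use mass_boundD[OF \<mu>(1) f \<pi>] in auto)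
    show "(\<Sum>n. \<bar>Q n f \<pi>\<bar>) \<le> lip_const \<pi> * (LINT x|\<kappa>. \<bar>f x\<bar>)"
      unfolding sums_unique[OF s]
      by (rule suminf_le[OF _ 1 sums_summable[OF s]]) (rule mass_boundD[OF \<mu>(1) f \<pi>])
  qed
  have sumQ: "summable (\<lambda>n. Q n f \<pi>)" if "f \<in> Lip_b" "\<pi> \<in> Lip" for f \<pi>
    using sumb(1)[OF that] by (rule summable_rabs_cancel)
  show "f \<in> Lip_b \<Longrightarrow> \<pi> \<in> Lip \<Longrightarrow> summable (\<lambda>n. Q n f \<pi>)" by (rule sumQ)
  have mb: "mass_bound (\<lambda>f \<pi>. \<Sum>n. Q n f \<pi>) \<kappa>"
    unfolding mass_bound_def
  proof (intro conjI ballI \<kappa>(1))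
    fix f \<pi> :: "'a \<Rightarrow> real" assume "f \<in> Lip_b" "\<pi> \<in> Lip"
    then show "\<bar>\<Sum>n. Q n f \<pi>\<bar> \<le> lip_const \<pi> * (LINT x|\<kappa>. \<bar>f x\<bar>)"
      using summable_rabs[OF sumb(1)] sumb(2) by (meson order_trans)
  qed
  have "metric_current (\<lambda>f \<pi>. \<Sum>n. Q n f \<pi>)"
  proof (rule metric_currentI[OF _ mb])
    show "bilinear_functional (\<lambda>f \<pi>. \<Sum>n. Q n f \<pi>)"
      unfolding bilinear_functional_def
    proof (intro conjI ballI allI)
      fix f g \<pi> :: "'a \<Rightarrow> real" and a b assume *: "f \<in> Lip_b" "g \<in> Lip_b" "\<pi> \<in> Lip"
      have "(\<Sum>n. Q n (\<lambda>x. a * f x + b * g x) \<pi>) = (\<Sum>n. a * Q n f \<pi> + b * Q n g \<pi>)"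
        by (intro suminf_cong bilinear_functionalD[OF metric_current_bilinear[OF cur]] *)
      also have "\<dots> = a * (\<Sum>n. Q n f \<pi>) + b * (\<Sum>n. Q n g \<pi>)"
        using sumQ * by (simp add: suminf_add suminf_mult summable_mult flip: suminf_add)
      finally show "(\<Sum>n. Q n (\<lambda>x. a * f x + b * g x) \<pi>) = a * (\<Sum>n. Q n f \<pi>) + b * (\<Sum>n. Q n g \<pi>)" .
    next
      fix f \<pi> \<sigma> :: "'a \<Rightarrow> real" and a b assume *: "f \<in> Lip_b" "\<pi> \<in> Lip" "\<sigma> \<in> Lip"
      have "(\<Sum>n. Q n f (\<lambda>x. a * \<pi> x + b * \<sigma> x)) = (\<Sum>n. a * Q n f \<pi> + b * Q n f \<sigma>)"
        by (intro suminf_cong bilinear_functionalD[OF metric_current_bilinear[OF cur]] *)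
      also have "\<dots> = a * (\<Sum>n. Q n f \<pi>) + b * (\<Sum>n. Q n f \<sigma>)"
        using sumQ * by (simp add: suminf_add suminf_mult summable_mult flip: suminf_add)
      finally show "(\<Sum>n. Q n f (\<lambda>x. a * \<pi> x + b * \<sigma> x)) = a * (\<Sum>n. Q n f \<pi>) + b * (\<Sum>n. Q n f \<sigma>)" .
    qed
  next
    fix f \<pi> :: "'a \<Rightarrow> real" and \<pi>s :: "nat \<Rightarrow> 'a \<Rightarrow> real"
    assume f: "f \<in> Lip_b" and \<pi>: "\<pi> \<in> Lip" and \<pi>s: "\<And>j. \<pi>s j \<in> Lip" "bdd_above (range (\<lambda>j. lip_const (\<pi>s j)))"
      and lim: "\<And>x. (\<lambda>j. \<pi>s j x) \<longlonglongrightarrow> \<pi> x"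
    obtain \<Lambda> where \<Lambda>: "\<And>j. lip_const (\<pi>s j) \<le> \<Lambda>" using \<pi>s(2) by (auto simp: bdd_above_def)
    have bd: "norm (Q n f (\<pi>s j)) \<le> \<Lambda> * (LINT x|\<mu> n. \<bar>f x\<bar>)" for n j
    proof -
      have "\<bar>Q n f (\<pi>s j)\<bar> \<le> lip_const (\<pi>s j) * (LINT x|\<mu> n. \<bar>f x\<bar>)" by (rule mass_boundD[OF \<mu>(1) f \<pi>s(1)])
      also have "\<dots> \<le> \<Lambda> * (LINT x|\<mu> n. \<bar>f x\<bar>)" by (intro mult_right_mono \<Lambda>) auto
      finally show ?thesis by simp
    qed
    \<comment> \<open>The uniform Lipschitz bound \<Lambda> gives a summable majorant independent of
      j, which is the hypothesis of Tannery's theorem.\<close>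
    have "\<forall>\<^sub>F (n, j) in at_top \<times>\<^sub>F sequentially. norm (Q n f (\<pi>s j)) \<le> \<Lambda> * (LINT x|\<mu> n. \<bar>f x\<bar>)"
      using bd by (intro always_eventually) auto
    moreover have "summable (\<lambda>n. \<Lambda> * (LINT x|\<mu> n. \<bar>f x\<bar>))"
      by (intro summable_mult sums_summable[OF \<kappa>(3)[OF f]])
    moreover have "(\<lambda>j. Q n f (\<pi>s j)) \<longlonglongrightarrow> Q n f \<pi>" for n
      by (rule metric_current_continuous[OF cur f \<pi> \<pi>s lim])
    ultimately show "(\<lambda>j. \<Sum>n. Q n f (\<pi>s j)) \<longlonglongrightarrow> (\<Sum>n. Q n f \<pi>)"
      using tannerys_theorem[of "\<lambda>n j. Q n f (\<pi>s j)" "\<lambda>n. Q n f \<pi>" sequentially "\<lambda>n. \<Lambda> * (LINT x|\<mu> n. \<bar>f x\<bar>)"]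
      by simp
  next
    fix f \<pi> :: "'a \<Rightarrow> real" and U a assume "f \<in> Lip_b" "\<pi> \<in> Lip" "open U" "closure {x. f x \<noteq> 0} \<subseteq> U" "\<And>x. x \<in> U \<Longrightarrow> \<pi> x = a"
    then have "Q n f \<pi> = 0" for n by (rule metric_current_local[OF cur])
    then show "(\<Sum>n. Q n f \<pi>) = 0" by simp
  qed
  moreover have "measure \<kappa> UNIV \<le> (\<Sum>n. m n)"
    unfolding \<kappa>(2) by (rule suminf_le[OF \<mu>(2) sm m])
  ultimately show "current_mass_le (\<lambda>f \<pi>. \<Sum>n. Q n f \<pi>) (\<Sum>n. m n)"
    using mb by (auto simp: current_mass_le_def)
qed

lemma current_mass_le_add:
  assumes S: "current_mass_le S m" and T: "current_mass_le T n"
  shows "current_mass_le (\<lambda>f \<pi>. S f \<pi> + T f \<pi>) (m + n)"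
proof -
  \<comment> \<open>A finite sum is treated as a series. Its tail is written as 0 * S so that
    \<open>current_mass_le_cmult\<close> certifies it with bound 0.\<close>
  define Q where "Q k = (if k = 0 then S else if k = Suc 0 then T else (\<lambda>f \<pi>. 0 * S f \<pi>))" for k :: nat
  define w where "w k = (if k = 0 then m else if k = Suc 0 then n else 0)" for k :: nat
  have "current_mass_le (Q k) (w k)" for k
    using S T current_mass_le_cmult[OF S, of 0] by (auto simp: Q_def w_def)
  moreover have "summable w" by (rule summable_finite[of "{0, Suc 0}"]) (auto simp: w_def)
  ultimately have "current_mass_le (\<lambda>f \<pi>. \<Sum>k. Q k f \<pi>) (\<Sum>k. w k)" by (rule current_mass_le_suminf)
  moreover have "(\<Sum>k. w k) = m + n"
    by (subst suminf_finite[of "{0, Suc 0}"]) (auto simp: w_def)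
  moreover have "(\<Sum>k. Q k f \<pi>) = S f \<pi> + T f \<pi>" for f \<pi>
    by (subst suminf_finite[of "{0, Suc 0}"]) (auto simp: Q_def)
  ultimately show ?thesis by simp
qed

lemma current_mass_le_diff:
  assumes S: "current_mass_le S m" and T: "current_mass_le T n"
  shows "current_mass_le (\<lambda>f \<pi>. S f \<pi> - T f \<pi>) (m + n)"
  using current_mass_le_add[OF S current_mass_le_cmult[OF T, of "- 1"]] by simp

lemma current_mass_le_curve:
  assumes "L-lipschitz_on {0..1} \<theta>"
  shows "current_mass_le (curve_current \<theta>) (curve_length \<theta>)"
  using metric_current_curve_current[OF assms] mass_bound_curve_current[OF assms] finite_borel_curve_mass(2)[OF assms]
  by (auto simp: current_mass_le_def)

section \<open>Functionals on Lipschitz functions\<close>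

lemma lip_const_lincomb:
  assumes "f \<in> Lip" "g \<in> Lip"
  shows "lip_const (\<lambda>x. a * f x + b * g x) \<le> \<bar>a\<bar> * lip_const f + \<bar>b\<bar> * lip_const g"
  by (rule lip_const_le) (intro lipschitz_on_add lipschitz_on_cmult_real lipschitz_lip_const assms)

lemma Lip_cmult: "f \<in> Lip \<Longrightarrow> (\<lambda>x. a * f x) \<in> Lip"
  using Lip_lincomb[of f f a 0] by simp

lemma lip_const_cmult_le: "f \<in> Lip \<Longrightarrow> lip_const (\<lambda>x. a * f x) \<le> \<bar>a\<bar> * lip_const f"
  using lip_const_lincomb[of f f a 0] by simp

definition linear_on_Lip :: "(('a::metric_space \<Rightarrow> real) \<Rightarrow> real) \<Rightarrow> bool"
  where "linear_on_Lip L \<longleftrightarrow> (\<forall>f\<in>Lip. \<forall>g\<in>Lip. \<forall>a b. L (\<lambda>x. a * f x + b * g x) = a * L f + b * L g)"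

lemma linear_on_LipD:
  assumes "linear_on_Lip L" "f \<in> Lip"
  shows "g \<in> Lip \<Longrightarrow> L (\<lambda>x. a * f x + b * g x) = a * L f + b * L g" "L (\<lambda>x. a * f x) = a * L f"
    "g \<in> Lip \<Longrightarrow> L (\<lambda>x. f x - g x) = L f - L g"
proof -
  show *: "L (\<lambda>x. a * f x + b * g x) = a * L f + b * L g" if "g \<in> Lip" for g a b
    using assms that by (auto simp: linear_on_Lip_def)
  show "L (\<lambda>x. a * f x) = a * L f" using *[OF assms(2), of a 0] by simp
  show "L (\<lambda>x. f x - g x) = L f - L g" if "g \<in> Lip" using *[OF that, of 1 "- 1"] by simp
qed

text \<open>What remains of a boundary once the current is forgotten. M is any bound, not
  necessarily the norm, so that a residual can be recorded together with the tolerance that produced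
  it.\<close>

definition kr_functional :: "(('a::metric_space \<Rightarrow> real) \<Rightarrow> real) \<Rightarrow> real \<Rightarrow> bool"
  where "kr_functional L M \<longleftrightarrow> linear_on_Lip L \<and> 0 \<le> M \<and> (\<forall>f\<in>Lip. \<bar>L f\<bar> \<le> M * lip_const f) \<and>
    (\<forall>\<pi>\<in>Lip. \<forall>\<pi>s. (\<forall>j::nat. \<pi>s j \<in> Lip) \<longrightarrow> bdd_above (range (\<lambda>j. lip_const (\<pi>s j))) \<longrightarrow>
       (\<forall>x. (\<lambda>j. \<pi>s j x) \<longlonglongrightarrow> \<pi> x) \<longrightarrow> (\<lambda>j. L (\<pi>s j)) \<longlonglongrightarrow> L \<pi>)"

lemma separable_dense_sequence:
  assumes "separable_space (euclidean :: 'a::metric_space topology)"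
  obtains e :: "nat \<Rightarrow> 'a::metric_space" where "\<And>x r. r > 0 \<Longrightarrow> \<exists>k. dist x (e k) < r"
proof -
  obtain D :: "'a set" where D: "countable D" "closure D = UNIV"
    using assms by (auto simp: separable_space_def)
  have "D \<noteq> {}" using D by auto
  then have e: "range (from_nat_into D) = D" using D by (intro range_from_nat_into)
  have "\<exists>k. dist x (from_nat_into D k) < r" if r: "r > 0" for x r
  proof -
    have "x \<in> closure D" using D by simp
    then obtain y where "y \<in> D" "dist y x < r" using r unfolding closure_approachable by blast
    then show ?thesis using e by (metis dist_commute rangeE)
  qed
  then show ?thesis by (rule that)
qed

text \<open>If this failed, functions vanishing on longer and longer initial parts of a dense sequence
  would converge pointwise to zero while \<open>L\<close> stays away from zero.\<close>

lemma kr_functional_small_off_finite: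
  fixes L :: "('a::metric_space \<Rightarrow> real) \<Rightarrow> real"
  assumes sep: "separable_space (euclidean :: 'a topology)" and L: "kr_functional L M" and \<delta>: "\<delta> > 0"
  shows "\<exists>F. finite F \<and> (\<forall>f\<in>Lip. (\<forall>x\<in>F. f x = 0) \<longrightarrow> \<bar>L f\<bar> \<le> \<delta> * lip_const f)"
proof -
  have lin: "linear_on_Lip L" and bnd: "\<And>f. f \<in> Lip \<Longrightarrow> \<bar>L f\<bar> \<le> M * lip_const f"
    using L by (auto simp: kr_functional_def)
  obtain e :: "nat \<Rightarrow> 'a" where e: "\<And>x r. r > 0 \<Longrightarrow> \<exists>k. dist x (e k) < r"
    using separable_dense_sequence[OF sep] by blast
  have "\<exists>n. \<forall>f. 1-lipschitz_on UNIV f \<longrightarrow> (\<forall>x\<in>e ` {..n}. f x = 0) \<longrightarrow> \<bar>L f\<bar> \<le> \<delta>"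
  proof (rule ccontr)
    assume "\<not> ?thesis"
    then obtain f where f: "\<And>n. 1-lipschitz_on UNIV (f n)" "\<And>n. \<forall>x\<in>e ` {..n}. f n x = 0" "\<And>n. \<delta> < \<bar>L (f n)\<bar>"
      unfolding not_ex not_all not_imp not_le by metis
    have lim: "(\<lambda>n. f n x) \<longlonglongrightarrow> 0" for x
    proof (rule LIMSEQ_I)
      fix r :: real assume "r > 0"
      then obtain k where k: "dist x (e k) < r" using e by blast
      have "norm (f n x - 0) < r" if "n \<ge> k" for n
      proof -
        have "f n (e k) = 0" using f(2)[of n] that by auto
        then have "\<bar>f n x\<bar> \<le> dist x (e k)"
          using lipschitz_onD[OF f(1)[of n], of x "e k"] by (simp add: dist_real_def)
        then show ?thesis using k by simp
      qed
      then show "\<exists>k. \<forall>n\<ge>k. norm (f n x - 0) < r" by blast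
    qed
    have fL: "f n \<in> Lip" for n using f(1) by (rule LipI)
    have "bdd_above (range (\<lambda>n. lip_const (f n)))"
      using lip_const_le[OF f(1)] by (intro bdd_aboveI[of _ 1]) auto
    then have "(\<lambda>n. L (f n)) \<longlonglongrightarrow> L (\<lambda>_. 0)"
      using L fL lim by (auto simp: kr_functional_def)
    moreover have "L (\<lambda>_. 0) = 0" using linear_on_LipD(2)[OF lin Lip_const[of 0], of 0] by simp
    ultimately have "(\<lambda>n. \<bar>L (f n)\<bar>) \<longlonglongrightarrow> 0" using tendsto_rabs_zero by simp
    then have "\<forall>\<^sub>F n in sequentially. \<bar>L (f n)\<bar> < \<delta>" using \<delta> by (rule order_tendstoD)
    then obtain N where "\<bar>L (f N)\<bar> < \<delta>" unfolding eventually_sequentially by blast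
    then show False using f(3)[of N] by simp
  qed
  then obtain n where n: "\<And>f. 1-lipschitz_on UNIV f \<Longrightarrow> (\<And>x. x \<in> e ` {..n} \<Longrightarrow> f x = 0) \<Longrightarrow> \<bar>L f\<bar> \<le> \<delta>"
    by blast
  show ?thesis
  proof (intro exI[of _ "e ` {..n}"] conjI ballI impI)
    fix f :: "'a \<Rightarrow> real" assume f: "f \<in> Lip" and z: "\<forall>x\<in>e ` {..n}. f x = 0"
    let ?l = "lip_const f"
    show "\<bar>L f\<bar> \<le> \<delta> * ?l"
    proof (cases "?l = 0")
      case True
      then show ?thesis using bnd[OF f] by simp
    next
      case False
      then have l: "?l > 0" using lip_const_nonneg[OF f] by simp
      have "\<bar>1 / ?l\<bar> * ?l = 1" using l by simp
      then have "1-lipschitz_on UNIV (\<lambda>x. 1 / ?l * f x)"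
        using lipschitz_on_cmult_real[OF lipschitz_lip_const[OF f], of "1 / ?l"] by simp
      then have "\<bar>L (\<lambda>x. 1 / ?l * f x)\<bar> \<le> \<delta>" by (rule n) (use z in auto)
      then have "\<bar>1 / ?l * L f\<bar> \<le> \<delta>" unfolding linear_on_LipD(2)[OF lin f] .
      then show ?thesis using l by (simp add: abs_mult pos_divide_le_eq mult.commute)
    qed
  qed simp
qed

lemma finite_support_approximation:
  assumes "finite F" "linear_on_Lip L" "0 \<le> \<delta>"
    and "\<And>f. f \<in> Lip \<Longrightarrow> (\<And>x. x \<in> F \<Longrightarrow> f x = 0) \<Longrightarrow> \<bar>L f\<bar> \<le> \<delta> * lip_const f"
  shows "\<exists>a. \<forall>f\<in>Lip. \<bar>L f - (\<Sum>x\<in>F. a x * f x)\<bar> \<le> \<delta> * lip_const f"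
  using assms
proof (induction F arbitrary: L)
  case empty
  then show ?case by auto
next
  case (insert z F)
  note lin = insert.prems(1)
  define V where "V = {f \<in> Lip. \<forall>x\<in>F. f x = 0}"
  have "\<exists>c. \<forall>f\<in>V. \<bar>L f - c * f z\<bar> \<le> \<delta> * lip_const f"
  proof -
    define V1 where "V1 = {f \<in> V. f z = 1}"
    \<comment> \<open>For f and g in V1 the difference f - g vanishes at z as well as on F, so the
      hypothesis on L puts every lower value L f - \<delta> Lip(f) below every upper value L g +
      \<delta> Lip(g). The supremum c separates them and becomes the coefficient at z.\<close>
    define c where "c = (SUP f\<in>V1. L f - \<delta> * lip_const f)"
    have le: "L f - \<delta> * lip_const f \<le> L g + \<delta> * lip_const g" if f: "f \<in> V1" and g: "g \<in> V1" for f g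
    proof -
      have fg: "f \<in> Lip" "g \<in> Lip" using f g by (auto simp: V1_def V_def)
      have h: "(\<lambda>x. f x - g x) \<in> Lip" using Lip_lincomb[OF fg, of 1 "- 1"] by simp
      have "L f - L g = L (\<lambda>x. f x - g x)" using linear_on_LipD(3)[OF lin fg] by simp
      also have "\<dots> \<le> \<bar>L (\<lambda>x. f x - g x)\<bar>" by simp
      also have "\<dots> \<le> \<delta> * lip_const (\<lambda>x. f x - g x)"
        by (rule insert.prems(3)[OF h]) (use f g in \<open>auto simp: V1_def V_def\<close>)
      also have "\<dots> \<le> \<delta> * (lip_const f + lip_const g)"
        using lip_const_lincomb[OF fg, of 1 "- 1"] insert.prems(2) by (intro mult_left_mono) auto
      finally show ?thesis by (simp add: algebra_simps)
    qed
    have one: "\<bar>L f - c\<bar> \<le> \<delta> * lip_const f" if f: "f \<in> V1" for f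
    proof -
      have "bdd_above ((\<lambda>f. L f - \<delta> * lip_const f) ` V1)"
        using le[OF _ f] by (intro bdd_aboveI[of _ "L f + \<delta> * lip_const f"]) auto
      then have "L f - \<delta> * lip_const f \<le> c" unfolding c_def using f by (intro cSUP_upper)
      moreover have "c \<le> L f + \<delta> * lip_const f"
        unfolding c_def using f by (intro cSUP_least le) auto
      ultimately show ?thesis by (simp add: abs_le_iff)
    qed
    have "\<bar>L f - c * f z\<bar> \<le> \<delta> * lip_const f" if f: "f \<in> V" for f
    proof (cases "f z = 0")
      case True
      then show ?thesis using f insert.prems(3)[of f] by (auto simp: V_def)
    next
      case False
      have fL: "f \<in> Lip" using f by (simp add: V_def)
      let ?g = "\<lambda>x. 1 / f z * f x"
      have "?g \<in> V1" using f False Lip_cmult[OF fL, of "1 / f z"] by (auto simp: V1_def V_def)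
      then have "\<bar>L ?g - c\<bar> \<le> \<delta> * lip_const ?g" by (rule one)
      also have "\<dots> \<le> \<delta> * (\<bar>1 / f z\<bar> * lip_const f)"
        using insert.prems(2) by (intro mult_left_mono lip_const_cmult_le fL)
      finally have "\<bar>1 / f z * L f - c\<bar> \<le> \<delta> * (\<bar>1 / f z\<bar> * lip_const f)"
        unfolding linear_on_LipD(2)[OF lin fL] .
      then have "\<bar>f z\<bar> * \<bar>1 / f z * L f - c\<bar> \<le> \<bar>f z\<bar> * (\<delta> * (\<bar>1 / f z\<bar> * lip_const f))"
        by (intro mult_left_mono) auto
      moreover have "\<bar>f z\<bar> * (\<delta> * (\<bar>1 / f z\<bar> * lip_const f)) = \<delta> * lip_const f"
        using False by (simp add: abs_divide)
      moreover have "\<bar>f z\<bar> * \<bar>1 / f z * L f - c\<bar> = \<bar>L f - c * f z\<bar>"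
        using False unfolding abs_mult[symmetric] by (simp add: algebra_simps)
      ultimately show ?thesis by simp
    qed
    then show ?thesis by blast
  qed
  then obtain c where c: "\<And>f. f \<in> V \<Longrightarrow> \<bar>L f - c * f z\<bar> \<le> \<delta> * lip_const f" by blast
  \<comment> \<open>After removal of the point z the tolerance on functions vanishing on F is still
    \<delta>, so the error does not grow with the number of points.\<close>
  have "\<exists>a. \<forall>f\<in>Lip. \<bar>(L f - c * f z) - (\<Sum>x\<in>F. a x * f x)\<bar> \<le> \<delta> * lip_const f"
  proof (rule insert.IH)
    show "linear_on_Lip (\<lambda>f. L f - c * f z)"
      using lin by (simp add: linear_on_Lip_def algebra_simps)
  qed (use c insert.prems(2) in \<open>auto simp: V_def\<close>)
  then obtain a where a: "\<And>f. f \<in> Lip \<Longrightarrow> \<bar>(L f - c * f z) - (\<Sum>x\<in>F. a x * f x)\<bar> \<le> \<delta> * lip_const f" by blast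
  have "(\<Sum>x\<in>insert z F. (a(z := c)) x * f x) = c * f z + (\<Sum>x\<in>F. a x * f x)" for f
  proof -
    have "(\<Sum>x\<in>F. (a(z := c)) x * f x) = (\<Sum>x\<in>F. a x * f x)"
      using insert.hyps by (intro sum.cong) auto
    then show ?thesis using insert.hyps by simp
  qed
  then show ?case using a by (intro exI[of _ "a(z := c)"]) (simp add: algebra_simps)
qed

section \<open>Finite-dimensional Hahn-Banach theorem and duality for transport costs\<close>

definition sublinear :: "(('i \<Rightarrow> real) \<Rightarrow> real) \<Rightarrow> bool"
  where "sublinear p \<longleftrightarrow> (\<forall>u v. p (\<lambda>i. u i + v i) \<le> p u + p v) \<and> (\<forall>t\<ge>0. \<forall>v. p (\<lambda>i. t * v i) = t * p v)"

lemma sublinearD: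
  assumes "sublinear p"
  shows "p (\<lambda>i. u i + v i) \<le> p u + p v" "t \<ge> 0 \<Longrightarrow> p (\<lambda>i. t * v i) = t * p v" "p (\<lambda>_. 0) = 0"
    "0 \<le> p v + p (\<lambda>i. - v i)"
proof -
  show *: "p (\<lambda>i. u i + v i) \<le> p u + p v" for u v using assms by (simp add: sublinear_def)
  show **: "t \<ge> 0 \<Longrightarrow> p (\<lambda>i. t * v i) = t * p v" for t v using assms by (simp add: sublinear_def)
  show z: "p (\<lambda>_. 0) = 0" using **[of 0] by simp
  show "0 \<le> p v + p (\<lambda>i. - v i)" using *[of v "\<lambda>i. - v i"] z by simp
qed

text \<open>The infimum of p (v + t e) - t p e over t \<ge> 0 is the classical way to shrink a
  sublinear functional until it is linear along e; t = 1 at v = - e gives the oddness.\<close>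

lemma sublinear_make_odd:
  assumes p: "sublinear p"
  obtains q where "sublinear q" "\<And>v. q v \<le> p v" "q (\<lambda>i. - e i) = - q e"
proof -
  note pD = sublinearD[OF p]
  define S where "S v = (\<lambda>t. p (\<lambda>i. v i + t * e i) - t * p e) ` {0..}" for v
  define q where "q v = Inf (S v)" for v
  have low: "- p (\<lambda>i. - v i) \<le> p (\<lambda>i. v i + t * e i) - t * p e" if "t \<ge> 0" for v t
    using pD(1)[of "\<lambda>i. v i + t * e i" "\<lambda>i. - v i"] pD(2)[OF that, of e] by simp
  have bdd: "bdd_below (S v)" for v
    using low[of _ v] by (intro bdd_belowI[of _ "- p (\<lambda>i. - v i)"]) (auto simp: S_def)
  have ne: "S v \<noteq> {}" for v by (auto simp: S_def)
  have le: "q v \<le> p (\<lambda>i. v i + t * e i) - t * p e" if "t \<ge> 0" for v t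
    unfolding q_def by (rule cInf_lower[OF _ bdd]) (use that in \<open>auto simp: S_def\<close>)
  have ge: "a \<le> q v" if "\<And>t. t \<ge> 0 \<Longrightarrow> a \<le> p (\<lambda>i. v i + t * e i) - t * p e" for a v
    unfolding q_def by (rule cInf_greatest[OF ne]) (use that in \<open>auto simp: S_def\<close>)
  have qp: "q v \<le> p v" for v using le[of 0 v] by simp
  have add: "q (\<lambda>i. u i + v i) \<le> q u + q v" for u v
  proof -
    have "q (\<lambda>i. u i + v i) - (p (\<lambda>i. u i + s * e i) - s * p e) \<le> q v" if s: "s \<ge> 0" for s
    proof (rule ge)
      fix t :: real assume t: "t \<ge> 0"
      have "q (\<lambda>i. u i + v i) \<le> p (\<lambda>i. (u i + v i) + (s + t) * e i) - (s + t) * p e"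
        using s t by (intro le) auto
      also have "(\<lambda>i. (u i + v i) + (s + t) * e i) = (\<lambda>i. (u i + s * e i) + (v i + t * e i))"
        by (simp add: algebra_simps)
      also have "p (\<lambda>i. (u i + s * e i) + (v i + t * e i)) \<le> p (\<lambda>i. u i + s * e i) + p (\<lambda>i. v i + t * e i)"
        by (rule pD(1))
      finally show "q (\<lambda>i. u i + v i) - (p (\<lambda>i. u i + s * e i) - s * p e) \<le> p (\<lambda>i. v i + t * e i) - t * p e"
        by (simp add: algebra_simps)
    qed
    then have "q (\<lambda>i. u i + v i) - q v \<le> q u" by (intro ge) (simp add: algebra_simps)
    then show ?thesis by simp
  qed
  have scale: "t * q v \<le> q (\<lambda>i. t * v i)" if t: "t > 0" for t v
  proof (rule ge)
    fix s :: real assume s: "s \<ge> 0"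
    have "t * q v \<le> t * (p (\<lambda>i. v i + (s / t) * e i) - (s / t) * p e)"
      using s t by (intro mult_left_mono le) auto
    also have "\<dots> = p (\<lambda>i. t * (v i + (s / t) * e i)) - s * p e"
      using t by (subst pD(2)) (auto simp: algebra_simps)
    also have "(\<lambda>i. t * (v i + (s / t) * e i)) = (\<lambda>i. t * v i + s * e i)"
      using t by (simp add: algebra_simps)
    finally show "t * q v \<le> p (\<lambda>i. t * v i + s * e i) - s * p e" .
  qed
  have q0: "q (\<lambda>_. 0) = 0"
    using low[of _ "\<lambda>_. 0"] pD(3) by (intro antisym ge order_trans[OF qp]) auto
  have sub: "sublinear q"
    unfolding sublinear_def
  proof (intro conjI allI impI add)
    fix t :: real and v assume "0 \<le> t"
    show "q (\<lambda>i. t * v i) = t * q v"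
    proof (cases "t = 0")
      case False
      then have t: "t > 0" using \<open>0 \<le> t\<close> by simp
      have "1 / t * q (\<lambda>i. t * v i) \<le> q (\<lambda>i. 1 / t * (t * v i))" using t by (intro scale) simp
      then have "q (\<lambda>i. t * v i) \<le> t * q v" using t by (simp add: field_simps)
      then show ?thesis using scale[OF t, of v] by simp
    qed (simp add: q0)
  qed
  have "q (\<lambda>i. - e i) \<le> - p e" using le[of 1 "\<lambda>i. - e i"] pD(3) by simp
  then have "q (\<lambda>i. - e i) = - q e" using qp[of e] sublinearD(4)[OF sub, of e] by simp
  then show ?thesis using sub qp that by blast
qed

text \<open>The functional is made odd along one coordinate vector after another. The final values
  at these vectors are the coefficients b.\<close>

lemma sublinear_dominates_linear:
  assumes I: "finite I" and p: "sublinear p"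
  obtains b :: "'i \<Rightarrow> real" where "\<And>v. (\<And>i. i \<notin> I \<Longrightarrow> v i = 0) \<Longrightarrow> (\<Sum>i\<in>I. b i * v i) \<le> p v"
proof -
  let ?e = "\<lambda>i j. if j = i then 1 else 0 :: real"
  have "\<exists>q. sublinear q \<and> (\<forall>v. q v \<le> p v) \<and> (\<forall>i\<in>I. q (\<lambda>j. - ?e i j) = - q (?e i))"
    using I
  proof induction
    case empty
    then show ?case using p by auto
  next
    case (insert k I)
    then obtain q where q: "sublinear q" "\<And>v. q v \<le> p v" "\<And>i. i \<in> I \<Longrightarrow> q (\<lambda>j. - ?e i j) = - q (?e i)" by blast
    obtain r where r: "sublinear r" "\<And>v. r v \<le> q v" "r (\<lambda>j. - ?e k j) = - r (?e k)"
      by (rule sublinear_make_odd[OF q(1), of "?e k"]) blast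
    \<comment> \<open>Oddness gained earlier survives: below a functional that is odd along a
      vector, a sublinear one has no room, because its values at the vector and at its negative have
      nonnegative sum.\<close>
    have "r (\<lambda>j. - ?e i j) = - r (?e i)" if "i \<in> I" for i
      using sublinearD(4)[OF r(1), of "?e i"] r(2)[of "?e i"] r(2)[of "\<lambda>j. - ?e i j"] q(3)[OF that] by linarith
    then show ?case using r q(2) by (intro exI[of _ r]) (auto intro: order_trans)
  qed
  then obtain q where q: "sublinear q" "\<And>v. q v \<le> p v" "\<And>i. i \<in> I \<Longrightarrow> q (\<lambda>j. - ?e i j) = - q (?e i)" by blast
  define b where "b i = q (?e i)" for i
  have qe: "q (\<lambda>j. t * ?e i j) = t * b i" if "i \<in> I" for t i
  proof (cases "t \<ge> 0")
    case True
    then show ?thesis using sublinearD(2)[OF q(1), of t "?e i"] by (simp add: b_def)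
  next
    case False
    have "(\<lambda>j. t * ?e i j) = (\<lambda>j. (- t) * (- ?e i j))" by auto
    then have "q (\<lambda>j. t * ?e i j) = - t * q (\<lambda>j. - ?e i j)"
      using sublinearD(2)[OF q(1), of "- t" "\<lambda>j. - ?e i j"] False by simp
    then show ?thesis using q(3)[OF that] by (simp add: b_def)
  qed
  have up: "q (\<lambda>j. \<Sum>i\<in>J. v i * ?e i j) \<le> (\<Sum>i\<in>J. v i * b i)" if "J \<subseteq> I" for J v
    using finite_subset[OF that I] that
  proof induction
    case empty
    then show ?case using sublinearD(3)[OF q(1)] by simp
  next
    case (insert k J)
    have "q (\<lambda>j. \<Sum>i\<in>insert k J. v i * ?e i j) = q (\<lambda>j. v k * ?e k j + (\<Sum>i\<in>J. v i * ?e i j))"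
      by (simp add: insert.hyps)
    also have "\<dots> \<le> q (\<lambda>j. v k * ?e k j) + q (\<lambda>j. \<Sum>i\<in>J. v i * ?e i j)" by (rule sublinearD(1)[OF q(1)])
    also have "\<dots> \<le> v k * b k + (\<Sum>i\<in>J. v i * b i)" using insert qe[of k "v k"] by simp
    finally show ?case using insert.hyps by simp
  qed
  have "(\<Sum>i\<in>I. b i * v i) \<le> p v" if v: "\<And>i. i \<notin> I \<Longrightarrow> v i = 0" for v
  proof -
    have "(\<lambda>j. \<Sum>i\<in>I. - v i * ?e i j) = (\<lambda>j. - v j)"
    proof
      fix j
      have "(\<Sum>i\<in>I. - v i * ?e i j) = (\<Sum>i\<in>I. if j = i then - v i else 0)" by (intro sum.cong) auto
      also have "\<dots> = - v j" using I v[of j] by (auto simp: sum.delta)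
      finally show "(\<Sum>i\<in>I. - v i * ?e i j) = - v j" .
    qed
    \<comment> \<open>Subadditivity only bounds q from above by the linear form, so it is applied to
      - v; since q (- v) + q v \<ge> 0, this becomes the lower bound for q v.\<close>
    then have "q (\<lambda>j. - v j) \<le> (\<Sum>i\<in>I. - v i * b i)" using up[OF order_refl, of "\<lambda>i. - v i"] by simp
    then have "(\<Sum>i\<in>I. b i * v i) \<le> - q (\<lambda>j. - v j)" by (simp add: sum_negf mult.commute)
    also have "\<dots> \<le> q v" using sublinearD(4)[OF q(1), of v] by simp
    also have "\<dots> \<le> p v" by (rule q(2))
    finally show ?thesis .
  qed
  then show ?thesis by (rule that)
qed

text \<open>Linear programming duality in Hahn-Banach form. The functional q is sublinear in
  perturbations v of the increments; a linear form below q provides the coefficients b, and two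
  choices of v yield the representation of L and the bound on the cost.\<close>

lemma finite_duality:
  fixes L :: "('a::metric_space \<Rightarrow> real) \<Rightarrow> real"
  assumes I: "finite I" "\<And>x y. (x, y) \<in> I \<Longrightarrow> x \<noteq> y" and lin: "linear_on_Lip L" and N: "N \<ge> 0"
    and bnd: "\<And>f s. f \<in> Lip \<Longrightarrow> s \<ge> 0 \<Longrightarrow> (\<And>x y. (x, y) \<in> I \<Longrightarrow> \<bar>f y - f x\<bar> \<le> s * dist x y) \<Longrightarrow> \<bar>L f\<bar> \<le> N * s"
  obtains b where "\<And>f. f \<in> Lip \<Longrightarrow> L f = (\<Sum>k\<in>I. b k * (f (snd k) - f (fst k)))"
    "(\<Sum>k\<in>I. \<bar>b k\<bar> * dist (fst k) (snd k)) \<le> N"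
proof -
  let ?g = "\<lambda>(f :: 'a \<Rightarrow> real) k. f (snd k) - f (fst k)"
  let ?d = "\<lambda>k :: 'a \<times> 'a. dist (fst k) (snd k)"
  have d: "?d k > 0" if "k \<in> I" for k using I(2)[of "fst k" "snd k"] that by simp
  define R where "R v f s \<longleftrightarrow> f \<in> Lip \<and> s \<ge> 0 \<and> (\<forall>k\<in>I. \<bar>v k + ?g f k\<bar> \<le> s * ?d k)" for v :: "'a \<times> 'a \<Rightarrow> real" and f s
  \<comment> \<open>Here s measures, relative to the distances, how far the increments of f are from
    - v; it is charged with N s, and L f is subtracted.\<close>
  define S where "S v = {N * s - L f |f s. R v f s}" for v
  define q where "q v = Inf (S v)" for v
  \<comment> \<open>A crude size of v relative to the distances. It makes f = 0 with s = w v
    admissible and yields the lower bound that keeps the infimum finite.\<close>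
  define w where "w v = (\<Sum>k\<in>I. \<bar>v k\<bar> / ?d k)" for v
  have w: "\<bar>v k\<bar> \<le> w v * ?d k" if "k \<in> I" for v k
  proof -
    have "\<bar>v k\<bar> / ?d k \<le> w v" unfolding w_def
      using I(1) that by (intro member_le_sum) auto
    then show ?thesis using d[OF that] by (simp add: pos_divide_le_eq)
  qed
  have w0: "w v \<ge> 0" for v unfolding w_def by (intro sum_nonneg) auto
  have low: "- (N * w v) \<le> N * s - L f" if R: "R v f s" for v f s
  proof -
    have "\<bar>L f\<bar> \<le> N * (s + w v)"
    proof (rule bnd)
      fix x y assume xy: "(x, y) \<in> I"
      have "\<bar>v (x, y) + (f y - f x)\<bar> \<le> s * dist x y" using R xy by (force simp: R_def)
      then show "\<bar>f y - f x\<bar> \<le> (s + w v) * dist x y"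
        using w[OF xy, of v] by (simp add: algebra_simps)
    qed (use R w0[of v] in \<open>auto simp: R_def\<close>)
    then show ?thesis by (simp add: algebra_simps)
  qed
  have bdd: "bdd_below (S v)" for v
    using low[of v] by (intro bdd_belowI[of _ "- (N * w v)"]) (auto simp: S_def)
  have "R v (\<lambda>_. 0) (w v)" for v using w w0 by (simp add: R_def)
  then have ne: "S v \<noteq> {}" for v by (auto simp: S_def)
  have le: "q v \<le> N * s - L f" if "R v f s" for v f s
    unfolding q_def by (rule cInf_lower[OF _ bdd]) (use that in \<open>auto simp: S_def\<close>)
  have ge: "a \<le> q v" if "\<And>f s. R v f s \<Longrightarrow> a \<le> N * s - L f" for a v
    unfolding q_def by (rule cInf_greatest[OF ne]) (use that in \<open>auto simp: S_def\<close>)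
  have scale: "t * q v \<le> q (\<lambda>i. t * v i)" if t: "t > 0" for t v
  proof (rule ge)
    fix f s assume R: "R (\<lambda>i. t * v i) f s"
    then have f: "f \<in> Lip" and s: "s \<ge> 0" by (auto simp: R_def)
    have "R v (\<lambda>x. 1 / t * f x) (s / t)"
      unfolding R_def
    proof (intro conjI ballI Lip_cmult[OF f])
      fix k assume "k \<in> I"
      then have "\<bar>t * v k + ?g f k\<bar> \<le> s * ?d k" using R by (simp add: R_def)
      then have "1 / t * \<bar>t * v k + ?g f k\<bar> \<le> 1 / t * (s * ?d k)" using t by (intro mult_left_mono) auto
      moreover have "1 / t * \<bar>t * v k + ?g f k\<bar> = \<bar>v k + ?g (\<lambda>x. 1 / t * f x) k\<bar>"
        using t by (simp add: abs_if field_simps)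
      ultimately show "\<bar>v k + ?g (\<lambda>x. 1 / t * f x) k\<bar> \<le> s / t * ?d k" by simp
    qed (use s t in auto)
    from le[OF this] have "t * q v \<le> t * (N * (s / t) - 1 / t * L f)"
      using t linear_on_LipD(2)[OF lin f, of "1 / t"] by simp
    also have "\<dots> = N * s - L f" using t by (simp add: right_diff_distrib)
    finally show "t * q v \<le> N * s - L f" .
  qed
  have L0: "L (\<lambda>_. 0) = 0" using linear_on_LipD(2)[OF lin Lip_const[of 0], of 0] by simp
  have q0: "q (\<lambda>_. 0) = 0"
  proof (rule antisym)
    show "q (\<lambda>_. 0) \<le> 0" using le[of "\<lambda>_. 0" "\<lambda>_. 0" 0] L0 by (simp add: R_def)
    have "w (\<lambda>_. 0) = 0" by (simp add: w_def)
    then show "0 \<le> q (\<lambda>_. 0)" using low[of "\<lambda>_. 0"] by (intro ge) simp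
  qed
  have "sublinear q"
    unfolding sublinear_def
  proof (intro conjI allI impI)
    fix u v
    have "q (\<lambda>i. u i + v i) - (N * s - L f) \<le> q v" if R: "R u f s" for f s
    proof (rule ge)
      fix g t assume R': "R v g t"
      have fg: "f \<in> Lip" "g \<in> Lip" using R R' by (auto simp: R_def)
      have "R (\<lambda>i. u i + v i) (\<lambda>x. 1 * f x + 1 * g x) (s + t)"
        unfolding R_def
      proof (intro conjI ballI Lip_lincomb[OF fg])
        fix k assume k: "k \<in> I"
        have "\<bar>u k + ?g f k\<bar> \<le> s * ?d k" "\<bar>v k + ?g g k\<bar> \<le> t * ?d k" using R R' k by (auto simp: R_def)
        then show "\<bar>u k + v k + ?g (\<lambda>x. 1 * f x + 1 * g x) k\<bar> \<le> (s + t) * ?d k"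
          unfolding distrib_right by linarith
      qed (use R R' in \<open>auto simp: R_def\<close>)
      from le[OF this] show "q (\<lambda>i. u i + v i) - (N * s - L f) \<le> N * t - L g"
        using linear_on_LipD(1)[OF lin fg, of 1 1] by (simp add: algebra_simps)
    qed
    then have "q (\<lambda>i. u i + v i) - q v \<le> q u" by (intro ge) (simp add: algebra_simps)
    then show "q (\<lambda>i. u i + v i) \<le> q u + q v" by simp
  next
    fix t :: real and v assume "0 \<le> t"
    show "q (\<lambda>i. t * v i) = t * q v"
    proof (cases "t = 0")
      case False
      then have t: "t > 0" using \<open>0 \<le> t\<close> by simp
      have "1 / t * q (\<lambda>i. t * v i) \<le> q (\<lambda>i. 1 / t * (t * v i))" using t by (intro scale) simp
      then have "q (\<lambda>i. t * v i) \<le> t * q v" using t by (simp add: field_simps)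
      then show ?thesis using scale[OF t, of v] by simp
    qed (simp add: q0)
  qed
  then obtain b where b: "\<And>v. (\<And>i. i \<notin> I \<Longrightarrow> v i = 0) \<Longrightarrow> (\<Sum>i\<in>I. b i * v i) \<le> q v"
    using sublinear_dominates_linear[OF I(1)] by blast
  show ?thesis
  proof (rule that)
    have half: "L f \<le> (\<Sum>k\<in>I. b k * ?g f k)" if f: "f \<in> Lip" for f
    proof -
      \<comment> \<open>For this v the function f is admissible with s = 0, so domination by q reads
        as an upper bound for L f; the reverse inequality comes from - f.\<close>
      let ?v = "\<lambda>k. if k \<in> I then - ?g f k else 0"
      have "(\<Sum>k\<in>I. b k * ?v k) \<le> q ?v" by (rule b) simp
      also have "\<dots> \<le> N * 0 - L f" by (rule le) (use f in \<open>auto simp: R_def\<close>)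
      also have "(\<Sum>k\<in>I. b k * ?v k) = - (\<Sum>k\<in>I. b k * ?g f k)"
        unfolding sum_negf[symmetric] by (intro sum.cong) (auto simp: algebra_simps)
      finally show ?thesis by simp
    qed
    show "L f = (\<Sum>k\<in>I. b k * ?g f k)" if f: "f \<in> Lip" for f
    proof (rule antisym[OF half[OF f]])
      have "L (\<lambda>x. - 1 * f x) \<le> (\<Sum>k\<in>I. b k * ?g (\<lambda>x. - 1 * f x) k)"
        by (rule half[OF Lip_cmult[OF f]])
      also have "\<dots> = - (\<Sum>k\<in>I. b k * ?g f k)"
        unfolding sum_negf[symmetric] by (intro sum.cong) (auto simp: algebra_simps)
      finally show "(\<Sum>k\<in>I. b k * ?g f k) \<le> L f"
        using linear_on_LipD(2)[OF lin f, of "- 1"] by simp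
    qed
    \<comment> \<open>Now f = 0 is admissible with s = 1, and the signs turn the linear form into
      the total cost.\<close>
    let ?v = "\<lambda>k. if k \<in> I then sgn (b k) * ?d k else 0"
    have "(\<Sum>k\<in>I. \<bar>b k\<bar> * ?d k) = (\<Sum>k\<in>I. b k * ?v k)"
      by (intro sum.cong) (auto simp: abs_sgn)
    also have "\<dots> \<le> q ?v" by (rule b) simp
    also have "\<dots> \<le> N * 1 - L (\<lambda>_. 0)"
      by (rule le) (auto simp: R_def abs_mult abs_sgn_eq)
    finally show "(\<Sum>k\<in>I. \<bar>b k\<bar> * ?d k) \<le> N" using L0 by simp
  qed
qed

text \<open>The largest extension with constant s is the minimum of the cones f x + s d(z, x); F is
  finite, so the minimum exists.\<close>

lemma McShane_extension:
  fixes f :: "'a::metric_space \<Rightarrow> real"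
  assumes F: "finite F" "F \<noteq> {}" and s: "s \<ge> 0" and f: "\<And>x y. x \<in> F \<Longrightarrow> y \<in> F \<Longrightarrow> \<bar>f y - f x\<bar> \<le> s * dist x y"
  obtains h where "s-lipschitz_on UNIV h" "\<And>x. x \<in> F \<Longrightarrow> h x = f x"
proof -
  define h where "h z = Min ((\<lambda>x. f x + s * dist z x) ` F)" for z
  have le: "h z \<le> f x + s * dist z x" if "x \<in> F" for x z
    unfolding h_def using F that by (intro Min_le) auto
  have ex: "\<exists>x\<in>F. h z = f x + s * dist z x" for z
  proof -
    have "h z \<in> (\<lambda>x. f x + s * dist z x) ` F" unfolding h_def using F by (intro Min_in) auto
    then show ?thesis by auto
  qed
  have half: "h z - h z' \<le> s * dist z z'" for z z'
  proof -
    obtain x where x: "x \<in> F" "h z' = f x + s * dist z' x" using ex by blast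
    have "h z \<le> f x + s * dist z x" by (rule le[OF x(1)])
    also have "s * dist z x \<le> s * (dist z z' + dist z' x)" using s by (intro mult_left_mono dist_triangle)
    finally show ?thesis using x by (simp add: algebra_simps)
  qed
  have "s-lipschitz_on UNIV h"
  proof (rule lipschitz_onI)
    show "dist (h x) (h y) \<le> s * dist x y" for x y
      using half[of x y] half[of y x] by (simp add: dist_real_def abs_le_iff dist_commute)
  qed (rule s)
  moreover have "h x = f x" if x: "x \<in> F" for x
  proof (rule antisym)
    show "h x \<le> f x" using le[OF x, of x] by simp
    obtain y where y: "y \<in> F" "h x = f y + s * dist x y" using ex by blast
    show "f x \<le> h x" using f[OF x y(1)] y(2) by (simp add: abs_le_iff)
  qed
  ultimately show ?thesis by (rule that)
qed

text \<open>The combination m of point masses is within \<delta> of L, so its norm is at most M +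
  \<delta>, and duality rewrites it as differences along pairs of points of F at this cost.\<close>

lemma kr_functional_molecule_approximation:
  fixes L :: "('a::metric_space \<Rightarrow> real) \<Rightarrow> real"
  assumes sep: "separable_space (euclidean :: 'a topology)" and L: "kr_functional L M" and \<delta>: "\<delta> > 0"
  obtains I :: "('a \<times> 'a) set" and b where "finite I"
    "\<And>f. f \<in> Lip \<Longrightarrow> \<bar>L f - (\<Sum>k\<in>I. b k * (f (snd k) - f (fst k)))\<bar> \<le> \<delta> * lip_const f"
    "(\<Sum>k\<in>I. \<bar>b k\<bar> * dist (fst k) (snd k)) \<le> M + \<delta>"
proof -
  have lin: "linear_on_Lip L" and bnd: "\<And>f. f \<in> Lip \<Longrightarrow> \<bar>L f\<bar> \<le> M * lip_const f" and M: "M \<ge> 0"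
    using L by (auto simp: kr_functional_def)
  obtain F where F: "finite F" "\<And>f. f \<in> Lip \<Longrightarrow> (\<And>x. x \<in> F \<Longrightarrow> f x = 0) \<Longrightarrow> \<bar>L f\<bar> \<le> \<delta> * lip_const f"
    using kr_functional_small_off_finite[OF sep L \<delta>] by metis
  obtain a where a: "\<And>f. f \<in> Lip \<Longrightarrow> \<bar>L f - (\<Sum>x\<in>F. a x * f x)\<bar> \<le> \<delta> * lip_const f"
    using finite_support_approximation[OF F(1) lin less_imp_le[OF \<delta>] F(2)] by blast
  define m where "m f = (\<Sum>x\<in>F. a x * f x)" for f
  have mlin: "linear_on_Lip m"
    by (simp add: linear_on_Lip_def m_def algebra_simps sum.distrib sum_distrib_left)
  have mb: "\<bar>m f\<bar> \<le> (M + \<delta>) * lip_const f" if "f \<in> Lip" for f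
    using bnd[OF that] a[OF that] by (simp add: m_def algebra_simps)
  define I where "I = {(x, y) \<in> F \<times> F. x \<noteq> y}"
  have I: "finite I" unfolding I_def by (rule finite_subset[of _ "F \<times> F"]) (use F in auto)
  \<comment> \<open>m sees f on F only, so f may be exchanged for a McShane extension whose global
    Lipschitz constant is at most the bound s observed between points of F.\<close>
  have "\<bar>m f\<bar> \<le> (M + \<delta>) * s" if f: "f \<in> Lip" "s \<ge> 0" "\<And>x y. (x, y) \<in> I \<Longrightarrow> \<bar>f y - f x\<bar> \<le> s * dist x y" for f s
  proof (cases "F = {}")
    case True
    then show ?thesis using M \<delta> f(2) by (simp add: m_def)
  next
    case False
    have "\<bar>f y - f x\<bar> \<le> s * dist x y" if "x \<in> F" "y \<in> F" for x y
      using f(3)[of x y] that by (cases "x = y") (auto simp: I_def)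
    then obtain h where h: "s-lipschitz_on UNIV h" "\<And>x. x \<in> F \<Longrightarrow> h x = f x"
      using McShane_extension[OF F(1) False f(2)] by blast
    have "\<bar>m f\<bar> = \<bar>m h\<bar>" using h(2) by (simp add: m_def)
    also have "\<dots> \<le> (M + \<delta>) * lip_const h" by (rule mb[OF LipI[OF h(1)]])
    also have "\<dots> \<le> (M + \<delta>) * s" using M \<delta> by (intro mult_left_mono lip_const_le[OF h(1)]) auto
    finally show ?thesis .
  qed
  then obtain b where b: "\<And>f. f \<in> Lip \<Longrightarrow> m f = (\<Sum>k\<in>I. b k * (f (snd k) - f (fst k)))"
    "(\<Sum>k\<in>I. \<bar>b k\<bar> * dist (fst k) (snd k)) \<le> M + \<delta>"
    using finite_duality[OF I _ mlin, of "M + \<delta>"] M \<delta> by (auto simp: I_def)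
  show ?thesis by (rule that[OF I _ b(2)]) (use a b(1) in \<open>simp add: m_def\<close>)
qed

section \<open>Series of curves\<close>

text \<open>With lists, concatenation is addition, and the partial sums of a series of such
  combinations are again single lists.\<close>

type_synonym 'a weighted_curves = "(real \<times> (real \<Rightarrow> 'a)) list"

definition curves_current :: "'a::metric_space weighted_curves \<Rightarrow> 'a functional"
  where "curves_current ws f \<pi> = (\<Sum>(a, \<sigma>)\<leftarrow>ws. a * curve_current \<sigma> f \<pi>)"

definition curves_boundary :: "'a::metric_space weighted_curves \<Rightarrow> ('a \<Rightarrow> real) \<Rightarrow> real"
  where "curves_boundary ws f = (\<Sum>(a, \<sigma>)\<leftarrow>ws. a * (f (\<sigma> 1) - f (\<sigma> 0)))"

definition curves_weight :: "'a::metric_space weighted_curves \<Rightarrow> real"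
  where "curves_weight ws = (\<Sum>(a, \<sigma>)\<leftarrow>ws. \<bar>a\<bar> * curve_length \<sigma>)"

lemma curves_simps [simp]:
  "curves_current [] f \<pi> = 0" "curves_current ((a, \<sigma>) # ws) f \<pi> = a * curve_current \<sigma> f \<pi> + curves_current ws f \<pi>"
  "curves_current (ws @ ws') f \<pi> = curves_current ws f \<pi> + curves_current ws' f \<pi>"
  "curves_boundary [] f = 0" "curves_boundary ((a, \<sigma>) # ws) f = a * (f (\<sigma> 1) - f (\<sigma> 0)) + curves_boundary ws f"
  "curves_boundary (ws @ ws') f = curves_boundary ws f + curves_boundary ws' f"
  "curves_weight [] = 0" "curves_weight ((a, \<sigma>) # ws) = \<bar>a\<bar> * curve_length \<sigma> + curves_weight ws"
  "curves_weight (ws @ ws') = curves_weight ws + curves_weight ws'"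
  by (simp_all add: curves_current_def curves_boundary_def curves_weight_def)

lemma Lip_1_curvesD: "\<theta> \<in> Lip_1_curves \<Longrightarrow> 1-lipschitz_on {0..1} \<theta>"
  by (simp add: Lip_1_curves_def)

lemma current_mass_le_zero: "current_mass_le (\<lambda>f \<pi>. 0 :: real) 0"
proof -
  \<comment> \<open>Zero is obtained as 0 times the current of a constant curve, which is already
    known to satisfy the axioms.\<close>
  have "1-lipschitz_on {0..1} (\<lambda>_ :: real. undefined :: 'a)"
    by (rule lipschitz_onI) auto
  from current_mass_le_cmult[OF current_mass_le_curve[OF this], of 0]
  show "current_mass_le (\<lambda>(f :: 'a \<Rightarrow> real) (\<pi> :: 'a \<Rightarrow> real). 0 :: real) 0" by simp
qed

lemma current_mass_le_curves:
  assumes "snd ` set ws \<subseteq> Lip_1_curves"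
  shows "current_mass_le (curves_current ws) (curves_weight ws)"
  using assms
proof (induction ws)
  case Nil
  have "current_mass_le (curves_current []) 0" by (rule current_mass_le_cong[OF current_mass_le_zero]) simp
  then show ?case by (simp only: curves_simps(7))
next
  case (Cons w ws)
  obtain a \<sigma> where w: "w = (a, \<sigma>)" by fastforce
  then have \<sigma>: "1-lipschitz_on {0..1} \<sigma>" using Cons.prems Lip_1_curvesD by auto
  have IH: "current_mass_le (curves_current ws) (curves_weight ws)" using Cons by auto
  show ?case
    using current_mass_le_cong[OF current_mass_le_add[OF current_mass_le_cmult[OF current_mass_le_curve[OF \<sigma>], of a] IH]]
    by (simp add: w)
qed

lemma curves_weight_nonneg: "snd ` set ws \<subseteq> Lip_1_curves \<Longrightarrow> 0 \<le> curves_weight ws"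
  using current_mass_le_mass(3)[OF current_mass_le_curves] .

lemma boundary_curves_current:
  assumes "snd ` set ws \<subseteq> Lip_1_curves" "\<pi> \<in> Lip"
  shows "boundary (curves_current ws) \<pi> = curves_boundary ws \<pi>"
  using assms(1)
proof (induction ws)
  case (Cons w ws)
  obtain a \<sigma> where w: "w = (a, \<sigma>)" by fastforce
  then have "1-lipschitz_on {0..1} \<sigma>" using Cons.prems Lip_1_curvesD by auto
  from boundary_curve_current[OF this assms(2)] show ?case using Cons by (simp add: w boundary_def)
qed (simp add: boundary_def)

text \<open>A weighted curve contributes |a| times the point masses at its two ends; these measures
  witness normality.\<close>

lemma curves_boundary_measure:
  fixes ws :: "'a::metric_space weighted_curves"
  shows "\<exists>\<nu>. finite_borel_measure \<nu> \<and> (\<forall>f\<in>Lip_b. \<bar>curves_boundary ws f\<bar> \<le> (LINT x|\<nu>. \<bar>f x\<bar>))"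
proof (induction ws)
  case Nil
  have "finite_borel_measure (null_measure (borel :: 'a measure))"
    by (auto simp: finite_borel_measure_def intro!: finite_measureI)
  then show ?case by (auto intro!: exI[of _ "null_measure borel"])
next
  case (Cons w ws)
  obtain a \<sigma> where w: "w = (a, \<sigma>)" by fastforce
  obtain \<nu> where \<nu>: "finite_borel_measure \<nu>" "\<And>f. f \<in> Lip_b \<Longrightarrow> \<bar>curves_boundary ws f\<bar> \<le> (LINT x|\<nu>. \<bar>f x\<bar>)"
    using Cons by blast
  define pt where "pt x = distr (count_space {()}) borel (\<lambda>_. x)" for x :: 'a
  define pm where "pm x = density (pt x) (\<lambda>_ :: 'a. ennreal \<bar>a\<bar>)" for x :: 'a
  have ret: "finite_borel_measure (pt x)" for x :: 'a
    by (auto simp: pt_def finite_borel_measure_def emeasure_distr intro!: finite_measureI)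
  have pm: "finite_borel_measure (pm x)" for x
    using ret[of x] by (auto simp: pm_def pt_def finite_borel_measure_def emeasure_density nn_integral_distr emeasure_distr
        intro!: finite_measureI)
  have pmi: "(LINT y|pm x. \<bar>f y\<bar>) = \<bar>a\<bar> * \<bar>f x\<bar>" if "f \<in> Lip_b" for f x
  proof -
    have m: "f \<in> borel_measurable borel" using that by (intro Lip_borel_measurable Lip_b_imp_Lip)
    have "(LINT y|pm x. \<bar>f y\<bar>) = (LINT y|pt x. \<bar>a\<bar> * \<bar>f y\<bar>)"
      unfolding pm_def by (rule integral_density_real[OF ret]) (use m in auto)
    also have "\<dots> = \<bar>a\<bar> * \<bar>f x\<bar>" using m unfolding pt_def
      by (subst integral_distr) (auto simp: lebesgue_integral_count_space_finite)
    finally show ?thesis .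
  qed
  \<comment> \<open>The three measures are summed as a series with zero tail, so the countable
    construction can be reused.\<close>
  define \<mu> where "\<mu> n = (if n = 0 then \<nu> else if n = Suc 0 then pm (\<sigma> 1) else if n = 2 then pm (\<sigma> 0) else null_measure borel)" for n :: nat
  have fin: "finite_borel_measure (\<mu> n)" for n
    using \<nu>(1) pm by (auto simp: \<mu>_def finite_borel_measure_def intro!: finite_measureI)
  have sm: "summable (\<lambda>n. measure (\<mu> n) UNIV)"
    by (rule summable_finite[of "{0, Suc 0, 2}"]) (auto simp: \<mu>_def measure_def)
  obtain \<kappa> where \<kappa>: "finite_borel_measure \<kappa>"
    "\<And>f. f \<in> Lip_b \<Longrightarrow> (\<lambda>n. LINT x|\<mu> n. \<bar>f x\<bar>) sums (LINT x|\<kappa>. \<bar>f x\<bar>)"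
    by (rule finite_sum_measure_exists[OF fin sm]) blast
  have "\<bar>curves_boundary (w # ws) f\<bar> \<le> (LINT x|\<kappa>. \<bar>f x\<bar>)" if f: "f \<in> Lip_b" for f
  proof -
    have "(LINT x|\<kappa>. \<bar>f x\<bar>) = (\<Sum>n. LINT x|\<mu> n. \<bar>f x\<bar>)" using \<kappa>(2)[OF f] by (rule sums_unique)
    also have "\<dots> = (\<Sum>n\<in>{0, Suc 0, 2}. LINT x|\<mu> n. \<bar>f x\<bar>)"
      by (rule suminf_finite) (auto simp: \<mu>_def)
    also have "\<dots> = (LINT x|\<nu>. \<bar>f x\<bar>) + (\<bar>a\<bar> * \<bar>f (\<sigma> 1)\<bar> + \<bar>a\<bar> * \<bar>f (\<sigma> 0)\<bar>)"
      using pmi[OF f] by (simp add: \<mu>_def)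
    finally have eq: "(LINT x|\<kappa>. \<bar>f x\<bar>) = (LINT x|\<nu>. \<bar>f x\<bar>) + (\<bar>a\<bar> * \<bar>f (\<sigma> 1)\<bar> + \<bar>a\<bar> * \<bar>f (\<sigma> 0)\<bar>)" .
    have "\<bar>a * (f (\<sigma> 1) - f (\<sigma> 0))\<bar> \<le> \<bar>a\<bar> * (\<bar>f (\<sigma> 1)\<bar> + \<bar>f (\<sigma> 0)\<bar>)"
      unfolding abs_mult by (intro mult_left_mono) auto
    then show ?thesis
      using \<nu>(2)[OF f] eq abs_triangle_ineq[of "a * (f (\<sigma> 1) - f (\<sigma> 0))" "curves_boundary ws f"]
      unfolding w curves_simps distrib_left by linarith
  qed
  then show ?case using \<kappa>(1) by blast
qed

lemma normal_curves_current:
  assumes "snd ` set ws \<subseteq> Lip_1_curves"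
  shows "normal_current (curves_current ws)"
  using curves_boundary_measure[of ws] boundary_curves_current[OF assms Lip_b_imp_Lip]
    current_mass_le_mass(1)[OF current_mass_le_curves[OF assms]]
  by (simp add: normal_current_def)

lemma curves_current_nth:
  "curves_current ws f \<pi> = (\<Sum>i=1..length ws. fst (ws ! (i - 1)) * curve_current (snd (ws ! (i - 1))) f \<pi>)"
proof -
  have "curves_current ws f \<pi> = (\<Sum>i<length ws. fst (ws ! i) * curve_current (snd (ws ! i)) f \<pi>)"
    by (simp add: curves_current_def sum_list_sum_nth split_beta atLeast0LessThan)
  also have "\<dots> = (\<Sum>i=1..length ws. fst (ws ! (i - 1)) * curve_current (snd (ws ! (i - 1))) f \<pi>)"
    by (rule sum.reindex_bij_witness[of _ "\<lambda>i. i - 1" Suc]) auto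
  finally show ?thesis .
qed

lemma curve_combination_curves_current:
  assumes "snd ` set ws \<subseteq> \<Theta>"
  shows "curve_combination \<Theta> (curves_current ws)"
  unfolding curve_combination_def
proof (intro exI conjI ballI)
  show "curves_current ws f \<pi> = (\<Sum>i=1..length ws. fst (ws ! (i - 1)) * curve_current (snd (ws ! (i - 1))) f \<pi>)" for f \<pi>
    by (rule curves_current_nth)
  fix i assume "i \<in> {1..length ws}"
  then have "ws ! (i - 1) \<in> set ws" by (intro nth_mem) auto
  then show "snd (ws ! (i - 1)) \<in> \<Theta>" using assms by blast
qed

lemma curve_combination_mono: "curve_combination \<Theta> P \<Longrightarrow> \<Theta> \<subseteq> \<Theta>' \<Longrightarrow> curve_combination \<Theta>' P"
  unfolding curve_combination_def by blast

definition segments :: "(real \<Rightarrow> 'a::real_normed_vector) set"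
  where "segments = range (\<lambda>(x, y) t. (1 - t) *\<^sub>R x + t *\<^sub>R y)"

lemma polyhedral_curve_combination:
  assumes "curve_combination segments P" shows "polyhedral P"
proof -
  obtain r \<eta> \<theta> where r: "\<And>i. i \<in> {1..r :: nat} \<Longrightarrow> \<theta> i \<in> segments"
    "\<And>f \<pi>. f \<in> Lip_b \<Longrightarrow> \<pi> \<in> Lip \<Longrightarrow> P f \<pi> = (\<Sum>i=1..r. \<eta> i * curve_current (\<theta> i) f \<pi>)"
    using assms unfolding curve_combination_def by blast
  have "\<forall>i\<in>{1..r}. \<exists>x y. \<theta> i = (\<lambda>t. (1 - t) *\<^sub>R x + t *\<^sub>R y)"
    using r(1) by (fastforce simp: segments_def)
  then obtain x y where xy: "\<And>i. i \<in> {1..r} \<Longrightarrow> \<theta> i = (\<lambda>t. (1 - t) *\<^sub>R x i + t *\<^sub>R y i)" by metis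
  have "P f \<pi> = (\<Sum>i=1..r. \<eta> i * segment_current (x i) (y i) f \<pi>)" if "f \<in> Lip_b" "\<pi> \<in> Lip" for f \<pi>
    unfolding r(2)[OF that] segment_current_def using xy by (intro sum.cong) auto
  then show ?thesis unfolding polyhedral_def by blast
qed

text \<open>Points are joined by finitely many curves of \<open>\<Theta>\<close>, up to gaps whose effect on the
  boundary is small in the Kantorovich--Rubinstein norm.\<close>

definition chainable :: "(real \<Rightarrow> 'a::metric_space) set \<Rightarrow> real \<Rightarrow> bool"
  where "chainable \<Theta> c \<longleftrightarrow> (\<forall>x y. \<forall>\<eta>>0. \<exists>\<sigma>s. set \<sigma>s \<subseteq> \<Theta> \<and> (\<Sum>\<sigma>\<leftarrow>\<sigma>s. curve_length \<sigma>) \<le> c * dist x y \<and>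
    (\<forall>f\<in>Lip. \<bar>f y - f x - (\<Sum>\<sigma>\<leftarrow>\<sigma>s. f (\<sigma> 1) - f (\<sigma> 0))\<bar> \<le> \<eta> * lip_const f))"

lemma curves_of_chain:
  "curves_boundary (map (Pair a) \<sigma>s) f = a * (\<Sum>\<sigma>\<leftarrow>\<sigma>s. f (\<sigma> 1) - f (\<sigma> 0))"
  "curves_weight (map (Pair a) \<sigma>s) = \<bar>a\<bar> * (\<Sum>\<sigma>\<leftarrow>\<sigma>s. curve_length \<sigma>)"
  by (induction \<sigma>s) (simp_all add: algebra_simps)

text \<open>Each pair is replaced by a chain with the same gap tolerance \<eta>. Lengths and gap
  errors both scale with |b k|, which gives the factors c and \<eta> in front of the sums.\<close>

lemma chainable_molecule:
  assumes ch: "chainable \<Theta> c" and I: "finite I" and \<eta>: "\<eta> > 0"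
  shows "\<exists>ws. snd ` set ws \<subseteq> \<Theta> \<and> curves_weight ws \<le> c * (\<Sum>k\<in>I. \<bar>b k\<bar> * dist (fst k) (snd k)) \<and>
    (\<forall>f\<in>Lip. \<bar>(\<Sum>k\<in>I. b k * (f (snd k) - f (fst k))) - curves_boundary ws f\<bar> \<le> \<eta> * (\<Sum>k\<in>I. \<bar>b k\<bar>) * lip_const f)"
  using I
proof induction
    case empty
    show ?case by (rule exI[of _ "[]"]) auto
  next
    case (insert k I)
    obtain ws where ws: "snd ` set ws \<subseteq> \<Theta>" "curves_weight ws \<le> c * (\<Sum>k\<in>I. \<bar>b k\<bar> * dist (fst k) (snd k))"
      "\<And>f. f \<in> Lip \<Longrightarrow> \<bar>(\<Sum>k\<in>I. b k * (f (snd k) - f (fst k))) - curves_boundary ws f\<bar> \<le> \<eta> * (\<Sum>k\<in>I. \<bar>b k\<bar>) * lip_const f"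
      using insert.IH by blast
    obtain \<sigma>s where \<sigma>s: "set \<sigma>s \<subseteq> \<Theta>" "(\<Sum>\<sigma>\<leftarrow>\<sigma>s. curve_length \<sigma>) \<le> c * dist (fst k) (snd k)"
      "\<And>f. f \<in> Lip \<Longrightarrow> \<bar>f (snd k) - f (fst k) - (\<Sum>\<sigma>\<leftarrow>\<sigma>s. f (\<sigma> 1) - f (\<sigma> 0))\<bar> \<le> \<eta> * lip_const f"
      using ch[unfolded chainable_def, rule_format, OF \<eta>, of "fst k" "snd k"] by blast
    let ?ws = "map (Pair (b k)) \<sigma>s @ ws"
    have "\<bar>b k\<bar> * (\<Sum>\<sigma>\<leftarrow>\<sigma>s. curve_length \<sigma>) \<le> \<bar>b k\<bar> * (c * dist (fst k) (snd k))"
      using \<sigma>s(2) by (intro mult_left_mono) auto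
    then have 1: "curves_weight ?ws \<le> c * (\<Sum>k\<in>insert k I. \<bar>b k\<bar> * dist (fst k) (snd k))"
      using ws(2) insert.hyps by (simp add: curves_of_chain algebra_simps)
    have 2: "\<bar>(\<Sum>k\<in>insert k I. b k * (f (snd k) - f (fst k))) - curves_boundary ?ws f\<bar>
      \<le> \<eta> * (\<Sum>k\<in>insert k I. \<bar>b k\<bar>) * lip_const f" if f: "f \<in> Lip" for f
    proof -
      let ?A = "f (snd k) - f (fst k) - (\<Sum>\<sigma>\<leftarrow>\<sigma>s. f (\<sigma> 1) - f (\<sigma> 0))"
      let ?B = "(\<Sum>k\<in>I. b k * (f (snd k) - f (fst k))) - curves_boundary ws f"
      have "(\<Sum>k\<in>insert k I. b k * (f (snd k) - f (fst k))) - curves_boundary ?ws f = b k * ?A + ?B"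
        using insert.hyps by (simp add: curves_of_chain algebra_simps)
      also have "\<bar>\<dots>\<bar> \<le> \<bar>b k\<bar> * \<bar>?A\<bar> + \<bar>?B\<bar>"
        using abs_triangle_ineq[of "b k * ?A" ?B] by (simp only: abs_mult)
      also have "\<dots> \<le> \<bar>b k\<bar> * (\<eta> * lip_const f) + \<eta> * (\<Sum>k\<in>I. \<bar>b k\<bar>) * lip_const f"
        using \<sigma>s(3)[OF f] ws(3)[OF f] by (intro add_mono mult_left_mono) auto
      also have "\<dots> = \<eta> * (\<Sum>k\<in>insert k I. \<bar>b k\<bar>) * lip_const f"
        using insert.hyps by (simp add: algebra_simps)
      finally show ?thesis .
    qed
    show ?case
      by (rule exI[of _ ?ws]) (use 1 2 \<sigma>s(1) ws(1) in \<open>auto simp del: curves_simps\<close>)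
qed

section \<open>The iteration on the residual functional\<close>

lemma curves_boundary_linear: "curves_boundary ws (\<lambda>x. a * f x + b * g x) = a * curves_boundary ws f + b * curves_boundary ws g"
proof (induction ws)
  case (Cons w ws)
  obtain e \<sigma> where "w = (e, \<sigma>)" by fastforce
  then show ?case using Cons by (simp add: algebra_simps)
qed simp

lemma curves_boundary_tendsto:
  assumes "\<And>x. (\<lambda>j. \<pi>s j x) \<longlonglongrightarrow> \<pi> x"
  shows "(\<lambda>j. curves_boundary ws (\<pi>s j)) \<longlonglongrightarrow> curves_boundary ws \<pi>"
proof (induction ws)
  case (Cons w ws)
  obtain e \<sigma> where "w = (e, \<sigma>)" by fastforce
  then show ?case using Cons assms by (auto intro!: tendsto_intros)
qed simp

lemma kr_functional_curve_step:
  fixes L :: "('a::metric_space \<Rightarrow> real) \<Rightarrow> real"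
  assumes sep: "separable_space (euclidean :: 'a topology)" and ch: "chainable \<Theta> c" and c: "c \<ge> 0"
    and L: "kr_functional L M" and \<delta>: "\<delta> > 0"
  shows "\<exists>ws. snd ` set ws \<subseteq> \<Theta> \<and> curves_weight ws \<le> c * M + \<delta> \<and> kr_functional (\<lambda>f. L f - curves_boundary ws f) \<delta>"
proof -
  \<comment> \<open>c d \<le> \<delta> pays for the excess length, and d \<le> \<delta> / 2 leaves
    the other half of the error to the gaps.\<close>
  define d where "d = \<delta> / (2 * (c + 1))"
  have d: "d > 0" "c * d \<le> \<delta>" "d \<le> \<delta> / 2" using \<delta> c by (auto simp: d_def field_simps)
  obtain I :: "('a \<times> 'a) set" and b where I: "finite I"
    "\<And>f. f \<in> Lip \<Longrightarrow> \<bar>L f - (\<Sum>k\<in>I. b k * (f (snd k) - f (fst k)))\<bar> \<le> d * lip_const f"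
    "(\<Sum>k\<in>I. \<bar>b k\<bar> * dist (fst k) (snd k)) \<le> M + d"
    by (rule kr_functional_molecule_approximation[OF sep L d(1)]) blast
  define B where "B = (\<Sum>k\<in>I. \<bar>b k\<bar>)"
  have B: "B \<ge> 0" unfolding B_def by (intro sum_nonneg) auto
  \<comment> \<open>The gap tolerance is chosen after the coefficients b are known; B + 1 keeps the
    quotient meaningful if B = 0.\<close>
  define \<eta> where "\<eta> = \<delta> / (2 * (B + 1))"
  have \<eta>: "\<eta> > 0" "\<eta> * B \<le> \<delta> / 2" using \<delta> B by (auto simp: \<eta>_def field_simps)
  obtain ws where ws: "snd ` set ws \<subseteq> \<Theta>" "curves_weight ws \<le> c * (\<Sum>k\<in>I. \<bar>b k\<bar> * dist (fst k) (snd k))"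
    "\<forall>f\<in>Lip. \<bar>(\<Sum>k\<in>I. b k * (f (snd k) - f (fst k))) - curves_boundary ws f\<bar> \<le> \<eta> * B * lip_const f"
    unfolding B_def using chainable_molecule[OF ch I(1) \<eta>(1), of b] by (elim exE conjE)
  have "curves_weight ws \<le> c * (M + d)" using ws(2) mult_left_mono[OF I(3) c] by linarith
  also have "\<dots> \<le> c * M + \<delta>" using d(2) by (simp add: distrib_left)
  finally have w: "curves_weight ws \<le> c * M + \<delta>" .
  have "kr_functional (\<lambda>f. L f - curves_boundary ws f) \<delta>"
    unfolding kr_functional_def
  proof (intro conjI ballI allI impI)
    show "linear_on_Lip (\<lambda>f. L f - curves_boundary ws f)"
      using L by (simp add: kr_functional_def linear_on_Lip_def curves_boundary_linear algebra_simps)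
    fix f :: "'a \<Rightarrow> real" assume f: "f \<in> Lip"
    have "\<bar>L f - curves_boundary ws f\<bar> \<le> d * lip_const f + \<eta> * B * lip_const f"
      using I(2)[OF f] ws(3)[rule_format, OF f] by linarith
    also have "\<dots> = (d + \<eta> * B) * lip_const f" by (simp add: algebra_simps)
    also have "\<dots> \<le> \<delta> * lip_const f"
      using d(3) \<eta>(2) by (intro mult_right_mono lip_const_nonneg f) auto
    finally show "\<bar>L f - curves_boundary ws f\<bar> \<le> \<delta> * lip_const f" .
  next
    fix \<pi> and \<pi>s :: "nat \<Rightarrow> 'a \<Rightarrow> real"
    assume "\<pi> \<in> Lip" "\<forall>j. \<pi>s j \<in> Lip" "bdd_above (range (\<lambda>j. lip_const (\<pi>s j)))" "\<forall>x. (\<lambda>j. \<pi>s j x) \<longlonglongrightarrow> \<pi> x"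
    then show "(\<lambda>j. L (\<pi>s j) - curves_boundary ws (\<pi>s j)) \<longlonglongrightarrow> L \<pi> - curves_boundary ws \<pi>"
      using L by (intro tendsto_diff curves_boundary_tendsto) (auto simp: kr_functional_def)
  qed (use \<delta> in simp)
  then show ?thesis using ws(1) w by blast
qed

text \<open>Finite mass makes the set behind \<open>KR_norm\<close> bounded above, so that the
  supremum is a true bound, and it makes the boundary vanish on constants, which cannot be
  normalized. Continuity is the continuity axiom with f = 1.\<close>

lemma kr_functional_boundary:
  assumes "metric_current T"
  shows "kr_functional (boundary T) (KR_norm (boundary T))"
proof -
  obtain \<mu> where \<mu>: "mass_bound T \<mu>" using assms by (auto simp: metric_current_def)
  have lin: "linear_on_Lip (boundary T)"
    using bilinear_functionalD(2)[OF metric_current_bilinear[OF assms] Lip_b_const]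
    by (simp add: linear_on_Lip_def boundary_def)
  have bd: "\<bar>boundary T f\<bar> \<le> lip_const f * (LINT x|\<mu>. 1)" if "f \<in> Lip" for f
    using mass_boundD[OF \<mu> Lip_b_const that, of 1] by (simp add: boundary_def)
  have bdd: "bdd_above (boundary T ` Lip_1)"
  proof (rule bdd_aboveI2)
    fix f :: "'a \<Rightarrow> real" assume "f \<in> Lip_1"
    then have f: "1-lipschitz_on UNIV f" by (simp add: Lip_1_def)
    have "boundary T f \<le> lip_const f * (LINT x|\<mu>. 1)" using bd[OF LipI[OF f]] by linarith
    also have "\<dots> \<le> 1 * (LINT x|\<mu>. 1)" by (intro mult_right_mono lip_const_le[OF f]) auto
    finally show "boundary T f \<le> (LINT x|\<mu>. 1)" by simp
  qed
  have le: "boundary T f \<le> KR_norm (boundary T)" if "1-lipschitz_on UNIV f" for f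
    unfolding KR_norm_def using that by (intro cSUP_upper bdd) (simp add: Lip_1_def)
  have "boundary T (\<lambda>_. 0) = 0" using linear_on_LipD(2)[OF lin Lip_const[of 0], of 0] by simp
  moreover have "1-lipschitz_on UNIV (\<lambda>_ :: 'a. 0 :: real)" by (rule lipschitz_onI) auto
  ultimately have nonneg: "0 \<le> KR_norm (boundary T)" using le by metis
  have half: "boundary T f \<le> KR_norm (boundary T) * lip_const f" if f: "f \<in> Lip" for f
  proof (cases "lip_const f = 0")
    case True
    then show ?thesis using bd[OF f] by simp
  next
    case False
    then have l: "lip_const f > 0" using lip_const_nonneg[OF f] by simp
    have "\<bar>1 / lip_const f\<bar> * lip_const f = 1" using l by simp
    then have "1-lipschitz_on UNIV (\<lambda>x. 1 / lip_const f * f x)"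
      using lipschitz_on_cmult_real[OF lipschitz_lip_const[OF f], of "1 / lip_const f"] by simp
    then have "boundary T (\<lambda>x. 1 / lip_const f * f x) \<le> KR_norm (boundary T)" by (rule le)
    then have "1 / lip_const f * boundary T f \<le> KR_norm (boundary T)"
      unfolding linear_on_LipD(2)[OF lin f] .
    then show ?thesis using l by (simp add: pos_divide_le_eq)
  qed
  have abs: "\<bar>boundary T f\<bar> \<le> KR_norm (boundary T) * lip_const f" if f: "f \<in> Lip" for f
  proof -
    have "- boundary T f \<le> KR_norm (boundary T) * lip_const (\<lambda>x. - 1 * f x)"
      using half[OF Lip_cmult[OF f, of "- 1"]] unfolding linear_on_LipD(2)[OF lin f] by simp
    also have "\<dots> \<le> KR_norm (boundary T) * lip_const f"
      using lip_const_cmult_le[OF f, of "- 1"] nonneg by (intro mult_left_mono) auto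
    finally show ?thesis using half[OF f] by (simp add: abs_le_iff)
  qed
  show ?thesis
    unfolding kr_functional_def
  proof (intro conjI ballI allI impI lin nonneg abs)
    fix \<pi> and \<pi>s :: "nat \<Rightarrow> 'a \<Rightarrow> real"
    assume "\<pi> \<in> Lip" "\<forall>j. \<pi>s j \<in> Lip" "bdd_above (range (\<lambda>j. lip_const (\<pi>s j)))" "\<forall>x. (\<lambda>j. \<pi>s j x) \<longlonglongrightarrow> \<pi> x"
    then show "(\<lambda>j. boundary T (\<pi>s j)) \<longlonglongrightarrow> boundary T \<pi>"
      unfolding boundary_def by (intro metric_current_continuous[OF assms Lip_b_const]) auto
  qed
qed

lemma kr_functional_curve_series:
  fixes L :: "('a::metric_space \<Rightarrow> real) \<Rightarrow> real"
  assumes sep: "separable_space (euclidean :: 'a topology)" and ch: "chainable \<Theta> c" and c: "c \<ge> 0"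
    and \<Theta>: "\<Theta> \<subseteq> Lip_1_curves"
    and L: "kr_functional L M" and \<epsilon>: "\<epsilon> > 0"
  obtains ws :: "nat \<Rightarrow> 'a weighted_curves" where "\<And>n. snd ` set (ws n) \<subseteq> \<Theta>"
    "summable (\<lambda>n. curves_weight (ws n))" "(\<Sum>n. curves_weight (ws n)) \<le> c * M + \<epsilon>"
    "\<And>f. f \<in> Lip \<Longrightarrow> (\<lambda>n. curves_boundary (ws n) f) sums L f"
proof -
  \<comment> \<open>These tolerances sum to \<epsilon> / (c + 1): each enters once as excess length
    and once, multiplied by c, as the error that the next step has to transport.\<close>
  define \<delta> where "\<delta> n = \<epsilon> / (c + 1) * (1 / 2) ^ Suc n" for n
  have \<delta>0: "\<delta> n > 0" for n using \<epsilon> c by (simp add: \<delta>_def)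
  have \<delta>s: "\<delta> sums (\<epsilon> / (c + 1))"
    unfolding \<delta>_def using sums_mult[OF power_half_series, of "\<epsilon> / (c + 1)"] by simp
  \<comment> \<open>m n bounds the residual before step n: M at the start, afterwards the tolerance
    of the preceding step.\<close>
  define m where "m n = (case n of 0 \<Rightarrow> M | Suc k \<Rightarrow> \<delta> k)" for n
  \<comment> \<open>Dependent choice runs over the residuals K; the lists of curves stay under an
    existential in the transition relation and are selected afterwards.\<close>
  have "\<exists>K. \<forall>n. (kr_functional (K n) (m n) \<and> (n = 0 \<longrightarrow> K n = L)) \<and>
    (\<exists>ws. snd ` set ws \<subseteq> \<Theta> \<and> curves_weight ws \<le> c * m n + \<delta> n \<and> K (Suc n) = (\<lambda>f. K n f - curves_boundary ws f))"
  proof (rule dependent_nat_choice[of "\<lambda>n K. kr_functional K (m n) \<and> (n = 0 \<longrightarrow> K = L)"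
        "\<lambda>n K K'. \<exists>ws. snd ` set ws \<subseteq> \<Theta> \<and> curves_weight ws \<le> c * m n + \<delta> n \<and> K' = (\<lambda>f. K f - curves_boundary ws f)"])
    show "\<exists>K. kr_functional K (m 0) \<and> ((0::nat) = 0 \<longrightarrow> K = L)" using L by (auto simp: m_def)
    fix K n assume "kr_functional K (m n) \<and> (n = 0 \<longrightarrow> K = L)"
    then obtain ws where "snd ` set ws \<subseteq> \<Theta>" "curves_weight ws \<le> c * m n + \<delta> n"
      "kr_functional (\<lambda>f. K f - curves_boundary ws f) (\<delta> n)"
      using kr_functional_curve_step[OF sep ch c _ \<delta>0, of K "m n" n] by blast
    then show "\<exists>K'. (kr_functional K' (m (Suc n)) \<and> (Suc n = 0 \<longrightarrow> K' = L)) \<and>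
      (\<exists>ws. snd ` set ws \<subseteq> \<Theta> \<and> curves_weight ws \<le> c * m n + \<delta> n \<and> K' = (\<lambda>f. K f - curves_boundary ws f))"
      by (intro exI[of _ "\<lambda>f. K f - curves_boundary ws f"]) (auto simp: m_def)
  qed
  then obtain K where K': "\<And>n. kr_functional (K n) (m n) \<and> (n = 0 \<longrightarrow> K n = L)"
    and ex: "\<forall>n. \<exists>ws. snd ` set ws \<subseteq> \<Theta> \<and> curves_weight ws \<le> c * m n + \<delta> n \<and> K (Suc n) = (\<lambda>f. K n f - curves_boundary ws f)"
    by blast
  have K: "\<And>n. kr_functional (K n) (m n)" "K 0 = L" using K' by blast+
  obtain ws where ws': "\<forall>n. snd ` set (ws n) \<subseteq> \<Theta> \<and> curves_weight (ws n) \<le> c * m n + \<delta> n \<and>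
      K (Suc n) = (\<lambda>f. K n f - curves_boundary (ws n) f)"
    using choice[OF ex] by blast
  have ws: "\<And>n. snd ` set (ws n) \<subseteq> \<Theta>" "\<And>n. curves_weight (ws n) \<le> c * m n + \<delta> n"
    and KS: "\<And>n. K (Suc n) = (\<lambda>f. K n f - curves_boundary (ws n) f)"
    using ws' by blast+
  have w0: "0 \<le> curves_weight (ws n)" for n
    using ws(1)[of n] \<Theta> by (intro curves_weight_nonneg) blast
  have ms: "m sums (\<epsilon> / (c + 1) + M)"
    using sums_Suc[of m "\<epsilon> / (c + 1)"] \<delta>s by (simp add: m_def)
  have s: "(\<lambda>n. c * m n + \<delta> n) sums (c * (\<epsilon> / (c + 1) + M) + \<epsilon> / (c + 1))"
    by (intro sums_add sums_mult ms \<delta>s)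
  have tot: "c * (\<epsilon> / (c + 1) + M) + \<epsilon> / (c + 1) = c * M + \<epsilon>"
  proof -
    define x where "x = \<epsilon> / (c + 1)"
    have "(c + 1) * x = \<epsilon>" using c by (simp add: x_def)
    then show ?thesis unfolding x_def[symmetric] by (simp add: algebra_simps)
  qed
  have sw: "summable (\<lambda>n. curves_weight (ws n))"
    by (rule summable_comparison_test'[OF sums_summable[OF s]]) (use w0 ws(2) in auto)
  have "(\<Sum>n. curves_weight (ws n)) \<le> (\<Sum>n. c * m n + \<delta> n)"
    by (rule suminf_le[OF ws(2) sw sums_summable[OF s]])
  also have "\<dots> = c * M + \<epsilon>" using sums_unique[OF s] tot by simp
  finally have le: "(\<Sum>n. curves_weight (ws n)) \<le> c * M + \<epsilon>" .
  have part: "(\<Sum>k<n. curves_boundary (ws k) f) = L f - K n f" for n f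
    by (induction n) (auto simp: K(2) KS)
  have "(\<lambda>n. curves_boundary (ws n) f) sums L f" if f: "f \<in> Lip" for f
    unfolding sums_def part
  proof -
    have "(\<lambda>n. m n * lip_const f) \<longlonglongrightarrow> 0 * lip_const f"
      by (intro tendsto_mult_right summable_LIMSEQ_zero sums_summable[OF ms])
    moreover have "\<bar>K n f\<bar> \<le> m n * lip_const f" for n
      by (rule K(1)[of n, unfolded kr_functional_def, THEN conjunct2, THEN conjunct2, THEN conjunct1, rule_format, OF f])
    ultimately have "(\<lambda>n. K n f) \<longlonglongrightarrow> 0"
      by (intro Lim_null_comparison[of "\<lambda>n. K n f" "\<lambda>n. m n * lip_const f"]) auto
    then show "(\<lambda>n. L f - K n f) \<longlonglongrightarrow> L f" using tendsto_diff[OF tendsto_const, of "\<lambda>n. K n f" 0 _ "L f"] by simp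
  qed
  then show ?thesis by (rule that[OF ws(1) sw le])
qed

theorem cycle_decomposition:
  fixes T :: "'a::metric_space functional"
  assumes sep: "separable_space (euclidean :: 'a topology)" and ch: "chainable \<Theta> c" and c: "c \<ge> 0"
    and \<Theta>: "\<Theta> \<subseteq> Lip_1_curves" and T: "metric_current T" and \<epsilon>: "\<epsilon> > 0"
  shows "\<exists>C P. cycle C \<and> (\<forall>j::nat. normal_current (P j) \<and> curve_combination \<Theta> (P j)) \<and>
    (\<lambda>j. mass (T - C - P j)) \<longlonglongrightarrow> 0 \<and> (\<forall>j. mass (P j) \<le> c * KR_norm (boundary T) + \<epsilon>)"
proof -
  obtain ws :: "nat \<Rightarrow> 'a weighted_curves" where ws: "\<And>n. snd ` set (ws n) \<subseteq> \<Theta>"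
    and sw: "summable (\<lambda>n. curves_weight (ws n))"
    and wle: "(\<Sum>n. curves_weight (ws n)) \<le> c * KR_norm (boundary T) + \<epsilon>"
    and bd: "\<And>f. f \<in> Lip \<Longrightarrow> (\<lambda>n. curves_boundary (ws n) f) sums boundary T f"
    by (rule kr_functional_curve_series[OF sep ch c \<Theta> kr_functional_boundary[OF T] \<epsilon>]) blast
  have ws1: "snd ` set (ws n) \<subseteq> Lip_1_curves" for n using ws \<Theta> by blast
  note Q = current_mass_le_curves[OF ws1]
  have w0: "0 \<le> curves_weight (ws n)" for n by (rule curves_weight_nonneg[OF ws1])
  define R where "R f \<pi> = (\<Sum>n. curves_current (ws n) f \<pi>)" for f \<pi>
  have R: "current_mass_le R (\<Sum>n. curves_weight (ws n))"
    unfolding R_def[abs_def] by (rule current_mass_le_suminf(1)[OF Q sw])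
  define C where "C = T - R"
  \<comment> \<open>As the current of one concatenated list, a partial sum inherits normality and
    its form from the results about a single list.\<close>
  define P where "P j = curves_current (concat (map ws [0..<j]))" for j :: nat
  have P: "P j f \<pi> = (\<Sum>n<j. curves_current (ws n) f \<pi>)" for j f \<pi>
    by (induction j) (auto simp: P_def)
  have Pw: "curves_weight (concat (map ws [0..<j])) = (\<Sum>n<j. curves_weight (ws n))" for j
    by (induction j) auto
  have Pset: "snd ` set (concat (map ws [0..<j])) \<subseteq> \<Theta>" for j
    using ws by fastforce
  have cyc: "cycle C"
    unfolding cycle_def
  proof (intro conjI ballI)
    obtain \<mu> where "mass_bound T \<mu>" using T by (auto simp: metric_current_def)
    then have "current_mass_le T (measure \<mu> UNIV)" using T by (auto simp: current_mass_le_def)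
    then have "current_mass_le C (measure \<mu> UNIV + (\<Sum>n. curves_weight (ws n)))"
      using current_mass_le_diff[OF _ R] by (simp add: C_def fun_diff_def)
    then show "metric_current C" by (rule current_mass_le_mass)
    fix f :: "'a \<Rightarrow> real" assume f: "f \<in> Lip"
    \<comment> \<open>This equality with the boundary of T is what makes C = T - R a cycle.\<close>
    have "R (\<lambda>_. 1) f = (\<Sum>n. curves_boundary (ws n) f)"
      using boundary_curves_current[OF ws1 f] by (simp add: R_def boundary_def)
    also have "\<dots> = boundary T f" using sums_unique[OF bd[OF f]] by simp
    finally show "boundary C f = 0" by (simp add: C_def boundary_def)
  qed
  have tail: "mass (T - C - P j) \<le> (\<Sum>n. curves_weight (ws n)) - (\<Sum>n<j. curves_weight (ws n))" for j
  proof -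
    \<comment> \<open>T - C - P j is R - P j, hence the tail of the series wherever the series
      converges; that restriction to Lipschitz pairs is why \<open>current_mass_le_cong\<close> is
      invoked.\<close>
    have "current_mass_le (T - C - P j) (\<Sum>n. curves_weight (ws (n + j)))"
    proof (rule current_mass_le_cong)
      show "current_mass_le (\<lambda>f \<pi>. \<Sum>n. curves_current (ws (n + j)) f \<pi>) (\<Sum>n. curves_weight (ws (n + j)))"
        by (rule current_mass_le_suminf(1)[OF Q summable_ignore_initial_segment[OF sw]])
      fix f \<pi> :: "'a \<Rightarrow> real" assume "f \<in> Lip_b" "\<pi> \<in> Lip"
      then have "summable (\<lambda>n. curves_current (ws n) f \<pi>)" by (rule current_mass_le_suminf(2)[OF Q sw])
      from suminf_minus_initial_segment[OF this, of j]
      show "(T - C - P j) f \<pi> = (\<Sum>n. curves_current (ws (n + j)) f \<pi>)"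
        by (simp add: C_def R_def P)
    qed
    then have "mass (T - C - P j) \<le> (\<Sum>n. curves_weight (ws (n + j)))" by (rule current_mass_le_mass)
    then show ?thesis using suminf_minus_initial_segment[OF sw, of j] by simp
  qed
  have lim: "(\<lambda>j. mass (T - C - P j)) \<longlonglongrightarrow> 0"
  proof (rule tendsto_sandwich)
    show "\<forall>\<^sub>F j in sequentially. 0 \<le> mass (T - C - P j)" by (simp add: mass_nonneg)
    show "\<forall>\<^sub>F j in sequentially. mass (T - C - P j) \<le> (\<Sum>n. curves_weight (ws n)) - (\<Sum>n<j. curves_weight (ws n))"
      using tail by simp
    show "(\<lambda>j. (\<Sum>n. curves_weight (ws n)) - (\<Sum>n<j. curves_weight (ws n))) \<longlonglongrightarrow> 0"
      using tendsto_diff[OF tendsto_const summable_LIMSEQ[OF sw], of "\<Sum>n. curves_weight (ws n)"] by simp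
  qed simp
  have "mass (P j) \<le> c * KR_norm (boundary T) + \<epsilon>" for j
  proof -
    have "mass (P j) \<le> curves_weight (concat (map ws [0..<j]))"
      unfolding P_def using Pset[of j] \<Theta> by (intro current_mass_le_mass(2) current_mass_le_curves) blast
    also have "\<dots> \<le> (\<Sum>n. curves_weight (ws n))"
      unfolding Pw by (rule sum_le_suminf[OF sw]) (use w0 in auto)
    finally show ?thesis using wle by simp
  qed
  moreover have "normal_current (P j) \<and> curve_combination \<Theta> (P j)" for j
    unfolding P_def using Pset[of j] \<Theta> by (intro conjI normal_curves_current curve_combination_curves_current) blast+
  ultimately show ?thesis using cyc lim by blast
qed

section \<open>Chains of curves and the decomposition\<close>

lemma subdivided_boundary:
  fixes f :: "'a::metric_space \<Rightarrow> real"
  assumes "n > 0"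
  shows "(\<Sum>\<sigma>\<leftarrow>map (\<lambda>k t. \<theta> (real k / n + 1 / n * t)) [0..<n]. f (\<sigma> 1) - f (\<sigma> 0)) = f (\<theta> 1) - f (\<theta> 0)"
proof -
  have "(\<Sum>\<sigma>\<leftarrow>map (\<lambda>k t. \<theta> (real k / n + 1 / n * t)) [0..<m]. f (\<sigma> 1) - f (\<sigma> 0)) = f (\<theta> (real m / n)) - f (\<theta> 0)" for m
    by (induction m) (auto simp: add_divide_distrib add.commute)
  from this[of n] show ?thesis using assms by simp
qed

lemma subdivided_length:
  "(\<Sum>\<sigma>\<leftarrow>map (\<lambda>k t. \<theta> (real k / n + 1 / n * t)) [0..<m]. curve_length \<sigma>) =
    (\<Sum>k<m. curve_length (\<lambda>t. \<theta> (real k / n + 1 / n * t)))"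
  by (induction m) auto

lemma Lipschitz_curve_chain:
  fixes \<theta> :: "real \<Rightarrow> 'a::metric_space"
  assumes "Lipschitz_curve \<theta>"
  shows "\<exists>\<sigma>s. set \<sigma>s \<subseteq> Lip_1_curves \<and> (\<Sum>\<sigma>\<leftarrow>\<sigma>s. curve_length \<sigma>) = curve_length \<theta> \<and>
    (\<forall>f :: 'a \<Rightarrow> real. (\<Sum>\<sigma>\<leftarrow>\<sigma>s. f (\<sigma> 1) - f (\<sigma> 0)) = f (\<theta> 1) - f (\<theta> 0))"
proof -
  obtain L where \<theta>: "L-lipschitz_on {0..1} \<theta>" using assms by (auto simp: Lipschitz_curve_def)
  obtain n :: nat where n: "n > 0" "\<And>k. k < n \<Longrightarrow> (\<lambda>t. \<theta> (real k / n + 1 / n * t)) \<in> Lip_1_curves"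
    "(\<Sum>k<n. curve_length (\<lambda>t. \<theta> (real k / n + 1 / n * t))) = curve_length \<theta>"
    by (rule curve_subdivision[OF \<theta>]) blast
  show ?thesis
    by (intro exI[of _ "map (\<lambda>k t. \<theta> (real k / n + 1 / n * t)) [0..<n]"] conjI allI subdivided_boundary n(1))
      (use n(2,3) in \<open>auto simp only: subdivided_length set_map set_upt atLeastLessThan_iff\<close>)
qed

text \<open>The increments of f along the curves telescope up to the increments across the gaps,
  which are at most Lip(f) times the total gap.\<close>

lemma chainable_Lip_1_curves:
  assumes "piecewise_quasiconvex TYPE('a::metric_space) c"
  shows "chainable (Lip_1_curves :: (real \<Rightarrow> 'a) set) c"
  unfolding chainable_def
proof (intro allI impI)
  fix x y :: 'a and \<eta> :: real assume "\<eta> > 0"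
  have "\<forall>(x::'a) y. \<forall>\<eta>>0. \<exists>m\<ge>1. \<exists>xs ys \<theta>.
       dist x (xs 1) + dist (ys m) y + (\<Sum>i=1..m-1. dist (xs (i + 1)) (ys i)) < \<eta> \<and>
       (\<forall>i\<in>{1..m::nat}. Lipschitz_curve (\<theta> i) \<and> \<theta> i 0 = xs i \<and> \<theta> i 1 = ys i) \<and>
       (\<Sum>i=1..m. curve_length (\<theta> i)) \<le> c * dist x y"
    using assms unfolding piecewise_quasiconvex_def by (rule conjunct2)
  from this[rule_format, OF \<open>\<eta> > 0\<close>, of x y]
  obtain m :: nat and xs ys \<theta> where m: "m \<ge> 1"
    and gap: "dist x (xs 1) + dist (ys m) y + (\<Sum>i=1..m-1. dist (xs (i + 1)) (ys i)) < \<eta>"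
    and \<theta>: "\<forall>i\<in>{1..m}. Lipschitz_curve (\<theta> i) \<and> \<theta> i 0 = xs i \<and> \<theta> i 1 = ys i"
    and len: "(\<Sum>i=1..m. curve_length (\<theta> i)) \<le> c * dist x y"
    by (elim exE conjE)
  have "\<forall>i\<in>{1..m}. \<exists>\<sigma>s. set \<sigma>s \<subseteq> Lip_1_curves \<and> (\<Sum>\<sigma>\<leftarrow>\<sigma>s. curve_length \<sigma>) = curve_length (\<theta> i) \<and>
      (\<forall>f :: 'a \<Rightarrow> real. (\<Sum>\<sigma>\<leftarrow>\<sigma>s. f (\<sigma> 1) - f (\<sigma> 0)) = f (ys i) - f (xs i))"
  proof
    fix i assume "i \<in> {1..m}"
    then have i: "Lipschitz_curve (\<theta> i)" "\<theta> i 0 = xs i" "\<theta> i 1 = ys i" using \<theta> by blast+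
    show "\<exists>\<sigma>s. set \<sigma>s \<subseteq> Lip_1_curves \<and> (\<Sum>\<sigma>\<leftarrow>\<sigma>s. curve_length \<sigma>) = curve_length (\<theta> i) \<and>
      (\<forall>f :: 'a \<Rightarrow> real. (\<Sum>\<sigma>\<leftarrow>\<sigma>s. f (\<sigma> 1) - f (\<sigma> 0)) = f (ys i) - f (xs i))"
      using Lipschitz_curve_chain[OF i(1)] unfolding i .
  qed
  then obtain \<sigma> where \<sigma>: "\<forall>i\<in>{1..m}. set (\<sigma> i) \<subseteq> Lip_1_curves \<and> (\<Sum>\<sigma>\<leftarrow>\<sigma> i. curve_length \<sigma>) = curve_length (\<theta> i) \<and>
      (\<forall>f :: 'a \<Rightarrow> real. (\<Sum>\<sigma>\<leftarrow>\<sigma> i. f (\<sigma> 1) - f (\<sigma> 0)) = f (ys i) - f (xs i))"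
    by (elim bchoice[THEN exE])
  have sums: "(\<Sum>\<sigma>\<leftarrow>concat (map \<sigma> [1..<Suc k]). g \<sigma>) = (\<Sum>i=1..k. \<Sum>\<sigma>\<leftarrow>\<sigma> i. g \<sigma>)" for k and g :: "(real \<Rightarrow> 'a) \<Rightarrow> real"
    by (induction k) auto
  let ?\<sigma>s = "concat (map \<sigma> [1..<Suc m])"
  show "\<exists>\<sigma>s. set \<sigma>s \<subseteq> Lip_1_curves \<and> (\<Sum>\<sigma>\<leftarrow>\<sigma>s. curve_length \<sigma>) \<le> c * dist x y \<and>
    (\<forall>f\<in>Lip. \<bar>f y - f x - (\<Sum>\<sigma>\<leftarrow>\<sigma>s. f (\<sigma> 1) - f (\<sigma> 0))\<bar> \<le> \<eta> * lip_const f)"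
  proof (intro exI[of _ ?\<sigma>s] conjI ballI)
    show "set ?\<sigma>s \<subseteq> Lip_1_curves" using \<sigma> by auto
    have "(\<Sum>i=1..m. \<Sum>\<sigma>\<leftarrow>\<sigma> i. curve_length \<sigma>) = (\<Sum>i=1..m. curve_length (\<theta> i))"
      using \<sigma> by (intro sum.cong) auto
    then show "(\<Sum>\<sigma>\<leftarrow>?\<sigma>s. curve_length \<sigma>) \<le> c * dist x y" unfolding sums using len by simp
    fix f :: "'a \<Rightarrow> real" assume f: "f \<in> Lip"
    \<comment> \<open>Regrouping by gaps: gap i leads from \<open>ys i\<close> to
      \<open>xs (i + 1)\<close>, so there is one gap fewer than curves.\<close>
    have *: "(\<Sum>i=1..Suc k. f (ys i) - f (xs i)) = f (ys (Suc k)) - f (xs 1) - (\<Sum>i=1..k. f (xs (i + 1)) - f (ys i))" for k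
      by (induction k) auto
    have "(\<Sum>\<sigma>\<leftarrow>?\<sigma>s. f (\<sigma> 1) - f (\<sigma> 0)) = (\<Sum>i=1..m. f (ys i) - f (xs i))"
      unfolding sums using \<sigma> by (intro sum.cong) auto
    also have "\<dots> = f (ys m) - f (xs 1) - (\<Sum>i=1..m-1. f (xs (i + 1)) - f (ys i))"
      using *[of "m - 1"] m by simp
    finally have "\<bar>f y - f x - (\<Sum>\<sigma>\<leftarrow>?\<sigma>s. f (\<sigma> 1) - f (\<sigma> 0))\<bar> =
      \<bar>(f y - f (ys m)) + (f (xs 1) - f x) + (\<Sum>i=1..m-1. f (xs (i + 1)) - f (ys i))\<bar>" by simp
    also have "\<dots> \<le> \<bar>f (ys m) - f y\<bar> + \<bar>f x - f (xs 1)\<bar> + (\<Sum>i=1..m-1. \<bar>f (xs (i + 1)) - f (ys i)\<bar>)"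
      using sum_abs[of "\<lambda>i. f (xs (i + 1)) - f (ys i)" "{1..m-1}"] by linarith
    also have "\<dots> \<le> lip_const f * dist (ys m) y + lip_const f * dist x (xs 1) + (\<Sum>i=1..m-1. lip_const f * dist (xs (i + 1)) (ys i))"
      by (intro add_mono sum_mono Lip_dist_le[OF f])
    also have "\<dots> = lip_const f * (dist x (xs 1) + dist (ys m) y + (\<Sum>i=1..m-1. dist (xs (i + 1)) (ys i)))"
      by (simp add: sum_distrib_left algebra_simps)
    also have "\<dots> \<le> lip_const f * \<eta>"
      using gap by (intro mult_left_mono lip_const_nonneg[OF f]) simp
    finally show "\<bar>f y - f x - (\<Sum>\<sigma>\<leftarrow>?\<sigma>s. f (\<sigma> 1) - f (\<sigma> 0))\<bar> \<le> \<eta> * lip_const f" by (simp add: mult.commute)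
  qed
qed

lemma chainableI_exact:
  fixes \<Theta> :: "(real \<Rightarrow> 'a::metric_space) set"
  assumes "\<And>x y :: 'a. \<exists>\<sigma>s. set \<sigma>s \<subseteq> \<Theta> \<and> (\<Sum>\<sigma>\<leftarrow>\<sigma>s. curve_length \<sigma>) \<le> c * dist x y \<and>
    (\<forall>f :: 'a \<Rightarrow> real. (\<Sum>\<sigma>\<leftarrow>\<sigma>s. f (\<sigma> 1) - f (\<sigma> 0)) = f y - f x)"
  shows "chainable \<Theta> c"
  unfolding chainable_def
proof (intro allI impI)
  fix x y :: 'a and \<eta> :: real assume "\<eta> > 0"
  obtain \<sigma>s where "set \<sigma>s \<subseteq> \<Theta>" "(\<Sum>\<sigma>\<leftarrow>\<sigma>s. curve_length \<sigma>) \<le> c * dist x y"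
    "\<And>f :: 'a \<Rightarrow> real. (\<Sum>\<sigma>\<leftarrow>\<sigma>s. f (\<sigma> 1) - f (\<sigma> 0)) = f y - f x"
    using assms by blast
  then show "\<exists>\<sigma>s. set \<sigma>s \<subseteq> \<Theta> \<and> (\<Sum>\<sigma>\<leftarrow>\<sigma>s. curve_length \<sigma>) \<le> c * dist x y \<and>
    (\<forall>f\<in>Lip. \<bar>f y - f x - (\<Sum>\<sigma>\<leftarrow>\<sigma>s. f (\<sigma> 1) - f (\<sigma> 0))\<bar> \<le> \<eta> * lip_const f)"
    using \<open>\<eta> > 0\<close> by (intro exI[of _ \<sigma>s]) (auto intro!: mult_nonneg_nonneg lip_const_nonneg)
qed

lemma chainable_geodesics:
  assumes "geodesic_space TYPE('a::metric_space)"
  shows "chainable (Lip_1_curves \<inter> Collect geodesic :: (real \<Rightarrow> 'a) set) 1"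
proof (rule chainableI_exact)
  fix x y :: 'a
  obtain \<theta> where \<theta>: "geodesic \<theta>" "\<theta> 0 = x" "\<theta> 1 = y"
    using assms unfolding geodesic_space_def by blast
  obtain n :: nat where n: "n > 0"
    "\<And>k. k < n \<Longrightarrow> (\<lambda>t. \<theta> (real k / n + 1 / n * t)) \<in> Lip_1_curves \<inter> Collect geodesic"
    "(\<Sum>k<n. curve_length (\<lambda>t. \<theta> (real k / n + 1 / n * t))) = curve_length \<theta>"
    by (rule geodesic_subdivision[OF \<theta>(1)]) blast
  let ?\<sigma>s = "map (\<lambda>k t. \<theta> (real k / n + 1 / n * t)) [0..<n]"
  have "set ?\<sigma>s \<subseteq> Lip_1_curves \<inter> Collect geodesic"
    unfolding set_map set_upt by (intro image_subsetI n(2)) simp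
  moreover have "(\<Sum>\<sigma>\<leftarrow>?\<sigma>s. curve_length \<sigma>) \<le> 1 * dist x y"
    unfolding subdivided_length n(3) using \<theta> by (simp add: geodesic_def)
  moreover have "(\<Sum>\<sigma>\<leftarrow>?\<sigma>s. f (\<sigma> 1) - f (\<sigma> 0)) = f y - f x" for f :: "'a \<Rightarrow> real"
    using subdivided_boundary[OF n(1), of f \<theta>] \<theta> by simp
  ultimately show "\<exists>\<sigma>s. set \<sigma>s \<subseteq> Lip_1_curves \<inter> Collect geodesic \<and> (\<Sum>\<sigma>\<leftarrow>\<sigma>s. curve_length \<sigma>) \<le> 1 * dist x y \<and>
    (\<forall>f :: 'a \<Rightarrow> real. (\<Sum>\<sigma>\<leftarrow>\<sigma>s. f (\<sigma> 1) - f (\<sigma> 0)) = f y - f x)" by blast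
qed

lemma chainable_segments:
  "chainable (Lip_1_curves \<inter> segments :: (real \<Rightarrow> 'a::real_normed_vector) set) 1"
proof (rule chainableI_exact)
  fix x y :: 'a
  let ?\<theta> = "\<lambda>t. (1 - t) *\<^sub>R x + t *\<^sub>R y"
  note lip = segment_length(1)[of x y]
  obtain n :: nat where n: "n > 0"
    "\<And>k. k < n \<Longrightarrow> (\<lambda>t. ?\<theta> (real k / n + 1 / n * t)) \<in> Lip_1_curves"
    "(\<Sum>k<n. curve_length (\<lambda>t. ?\<theta> (real k / n + 1 / n * t))) = curve_length ?\<theta>"
    by (rule curve_subdivision[OF lip]) blast
  let ?\<sigma>s = "map (\<lambda>k t. ?\<theta> (real k / n + 1 / n * t)) [0..<n]"
  \<comment> \<open>An affine reparametrization of a segment is the segment between its new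
    endpoints, so the 1-Lipschitz pieces remain segments.\<close>
  have seg: "(\<lambda>t. ?\<theta> (p + q * t)) \<in> segments" for p q :: real
  proof -
    have "(\<lambda>t. ?\<theta> (p + q * t)) = (\<lambda>t. (1 - t) *\<^sub>R ?\<theta> p + t *\<^sub>R ?\<theta> (p + q))"
      by (simp add: fun_eq_iff algebra_simps)
    then show ?thesis unfolding segments_def by (intro image_eqI[of _ _ "(?\<theta> p, ?\<theta> (p + q))"]) auto
  qed
  have "set ?\<sigma>s \<subseteq> Lip_1_curves \<inter> segments"
    unfolding set_map set_upt by (intro image_subsetI IntI n(2) seg) simp
  moreover have "(\<Sum>\<sigma>\<leftarrow>?\<sigma>s. curve_length \<sigma>) \<le> 1 * dist x y"
    unfolding subdivided_length[where \<theta> = ?\<theta>] n(3) using segment_length(2)[of x y] by simp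
  moreover have "(\<Sum>\<sigma>\<leftarrow>?\<sigma>s. f (\<sigma> 1) - f (\<sigma> 0)) = f y - f x" for f :: "'a \<Rightarrow> real"
    using subdivided_boundary[OF n(1), of f ?\<theta>] by simp
  ultimately show "\<exists>\<sigma>s. set \<sigma>s \<subseteq> Lip_1_curves \<inter> segments \<and> (\<Sum>\<sigma>\<leftarrow>\<sigma>s. curve_length \<sigma>) \<le> 1 * dist x y \<and>
    (\<forall>f :: 'a \<Rightarrow> real. (\<Sum>\<sigma>\<leftarrow>\<sigma>s. f (\<sigma> 1) - f (\<sigma> 0)) = f y - f x)" by blast
qed

text \<open>Geodesics and segments chain points with constant 1, whereas the bound in the theorem is
  stated with c \<ge> 1.\<close>

lemma chainable_mono:
  assumes "chainable \<Theta> c" "c \<le> c'" shows "chainable \<Theta> c'"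
  unfolding chainable_def
proof (intro allI impI)
  fix x y and \<eta> :: real assume "\<eta> > 0"
  then obtain \<sigma>s where "set \<sigma>s \<subseteq> \<Theta>" "(\<Sum>\<sigma>\<leftarrow>\<sigma>s. curve_length \<sigma>) \<le> c * dist x y"
    "\<forall>f\<in>Lip. \<bar>f y - f x - (\<Sum>\<sigma>\<leftarrow>\<sigma>s. f (\<sigma> 1) - f (\<sigma> 0))\<bar> \<le> \<eta> * lip_const f"
    using assms(1) unfolding chainable_def by blast
  moreover have "c * dist x y \<le> c' * dist x y" using assms(2) by (intro mult_right_mono) auto
  ultimately show "\<exists>\<sigma>s. set \<sigma>s \<subseteq> \<Theta> \<and> (\<Sum>\<sigma>\<leftarrow>\<sigma>s. curve_length \<sigma>) \<le> c' * dist x y \<and>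
    (\<forall>f\<in>Lip. \<bar>f y - f x - (\<Sum>\<sigma>\<leftarrow>\<sigma>s. f (\<sigma> 1) - f (\<sigma> 0))\<bar> \<le> \<eta> * lip_const f)"
    by (intro exI[of _ \<sigma>s]) auto
qed

theorem theoremB:
  fixes T :: "'a::metric_space functional"
    and S :: "'b::banach functional"
    and c \<epsilon> :: real
  assumes "\<epsilon> > 0"
  shows
    "(separable_space (euclidean :: 'a topology) \<and> piecewise_quasiconvex TYPE('a) c \<and>
      metric_current T \<longrightarrow>
        (\<exists>C P. cycle C \<and>
           (\<forall>j::nat. normal_current (P j) \<and> curve_combination Lip_1_curves (P j)) \<and>
           (\<lambda>j. mass (T - C - P j)) \<longlonglongrightarrow> 0 \<and>
           (\<forall>j. mass (P j) \<le> c * KR_norm (boundary T) + \<epsilon>)) \<and>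
        (geodesic_space TYPE('a) \<longrightarrow>
          (\<exists>C P. cycle C \<and>
             (\<forall>j::nat. normal_current (P j) \<and>
                curve_combination (Lip_1_curves \<inter> Collect geodesic) (P j)) \<and>
             (\<lambda>j. mass (T - C - P j)) \<longlonglongrightarrow> 0 \<and>
             (\<forall>j. mass (P j) \<le> c * KR_norm (boundary T) + \<epsilon>)))) \<and>
     (separable_space (euclidean :: 'b topology) \<and> piecewise_quasiconvex TYPE('b) c \<and>
      metric_current S \<longrightarrow>
        (\<exists>C P. cycle C \<and>
           (\<forall>j::nat. normal_current (P j) \<and> curve_combination Lip_1_curves (P j) \<and>
              polyhedral (P j)) \<and>
           (\<lambda>j. mass (S - C - P j)) \<longlonglongrightarrow> 0 \<and>
           (\<forall>j. mass (P j) \<le> c * KR_norm (boundary S) + \<epsilon>)))"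
proof (intro conjI impI; (elim conjE)?)
  assume sep: "separable_space (euclidean :: 'a topology)" and qc: "piecewise_quasiconvex TYPE('a) c"
    and T: "metric_current T"
  have c: "1 \<le> c" using qc by (simp add: piecewise_quasiconvex_def)
  then have c0: "0 \<le> c" by simp
  show "\<exists>C P. cycle C \<and> (\<forall>j::nat. normal_current (P j) \<and> curve_combination Lip_1_curves (P j)) \<and>
      (\<lambda>j. mass (T - C - P j)) \<longlonglongrightarrow> 0 \<and> (\<forall>j. mass (P j) \<le> c * KR_norm (boundary T) + \<epsilon>)"
    by (rule cycle_decomposition[OF sep chainable_Lip_1_curves[OF qc] c0 order_refl T assms])
  assume "geodesic_space TYPE('a)"
  note ch = chainable_mono[OF chainable_geodesics[OF this] c]
  show "\<exists>C P. cycle C \<and> (\<forall>j::nat. normal_current (P j) \<and> curve_combination (Lip_1_curves \<inter> Collect geodesic) (P j)) \<and>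
      (\<lambda>j. mass (T - C - P j)) \<longlonglongrightarrow> 0 \<and> (\<forall>j. mass (P j) \<le> c * KR_norm (boundary T) + \<epsilon>)"
    by (rule cycle_decomposition[OF sep ch c0 Int_lower1 T assms])
next
  assume sep: "separable_space (euclidean :: 'b topology)" and qc: "piecewise_quasiconvex TYPE('b) c"
    and S: "metric_current S"
  have c: "1 \<le> c" using qc by (simp add: piecewise_quasiconvex_def)
  then have c0: "0 \<le> c" by simp
  \<comment> \<open>A single run with 1-Lipschitz segments gives one sequence that has both required
    forms.\<close>
  obtain C P where CP: "cycle C"
    "\<And>j::nat. normal_current (P j) \<and> curve_combination (Lip_1_curves \<inter> segments) (P j)"
    "(\<lambda>j. mass (S - C - P j)) \<longlonglongrightarrow> 0" "\<And>j. mass (P j) \<le> c * KR_norm (boundary S) + \<epsilon>"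
    using cycle_decomposition[OF sep chainable_mono[OF chainable_segments c] c0 Int_lower1 S assms] by blast
  have "curve_combination Lip_1_curves (P j) \<and> polyhedral (P j)" for j
    using CP(2)[of j] curve_combination_mono[OF _ Int_lower1] curve_combination_mono[OF _ Int_lower2]
      polyhedral_curve_combination by blast
  then show "\<exists>C P. cycle C \<and> (\<forall>j::nat. normal_current (P j) \<and> curve_combination Lip_1_curves (P j) \<and> polyhedral (P j)) \<and>
      (\<lambda>j. mass (S - C - P j)) \<longlonglongrightarrow> 0 \<and> (\<forall>j. mass (P j) \<le> c * KR_norm (boundary S) + \<epsilon>)"
    using CP by blast
qed

end
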